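(* Let $k\geq 1$, let $M$ be a smooth manifold, and let $\mu:A\to\wedge^kT^*M$ be a $k$-Poisson structure on $M$, where $A\to M$ is a Lie algebroid. Then $\mu$ is equivalent to a subbundle $L\subset TM\oplus\wedge^kT^*M$ which is isotropic, involutive, and satisfies $L^\perp\cap TM=\{0\}$. That is, there exist such a subbundle $L$ and an isomorphism of Lie algebroids $\phi:A\to L$ (covering the identity of $M$) such that $\mathrm{pr}_2|_L\circ\phi=\mu$.
   Context: Everything is smooth. A closed IM $(k+1)$-form on a Lie algebroid $A\to M$ with anchor $\rho:A\to TM$ is a vector-bundle map $\mu:A\to\wedge^kT^*M$ covering the identity of $M$ such that, for all $u,v\in\Gamma(A)$, $$i_{\rho(u)}\mu(v)=-i_{\rho(v)}\mu(u),\qquad \mu([u,v])=\mathcal{L}_{\rho(u)}\mu(v)-i_{\rho(v)}d(\mu(u)).$$ A $k$-Poisson structure on $M$ (also called an IM $k$-plectic form) is a closed IM $(k+1)$-form $\mu:A\to\wedge^kT^*M$ on some Lie algebroid $A\to M$ such that (1) $\ker\mu=\{0\}$, and (2) $\{X\in TM \mid i_X\mu(u)=0\ \forall u\in A\}=\{0\}$ (fibrewise: for $X\in T_xM$, $u$ ranges over $A|_x$). Two IM $(k+1)$-forms $\mu_1:A_1\to\wedge^kT^*M$ and $\mu_2:A_2\to\wedge^kT^*M$ are equivalent if there is a Lie-algebroid isomorphism $\phi:A_1\to A_2$ with $\mu_2\circ\phi=\mu_1$. Let $\mathbb{T}M^{(k)}=TM\oplus\wedge^kT^*M$ with projections $\mathrm{pr}_1:\mathbb{T}M^{(k)}\to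 TM$ and $\mathrm{pr}_2:\mathbb{T}M^{(k)}\to\wedge^kT^*M$. It carries the fibrewise symmetric $\wedge^{k-1}T^*M$-valued pairing $$\langle (X,\alpha),(Y,\beta)\rangle=i_X\beta+i_Y\alpha$$ and, on sections, the (higher) Courant–Dorfman bracket $$[\![(X,\alpha),(Y,\beta)]\!]=([X,Y],\ \mathcal{L}_X\beta-i_Yd\alpha).$$ For a subbundle $L\subset\mathbb{T}M^{(k)}$, $L^\perp$ denotes its fibrewise orthogonal with respect to $\langle\cdot,\cdot\rangle$ (possibly of non-constant rank); $L$ is isotropic if $L\subset L^\perp$, and involutive if $\Gamma(L)$ is closed under $[\![\cdot,\cdot]\!]$. $TM$ is regarded as the subbundle $TM\oplus 0$ of $\mathbb{T}M^{(k)}$. An isotropic, involutive subbundle $L$ is a Lie algebroid with anchor $\mathrm{pr}_1|_L$ and bracket $[\![\cdot,\cdot]\!]|_{\Gamma(L)}$, and $\mathrm{pr}_2|_L:L\to\wedge^kT^*M$ is a closed IM $(k+1)$-form on it, which is a $k$-Poisson structure if and only if $L^\perp\cap TM=\{0\}$; such an $L$ is identified with the $k$-Poisson structure $\mathrm{pr}_2|_L$. *)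

theory Defs
  imports "HOL-Analysis.Analysis" "HOL-Library.Function_Algebras"
begin

text \<open>Functions into a real vector space form a real vector space under the pointwise operations;
  tangent vectors and exterior forms at a point are functions and inherit this structure.\<close>

instantiation "fun" :: (type, real_vector) real_vector
begin

definition scaleR_fun :: "real \<Rightarrow> ('a \<Rightarrow> 'b) \<Rightarrow> 'a \<Rightarrow> 'b"
  where "scaleR_fun r f = (\<lambda>x. r *\<^sub>R f x)"

instance
  by standard (auto simp: scaleR_fun_def plus_fun_def scaleR_add_right scaleR_add_left)

end


subsection \<open>Smooth functions on \<open>\<real>\<^sup>n\<close>\<close>

text \<open>\<open>\<real>\<^sup>n\<close> is the library space \<open>Euclidean_space n\<close>: sequences that vanish from index \<open>n\<close> on.
  The dimension is thus an arbitrary natural number, zero included.\<close>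

definition partial :: "nat \<Rightarrow> ((nat \<Rightarrow> real) \<Rightarrow> real) \<Rightarrow> (nat \<Rightarrow> real) \<Rightarrow> real"
  where "partial i f x = deriv (\<lambda>t. f (x(i := t))) (x i)"

primrec iter_partial :: "nat list \<Rightarrow> ((nat \<Rightarrow> real) \<Rightarrow> real) \<Rightarrow> (nat \<Rightarrow> real) \<Rightarrow> real"
  where
    "iter_partial [] f = f"
  | "iter_partial (i # is) f = partial i (iter_partial is f)"

text \<open>\<open>C\<^sup>\<infinity>\<close>: all iterated partial derivatives exist and are continuous.  This is meant for \<open>V\<close> open in
  \<open>\<real>\<^sup>n\<close>; the values of \<open>f\<close> outside \<open>V\<close> are then irrelevant.\<close>

definition smooth_Rn :: "nat \<Rightarrow> (nat \<Rightarrow> real) set \<Rightarrow> ((nat \<Rightarrow> real) \<Rightarrow> real) \<Rightarrow> bool"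
  where "smooth_Rn n V f \<longleftrightarrow>
    (\<forall>is. set is \<subseteq> {..<n} \<longrightarrow>
       continuous_on V (iter_partial is f) \<and>
       (\<forall>x\<in>V. \<forall>i<n. (\<lambda>t. iter_partial is f (x(i := t))) field_differentiable at (x i)))"


subsection \<open>Smooth manifolds\<close>

text \<open>A manifold is the whole type \<open>'m\<close>, with its topology, together with a smooth atlas.
  A chart is a pair \<open>(U, c)\<close>; the values of \<open>c\<close> outside \<open>U\<close> are irrelevant.\<close>

type_synonym 'm chart = "'m set \<times> ('m \<Rightarrow> nat \<Rightarrow> real)"

record 'm manifold =
  mdim :: nat
  atlas :: "'m chart set"

definition smooth_manifold :: "('m::{t2_space, second_countable_topology}) manifold \<Rightarrow> bool"
  where "smooth_manifold M \<longleftrightarrow>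
    (\<Union>(U, c)\<in>atlas M. U) = UNIV \<and>
    (\<forall>(U, c)\<in>atlas M. open U \<and> openin (Euclidean_space (mdim M)) (c ` U) \<and>
       homeomorphic_map (top_of_set U) (subtopology (Euclidean_space (mdim M)) (c ` U)) c) \<and>
    (\<forall>(U, c)\<in>atlas M. \<forall>(V, d)\<in>atlas M. \<forall>i<mdim M.
       smooth_Rn (mdim M) (c ` (U \<inter> V)) (\<lambda>x. d (inv_into U c x) i))"

definition smooth_on :: "('m::topological_space) manifold \<Rightarrow> 'm set \<Rightarrow> ('m \<Rightarrow> real) \<Rightarrow> bool"
  where "smooth_on M W f \<longleftrightarrow>
    (\<forall>(U, c)\<in>atlas M. smooth_Rn (mdim M) (c ` (U \<inter> W)) (f \<circ> inv_into U c))"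

definition smooth_near :: "('m::topological_space) manifold \<Rightarrow> 'm \<Rightarrow> ('m \<Rightarrow> real) \<Rightarrow> bool"
  where "smooth_near M p f \<longleftrightarrow> (\<exists>W. open W \<and> p \<in> W \<and> smooth_on M W f)"


subsection \<open>Smooth vector bundles\<close>

text \<open>The fibres of a bundle are linear subspaces of one real vector space \<open>'a\<close>, which plays no other
  role (any family of vector spaces embeds into its direct sum); the total space is the disjoint
  union of the fibres.  The smooth structure is a bundle atlas: a local trivialization over \<open>U\<close> is a
  family \<open>\<psi> p\<close>, \<open>p \<in> U\<close>, of linear isomorphisms from the fibres onto \<open>\<real>\<^sup>I\<close>, where \<open>I\<close> is a finite
  index set whose cardinality is the rank.\<close>

record ('m, 'a, 'i) vbundle =
  fib :: "'m \<Rightarrow> 'a set"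
  idx :: "'i set"
  triv :: "('m set \<times> ('m \<Rightarrow> 'a \<Rightarrow> 'i \<Rightarrow> real)) set"

definition linear_over :: "('a::real_vector) set \<Rightarrow> ('a \<Rightarrow> 'b::real_vector) \<Rightarrow> bool"
  where "linear_over V f \<longleftrightarrow>
    (\<forall>a\<in>V. \<forall>b\<in>V. f (a + b) = f a + f b) \<and> (\<forall>r. \<forall>a\<in>V. f (r *\<^sub>R a) = r *\<^sub>R f a)"

definition coord_space :: "'i set \<Rightarrow> ('i \<Rightarrow> real) set"
  where "coord_space I = {x. \<forall>i. i \<notin> I \<longrightarrow> x i = 0}"

text \<open>The local frame belonging to a trivialization.\<close>

definition frame_vec ::
    "('m, 'a, 'i, 'z) vbundle_scheme \<Rightarrow> ('m \<Rightarrow> 'a \<Rightarrow> 'i \<Rightarrow> real) \<Rightarrow> 'm \<Rightarrow> 'i \<Rightarrow> 'a"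
  where "frame_vec E \<psi> p j = inv_into (fib E p) (\<psi> p) (\<lambda>i. if i = j then 1 else 0)"

definition vector_bundle ::
    "('m::topological_space) manifold \<Rightarrow> ('m, 'a::real_vector, 'i, 'z) vbundle_scheme \<Rightarrow> bool"
  where "vector_bundle M E \<longleftrightarrow>
    finite (idx E) \<and> (\<forall>p. subspace (fib E p)) \<and>
    (\<Union>(U, \<psi>)\<in>triv E. U) = UNIV \<and>
    (\<forall>(U, \<psi>)\<in>triv E. open U \<and>
       (\<forall>p\<in>U. linear_over (fib E p) (\<psi> p) \<and> bij_betw (\<psi> p) (fib E p) (coord_space (idx E)))) \<and>
    (\<forall>(U, \<psi>)\<in>triv E. \<forall>(V, \<theta>)\<in>triv E. \<forall>i\<in>idx E. \<forall>j\<in>idx E.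
       smooth_on M (U \<inter> V) (\<lambda>p. \<theta> p (frame_vec E \<psi> p j) i))"

definition smooth_section ::
    "('m::topological_space) manifold \<Rightarrow> ('m, 'a, 'i, 'z) vbundle_scheme \<Rightarrow> 'm set \<Rightarrow> ('m \<Rightarrow> 'a) \<Rightarrow> bool"
  where "smooth_section M E W s \<longleftrightarrow>
    (\<forall>p\<in>W. s p \<in> fib E p) \<and>
    (\<forall>(U, \<psi>)\<in>triv E. \<forall>i\<in>idx E. smooth_on M (U \<inter> W) (\<lambda>p. \<psi> p (s p) i))"

definition sections ::
    "('m::topological_space) manifold \<Rightarrow> ('m, 'a, 'i, 'z) vbundle_scheme \<Rightarrow> ('m \<Rightarrow> 'a) set"
  where "sections M E = {s. smooth_section M E UNIV s}"

text \<open>Smooth vector bundle maps over the identity: fibrewise linear, with smooth matrix entries in local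
  trivializations.\<close>

definition vb_map ::
    "('m::topological_space) manifold \<Rightarrow> ('m, 'a::real_vector, 'i, 'y) vbundle_scheme \<Rightarrow>
     ('m, 'b::real_vector, 'j, 'z) vbundle_scheme \<Rightarrow> ('m \<Rightarrow> 'a \<Rightarrow> 'b) \<Rightarrow> bool"
  where "vb_map M E F \<Phi> \<longleftrightarrow>
    (\<forall>p. \<Phi> p ` fib E p \<subseteq> fib F p \<and> linear_over (fib E p) (\<Phi> p)) \<and>
    (\<forall>(U, \<psi>)\<in>triv E. \<forall>(V, \<theta>)\<in>triv F. \<forall>j\<in>idx E. \<forall>i\<in>idx F.
       smooth_on M (U \<inter> V) (\<lambda>p. \<theta> p (\<Phi> p (frame_vec E \<psi> p j)) i))"

definition vb_iso ::
    "('m::topological_space) manifold \<Rightarrow> ('m, 'a::real_vector, 'i, 'y) vbundle_scheme \<Rightarrow>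
     ('m, 'b::real_vector, 'j, 'z) vbundle_scheme \<Rightarrow> ('m \<Rightarrow> 'a \<Rightarrow> 'b) \<Rightarrow> bool"
  where "vb_iso M E F \<Phi> \<longleftrightarrow>
    vb_map M E F \<Phi> \<and> (\<forall>p. bij_betw (\<Phi> p) (fib E p) (fib F p)) \<and>
    vb_map M F E (\<lambda>p. inv_into (fib E p) (\<Phi> p))"

definition direct_sum ::
    "('m, 'a::real_vector, 'i) vbundle \<Rightarrow> ('m, 'b::real_vector, 'j) vbundle \<Rightarrow> ('m, 'a \<times> 'b, 'i + 'j) vbundle"
  where "direct_sum E F =
    \<lparr>fib = (\<lambda>p. fib E p \<times> fib F p), idx = idx E <+> idx F,
     triv = {(U \<inter> V, \<lambda>p (a, b). case_sum (\<psi> p a) (\<theta> p b)) | U \<psi> V \<theta>.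
               (U, \<psi>) \<in> triv E \<and> (V, \<theta>) \<in> triv F}\<rparr>"

definition local_frame ::
    "('m::topological_space) manifold \<Rightarrow> ('m, 'a::real_vector, 'i) vbundle \<Rightarrow> nat \<Rightarrow> ('m \<Rightarrow> 'a set) \<Rightarrow>
     'm set \<Rightarrow> (nat \<Rightarrow> 'm \<Rightarrow> 'a) \<Rightarrow> bool"
  where "local_frame M E r L U e \<longleftrightarrow>
    open U \<and> (\<forall>i<r. smooth_section M E U (e i)) \<and>
    (\<forall>p\<in>U. inj_on (\<lambda>i. e i p) {..<r} \<and> independent ((\<lambda>i. e i p) ` {..<r}) \<and>
       span ((\<lambda>i. e i p) ` {..<r}) = L p)"

definition is_subbundle ::
    "('m::topological_space) manifold \<Rightarrow> ('m, 'a::real_vector, 'i) vbundle \<Rightarrow> nat \<Rightarrow> ('m \<Rightarrow> 'a set) \<Rightarrow> bool"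
  where "is_subbundle M E r L \<longleftrightarrow>
    (\<forall>p. subspace (L p) \<and> L p \<subseteq> fib E p) \<and>
    (\<forall>p. \<exists>U e. p \<in> U \<and> local_frame M E r L U e)"

text \<open>A subbundle of rank \<open>r\<close> as a vector bundle: its trivializations are the coordinates with respect to
  smooth local frames.\<close>

definition subbundle ::
    "('m::topological_space) manifold \<Rightarrow> ('m, 'a::real_vector, 'i) vbundle \<Rightarrow> nat \<Rightarrow> ('m \<Rightarrow> 'a set) \<Rightarrow>
     ('m, 'a, nat) vbundle"
  where "subbundle M E r L =
    \<lparr>fib = L, idx = {..<r},
     triv = {(U, \<psi>). \<exists>e. local_frame M E r L U e \<and>
               (\<forall>p\<in>U. \<forall>a\<in>L p. \<psi> p a \<in> coord_space {..<r} \<and> a = (\<Sum>i<r. \<psi> p a i *\<^sub>R e i p))}\<rparr>"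


subsection \<open>The tangent bundle\<close>

text \<open>Tangent vectors at \<open>p\<close> are derivations of the algebra of germs of smooth functions at \<open>p\<close>.
  So that equality of tangent vectors is equality of functions, they are required to be \<open>0\<close> on
  functions that are not smooth near \<open>p\<close>.\<close>

type_synonym 'm tvec = "('m \<Rightarrow> real) \<Rightarrow> real"

definition tangent_space :: "('m::topological_space) manifold \<Rightarrow> 'm \<Rightarrow> 'm tvec set"
  where "tangent_space M p = {v.
    (\<forall>f g. smooth_near M p f \<longrightarrow> smooth_near M p g \<longrightarrow>
       v (\<lambda>q. f q + g q) = v f + v g \<and>
       v (\<lambda>q. f q * g q) = f p * v g + g p * v f \<and>
       ((\<forall>\<^sub>F q in nhds p. f q = g q) \<longrightarrow> v f = v g)) \<and>
    (\<forall>r f. smooth_near M p f \<longrightarrow> v (\<lambda>q. r * f q) = r * v f) \<and>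
    (\<forall>f. \<not> smooth_near M p f \<longrightarrow> v f = 0)}"

text \<open>The coordinate vector \<open>\<partial>/\<partial>x\<^sub>i\<close> at \<open>p\<close> of a chart around \<open>p\<close>.\<close>

definition coord_vec :: "('m::topological_space) manifold \<Rightarrow> 'm chart \<Rightarrow> 'm \<Rightarrow> nat \<Rightarrow> 'm tvec"
  where "coord_vec M C p i = (case C of (U, c) \<Rightarrow>
    (\<lambda>f. if smooth_near M p f then partial i (f \<circ> inv_into U c) (c p) else 0))"

definition tangent_bundle :: "('m::topological_space) manifold \<Rightarrow> ('m, 'm tvec, nat) vbundle"
  where "tangent_bundle M =
    \<lparr>fib = tangent_space M, idx = {..<mdim M},
     triv = {(U, \<lambda>p v i. if i < mdim M then v (\<lambda>q. c q i) else 0) | U c. (U, c) \<in> atlas M}\<rparr>"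

definition lie_bracket ::
    "('m::topological_space) manifold \<Rightarrow> ('m \<Rightarrow> 'm tvec) \<Rightarrow> ('m \<Rightarrow> 'm tvec) \<Rightarrow> 'm \<Rightarrow> 'm tvec"
  where "lie_bracket M X Y p =
    (\<lambda>f. if smooth_near M p f then X p (\<lambda>q. Y q f) - Y p (\<lambda>q. X q f) else 0)"


subsection \<open>Differential forms\<close>

text \<open>An element of \<open>\<and>\<^sup>kT\<^sub>p\<^sup>*M\<close> is an alternating \<open>k\<close>-linear form on \<open>T\<^sub>pM\<close>, given as a function on
  lists and extended by \<open>0\<close> to all lists that are not \<open>k\<close>-tuples of tangent vectors at \<open>p\<close>.\<close>

type_synonym 'm form = "'m tvec list \<Rightarrow> real"

definition tuples :: "('m::topological_space) manifold \<Rightarrow> nat \<Rightarrow> 'm \<Rightarrow> 'm tvec list set"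
  where "tuples M k p = {vs. length vs = k \<and> set vs \<subseteq> tangent_space M p}"

definition ext_power :: "('m::topological_space) manifold \<Rightarrow> nat \<Rightarrow> 'm \<Rightarrow> 'm form set"
  where "ext_power M k p = {\<alpha>.
    (\<forall>vs. vs \<notin> tuples M k p \<longrightarrow> \<alpha> vs = 0) \<and>
    (\<forall>vs\<in>tuples M k p. \<forall>i<k. linear_over (tangent_space M p) (\<lambda>v. \<alpha> (vs[i := v]))) \<and>
    (\<forall>vs\<in>tuples M k p. \<forall>i<k. \<forall>j<k. i \<noteq> j \<longrightarrow> vs ! i = vs ! j \<longrightarrow> \<alpha> vs = 0)}"

text \<open>Coordinates on \<open>\<and>\<^sup>kT\<^sup>*M\<close>: the components \<open>\<alpha>(\<partial>\<^sub>i\<^sub>1, \<dots>, \<partial>\<^sub>i\<^sub>k)\<close> with \<open>i\<^sub>1 < \<dots> < i\<^sub>k\<close>.\<close>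

definition multi_indices :: "nat \<Rightarrow> nat \<Rightarrow> nat list set"
  where "multi_indices n k = {is. length is = k \<and> set is \<subseteq> {..<n} \<and> sorted_wrt (<) is}"

definition ext_bundle :: "('m::topological_space) manifold \<Rightarrow> nat \<Rightarrow> ('m, 'm form, nat list) vbundle"
  where "ext_bundle M k =
    \<lparr>fib = ext_power M k, idx = multi_indices (mdim M) k,
     triv = {(fst C, \<lambda>p \<alpha> is. if is \<in> multi_indices (mdim M) k
                               then \<alpha> (map (coord_vec M C p) is) else 0) | C. C \<in> atlas M}\<rparr>"

definition contract :: "'m tvec \<Rightarrow> 'm form \<Rightarrow> 'm form"
  where "contract v \<alpha> = (\<lambda>vs. \<alpha> (v # vs))"

text \<open>The exterior and the Lie derivative at \<open>p\<close> are defined by the invariant formulas, in which tangent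
  vectors at \<open>p\<close> are extended to vector fields that are smooth near \<open>p\<close>.  Both formulas are linear over
  smooth functions in these fields, so the values do not depend on the extensions chosen.\<close>

definition extend_vec :: "('m::topological_space) manifold \<Rightarrow> 'm \<Rightarrow> 'm tvec \<Rightarrow> 'm \<Rightarrow> 'm tvec"
  where "extend_vec M p v =
    (SOME X. X p = v \<and> (\<exists>W. open W \<and> p \<in> W \<and> smooth_section M (tangent_bundle M) W X))"

definition omit :: "nat \<Rightarrow> 'a list \<Rightarrow> 'a list"
  where "omit i xs = take i xs @ drop (Suc i) xs"

definition ext_deriv ::
    "('m::topological_space) manifold \<Rightarrow> nat \<Rightarrow> ('m \<Rightarrow> 'm form) \<Rightarrow> 'm \<Rightarrow> 'm form"
  where "ext_deriv M k \<alpha> p = (\<lambda>vs.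
    if vs \<in> tuples M (Suc k) p then
      let Xs = map (extend_vec M p) vs in
        (\<Sum>i\<le>k. (- 1) ^ i * (vs ! i) (\<lambda>q. \<alpha> q (map (\<lambda>X. X q) (omit i Xs)))) +
        (\<Sum>j\<le>k. \<Sum>i<j. (- 1) ^ (i + j) *
            \<alpha> p (lie_bracket M (Xs ! i) (Xs ! j) p # omit i (omit j vs)))
    else 0)"

definition lie_deriv ::
    "('m::topological_space) manifold \<Rightarrow> nat \<Rightarrow> ('m \<Rightarrow> 'm tvec) \<Rightarrow> ('m \<Rightarrow> 'm form) \<Rightarrow> 'm \<Rightarrow> 'm form"
  where "lie_deriv M k X \<alpha> p = (\<lambda>vs.
    if vs \<in> tuples M k p then
      let Ys = map (extend_vec M p) vs in
        X p (\<lambda>q. \<alpha> q (map (\<lambda>Y. Y q) Ys)) -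
        (\<Sum>i<k. \<alpha> p (vs[i := lie_bracket M X (Ys ! i) p]))
    else 0)"


subsection \<open>Lie algebroids\<close>

text \<open>The bracket is relevant only on smooth sections.\<close>

record ('m, 'a, 'i) lie_algebroid = "('m, 'a, 'i) vbundle" +
  anchor :: "'m \<Rightarrow> 'a \<Rightarrow> 'm tvec"
  bracket :: "('m \<Rightarrow> 'a) \<Rightarrow> ('m \<Rightarrow> 'a) \<Rightarrow> 'm \<Rightarrow> 'a"

definition anchor_section :: "('m, 'a, 'i) lie_algebroid \<Rightarrow> ('m \<Rightarrow> 'a) \<Rightarrow> 'm \<Rightarrow> 'm tvec"
  where "anchor_section A u = (\<lambda>p. anchor A p (u p))"

text \<open>That the anchor preserves brackets is customarily listed among the axioms, although it follows from
  the Jacobi identity and the Leibniz rule.\<close>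

definition lie_algebroid ::
    "('m::topological_space) manifold \<Rightarrow> ('m, 'a::real_vector, 'i) lie_algebroid \<Rightarrow> bool"
  where "lie_algebroid M A \<longleftrightarrow>
    vector_bundle M A \<and>
    vb_map M A (tangent_bundle M) (anchor A) \<and>
    (\<forall>u\<in>sections M A. \<forall>v\<in>sections M A.
       bracket A u v \<in> sections M A \<and>
       bracket A u v = - bracket A v u \<and>
       (\<forall>w\<in>sections M A.
          bracket A u (v + w) = bracket A u v + bracket A u w \<and>
          bracket A u (bracket A v w) + bracket A v (bracket A w u) + bracket A w (bracket A u v) = 0) \<and>
       (\<forall>r. bracket A u (r *\<^sub>R v) = r *\<^sub>R bracket A u v) \<and>
       (\<forall>f. smooth_on M UNIV f \<longrightarrow>
          bracket A u (\<lambda>p. f p *\<^sub>R v p) =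
            (\<lambda>p. f p *\<^sub>R bracket A u v p + anchor A p (u p) f *\<^sub>R v p)) \<and>
       anchor_section A (bracket A u v) =
         lie_bracket M (anchor_section A u) (anchor_section A v))"

text \<open>Isomorphisms over the identity of the base.\<close>

definition lie_algebroid_iso ::
    "('m::topological_space) manifold \<Rightarrow> ('m, 'a::real_vector, 'i) lie_algebroid \<Rightarrow>
     ('m, 'b::real_vector, 'j) lie_algebroid \<Rightarrow> ('m \<Rightarrow> 'a \<Rightarrow> 'b) \<Rightarrow> bool"
  where "lie_algebroid_iso M A B \<phi> \<longleftrightarrow>
    lie_algebroid M A \<and> lie_algebroid M B \<and> vb_iso M A B \<phi> \<and>
    (\<forall>p. \<forall>a\<in>fib A p. anchor B p (\<phi> p a) = anchor A p a) \<and>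
    (\<forall>u\<in>sections M A. \<forall>v\<in>sections M A.
       (\<lambda>p. \<phi> p (bracket A u v p)) = bracket B (\<lambda>p. \<phi> p (u p)) (\<lambda>p. \<phi> p (v p)))"


subsection \<open>Closed IM forms and \<open>k\<close>-Poisson structures\<close>

text \<open>\<open>closed_IM_form M k A \<mu>\<close>: \<open>\<mu>\<close> takes values in \<open>\<and>\<^sup>kT\<^sup>*M\<close>, so it is an IM \<open>(k+1)\<close>-form.\<close>

definition closed_IM_form ::
    "('m::topological_space) manifold \<Rightarrow> nat \<Rightarrow> ('m, 'a::real_vector, 'i) lie_algebroid \<Rightarrow>
     ('m \<Rightarrow> 'a \<Rightarrow> 'm form) \<Rightarrow> bool"
  where "closed_IM_form M k A \<mu> \<longleftrightarrow>
    vb_map M A (ext_bundle M k) \<mu> \<and>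
    (\<forall>u\<in>sections M A. \<forall>v\<in>sections M A. \<forall>p.
       contract (anchor A p (u p)) (\<mu> p (v p)) = - contract (anchor A p (v p)) (\<mu> p (u p)) \<and>
       \<mu> p (bracket A u v p) =
         lie_deriv M k (anchor_section A u) (\<lambda>q. \<mu> q (v q)) p -
         contract (anchor A p (v p)) (ext_deriv M k (\<lambda>q. \<mu> q (u q)) p))"

definition k_poisson ::
    "('m::topological_space) manifold \<Rightarrow> nat \<Rightarrow> ('m, 'a::real_vector, 'i) lie_algebroid \<Rightarrow>
     ('m \<Rightarrow> 'a \<Rightarrow> 'm form) \<Rightarrow> bool"
  where "k_poisson M k A \<mu> \<longleftrightarrow>
    closed_IM_form M k A \<mu> \<and>
    (\<forall>p. {a \<in> fib A p. \<mu> p a = 0} = {0}) \<and>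
    (\<forall>p. {X \<in> tangent_space M p. \<forall>a\<in>fib A p. contract X (\<mu> p a) = 0} = {0})"

definition IM_equivalent ::
    "('m::topological_space) manifold \<Rightarrow>
     ('m, 'a::real_vector, 'i) lie_algebroid \<Rightarrow> ('m \<Rightarrow> 'a \<Rightarrow> 'm form) \<Rightarrow>
     ('m, 'b::real_vector, 'j) lie_algebroid \<Rightarrow> ('m \<Rightarrow> 'b \<Rightarrow> 'm form) \<Rightarrow> bool"
  where "IM_equivalent M A \<mu> B \<nu> \<longleftrightarrow>
    (\<exists>\<phi>. lie_algebroid_iso M A B \<phi> \<and> (\<forall>p. \<forall>a\<in>fib A p. \<nu> p (\<phi> p a) = \<mu> p a))"


subsection \<open>The higher Courant algebroid \<open>TM \<oplus> \<and>\<^sup>kT\<^sup>*M\<close>\<close>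

type_synonym 'm gvec = "'m tvec \<times> 'm form"

definition higher_TM :: "('m::topological_space) manifold \<Rightarrow> nat \<Rightarrow> ('m, 'm gvec, nat + nat list) vbundle"
  where "higher_TM M k = direct_sum (tangent_bundle M) (ext_bundle M k)"

definition pairing :: "'m gvec \<Rightarrow> 'm gvec \<Rightarrow> 'm form"
  where "pairing e e' = contract (fst e) (snd e') + contract (fst e') (snd e)"

definition courant_bracket ::
    "('m::topological_space) manifold \<Rightarrow> nat \<Rightarrow> ('m \<Rightarrow> 'm gvec) \<Rightarrow> ('m \<Rightarrow> 'm gvec) \<Rightarrow> 'm \<Rightarrow> 'm gvec"
  where "courant_bracket M k s t = (\<lambda>p.
    (lie_bracket M (\<lambda>q. fst (s q)) (\<lambda>q. fst (t q)) p,
     lie_deriv M k (\<lambda>q. fst (s q)) (\<lambda>q. snd (t q)) p -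
     contract (fst (t p)) (ext_deriv M k (\<lambda>q. snd (s q)) p)))"

definition perp :: "('m::topological_space) manifold \<Rightarrow> nat \<Rightarrow> ('m \<Rightarrow> 'm gvec set) \<Rightarrow> 'm \<Rightarrow> 'm gvec set"
  where "perp M k L p = {e \<in> fib (higher_TM M k) p. \<forall>e'\<in>L p. pairing e e' = 0}"

definition isotropic :: "('m::topological_space) manifold \<Rightarrow> nat \<Rightarrow> ('m \<Rightarrow> 'm gvec set) \<Rightarrow> bool"
  where "isotropic M k L \<longleftrightarrow> (\<forall>p. L p \<subseteq> perp M k L p)"

definition involutive :: "('m::topological_space) manifold \<Rightarrow> nat \<Rightarrow> nat \<Rightarrow> ('m \<Rightarrow> 'm gvec set) \<Rightarrow> bool"
  where "involutive M k r L \<longleftrightarrow>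
    (\<forall>s\<in>sections M (subbundle M (higher_TM M k) r L).
     \<forall>t\<in>sections M (subbundle M (higher_TM M k) r L).
       courant_bracket M k s t \<in> sections M (subbundle M (higher_TM M k) r L))"

text \<open>The Lie algebroid carried by an isotropic, involutive subbundle \<open>L\<close> of rank \<open>r\<close>.\<close>

definition subbundle_algebroid ::
    "('m::topological_space) manifold \<Rightarrow> nat \<Rightarrow> nat \<Rightarrow> ('m \<Rightarrow> 'm gvec set) \<Rightarrow> ('m, 'm gvec, nat) lie_algebroid"
  where "subbundle_algebroid M k r L =
    vbundle.extend (subbundle M (higher_TM M k) r L)
      (lie_algebroid.fields (\<lambda>p. fst) (courant_bracket M k))"

end

theory Submission
  imports Defs
begin

text \<open>The isomorphism is \<open>\<phi> a = (\<rho> a, \<mu> a)\<close> and \<open>L\<close> is its image.  As \<open>\<mu>\<close> is injective, \<open>\<phi>\<close>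
  maps local frames of \<open>A\<close> to local frames of \<open>L\<close>.  The two equations of a closed IM form say that
  \<open>L\<close> is isotropic and that \<open>\<phi>\<close> takes the bracket of \<open>A\<close> to the Courant--Dorfman bracket, so the
  axioms of a Lie algebroid are carried over from \<open>A\<close>.  The equations are only given for global
  sections; bump functions extend every vector of \<open>A\<close> to such a section.

  The inverse of \<open>\<phi>\<close> is smooth because the coefficients of a smooth section with respect to
  independent smooth sections are rational functions of their coordinates.  That independence can be
  tested in coordinates rests on Hadamard's lemma: a derivation is determined by its values on the
  coordinate functions of a chart.\<close>

subsection \<open>Smooth functions on \<open>\<real>\<^sup>n\<close>\<close>

text \<open>The obstacle is smoothness, not geometry. The right-hand side of the second IM equation
  is word for word the second component of the Courant--Dorfman bracket, so Lie and exterior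
  derivatives are only compared, never computed. But \<open>smooth_Rn\<close> speaks of iterated
  partial derivatives of every order, on domains that are open only relative to a copy of R^n inside
  the sequences. Smoothness is therefore obtained by coinduction: a class of continuous functions
  that is closed under partial derivatives consists of smooth functions. Sums, products,
  reciprocals, compositions, parameter integrals and bump functions each come down to the choice of
  such a class.

  The trivializations of \<open>subbundle\<close> range over all smooth local frames. Hence the
  transition functions of the image bundle and the matrix entries of the isomorphism and of its
  inverse all raise one question: are the coefficients of a smooth section with respect to
  independent smooth sections smooth?\<close>

lemma Euclidean_space_eq: "Euclidean_space n = top_of_set {x. \<forall>i\<ge>n. x i = 0}"
  by (simp add: Euclidean_space_def euclidean_product_topology)

lemma continuous_on_fun_upd: "continuous_on S (\<lambda>t. (x :: nat \<Rightarrow> real)(i := t))"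
proof (rule continuous_on_coordinatewise_then_product)
  show "continuous_on S (\<lambda>t. (x(i := t)) j)" for j
    by (cases "j = i") (auto intro: continuous_intros)
qed

text \<open>Changing a coordinate below \<open>n\<close> does not leave R^n, so a relatively open
  set contains a piece of the coordinate line.\<close>

lemma openin_Euclidean_space_line:
  assumes "openin (Euclidean_space n) V" "x \<in> V" "i < n"
  shows "\<forall>\<^sub>F t in nhds (x i). x(i := t) \<in> V"
proof -
  obtain T where T: "open T" "V = T \<inter> {x. \<forall>i\<ge>n. x i = 0}"
    using assms(1) by (auto simp: Euclidean_space_eq openin_open Int_commute)
  have "open ((\<lambda>t. x(i := t)) -` T)"
    using open_vimage[OF T(1) continuous_on_fun_upd] .
  then have "\<forall>\<^sub>F t in nhds (x i). t \<in> (\<lambda>t. x(i := t)) -` T"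
    by (rule eventually_nhds_in_open) (use assms T in auto)
  then show ?thesis
    by eventually_elim (use assms T in auto)
qed

text \<open>A partial derivative at a point of \<open>V\<close> sees only values in
  \<open>V\<close>. This makes the later arguments insensitive to arbitrary values outside the
  domain.\<close>

lemma has_derivative_line_cong:
  assumes "openin (Euclidean_space n) V" "x \<in> V" "i < n" "\<And>y. y \<in> V \<Longrightarrow> f y = g y"
  shows "((\<lambda>t. f (x(i := t))) has_real_derivative D) (at (x i)) \<longleftrightarrow>
         ((\<lambda>t. g (x(i := t))) has_real_derivative D) (at (x i))"
proof (rule DERIV_cong_ev)
  show "\<forall>\<^sub>F t in nhds (x i). f (x(i := t)) = g (x(i := t))"
    using openin_Euclidean_space_line[OF assms(1-3)] by eventually_elim (rule assms(4))
qed auto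

text \<open>Smoothness as a greatest fixed point: by induction on the list of indices, every
  iterated partial derivative agrees on \<open>V\<close> with a member of \<open>P\<close>. Choosing
  \<open>P\<close> well replaces any computation of higher derivatives.\<close>

lemma smooth_Rn_coinduct:
  assumes V: "openin (Euclidean_space n) V" and "P f"
    and cont: "\<And>f. P f \<Longrightarrow> continuous_on V f"
    and der: "\<And>f i. P f \<Longrightarrow> i < n \<Longrightarrow>
      \<exists>g. P g \<and> (\<forall>x\<in>V. ((\<lambda>t. f (x(i := t))) has_real_derivative g x) (at (x i)))"
  shows "smooth_Rn n V f"
proof -
  \<comment> \<open>Agreement is claimed on \<open>V\<close> only, since the derivatives in
    \<open>P\<close> are prescribed only there; openness of \<open>V\<close> lets it survive another
    differentiation.\<close>
  have *: "\<exists>g. P g \<and> (\<forall>x\<in>V. iter_partial is f x = g x)" if "set is \<subseteq> {..<n}" for "is"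
    using that
  proof (induction "is")
    case Nil
    then show ?case using \<open>P f\<close> by auto
  next
    case (Cons i "is")
    then obtain g where g: "P g" "\<And>x. x \<in> V \<Longrightarrow> iter_partial is f x = g x" by auto
    obtain h where h: "P h" "\<And>x. x \<in> V \<Longrightarrow> ((\<lambda>t. g (x(i := t))) has_real_derivative h x) (at (x i))"
      using der[OF g(1), of i] Cons.prems by auto
    have "iter_partial (i # is) f x = h x" if "x \<in> V" for x
      using h(2)[OF that] has_derivative_line_cong[OF V that, of i "iter_partial is f" g] g(2) Cons.prems
      by (auto simp: partial_def intro!: DERIV_imp_deriv)
    then show ?case using h(1) by auto
  qed
  show ?thesis
    unfolding smooth_Rn_def
  proof (intro allI impI conjI ballI)
    fix "is" assume "is": "set is \<subseteq> {..<n}"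
    obtain g where g: "P g" "\<And>x. x \<in> V \<Longrightarrow> iter_partial is f x = g x"
      using *[OF "is"] by auto
    show "continuous_on V (iter_partial is f)"
      using continuous_on_cong[of V V "iter_partial is f" g] g cont by auto
    fix x i assume "x \<in> V" "i < n"
    then show "(\<lambda>t. iter_partial is f (x(i := t))) field_differentiable at (x i)"
      using der[OF g(1) \<open>i < n\<close>] has_derivative_line_cong[OF V, of x i "iter_partial is f" g] g(2)
      unfolding field_differentiable_def by blast
  qed
qed

lemma smooth_Rn_continuous_on: "smooth_Rn n V f \<Longrightarrow> continuous_on V f"
  unfolding smooth_Rn_def by (metis empty_set empty_subsetI iter_partial.simps(1))

lemma smooth_Rn_has_partial:
  "smooth_Rn n V f \<Longrightarrow> i < n \<Longrightarrow> x \<in> V \<Longrightarrow>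
    ((\<lambda>t. f (x(i := t))) has_real_derivative partial i f x) (at (x i))"
  unfolding smooth_Rn_def partial_def
  by (metis DERIV_deriv_iff_field_differentiable empty_set empty_subsetI iter_partial.simps(1))

lemma iter_partial_append: "iter_partial (is @ js) f = iter_partial is (iter_partial js f)"
  by (induction "is") auto

lemma smooth_Rn_partial:
  assumes "smooth_Rn n V f" "i < n" shows "smooth_Rn n V (partial i f)"
  unfolding smooth_Rn_def
proof (intro allI impI)
  fix "is" assume "set is \<subseteq> {..<n}"
  \<comment> \<open>The head of the list is differentiated last, so starting from
    \<open>partial i f\<close> extends the list at its end.\<close>
  then have "set (is @ [i]) \<subseteq> {..<n}" using assms by auto
  then show "continuous_on V (iter_partial is (partial i f)) \<and>
       (\<forall>x\<in>V. \<forall>j<n. (\<lambda>t. iter_partial is (partial i f) (x(j := t))) field_differentiable at (x j))"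
    using assms(1) iter_partial_append[of "is" "[i]" f] unfolding smooth_Rn_def by fastforce
qed

lemma smooth_Rn_subset: "smooth_Rn n V f \<Longrightarrow> W \<subseteq> V \<Longrightarrow> smooth_Rn n W f"
  unfolding smooth_Rn_def by (meson continuous_on_subset subset_eq)

lemma smooth_Rn_cong:
  assumes "openin (Euclidean_space n) V" "smooth_Rn n V f" "\<And>x. x \<in> V \<Longrightarrow> f x = g x"
  shows "smooth_Rn n V g"
proof (rule smooth_Rn_coinduct[OF assms(1), where P = "\<lambda>g. \<exists>f. smooth_Rn n V f \<and> (\<forall>x\<in>V. f x = g x)"])
  show "\<exists>f. smooth_Rn n V f \<and> (\<forall>x\<in>V. f x = g x)" using assms by auto
  fix g assume "\<exists>f. smooth_Rn n V f \<and> (\<forall>x\<in>V. f x = g x)"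
  then obtain f where f: "smooth_Rn n V f" "\<And>x. x \<in> V \<Longrightarrow> f x = g x" by auto
  show "continuous_on V g"
    using continuous_on_eq[OF smooth_Rn_continuous_on[OF f(1)] f(2)] .
  fix i assume "i < n"
  then show "\<exists>h. (\<exists>f. smooth_Rn n V f \<and> (\<forall>x\<in>V. f x = h x)) \<and>
      (\<forall>x\<in>V. ((\<lambda>t. g (x(i := t))) has_real_derivative h x) (at (x i)))"
    using smooth_Rn_has_partial[OF f(1)] smooth_Rn_partial[OF f(1)]
      has_derivative_line_cong[OF assms(1), of _ i f g] f(2)
    by (intro exI[of _ "partial i f"]) blast
qed

text \<open>\<open>iter_partial\<close> does not mention the domain, so differentiability is
  inherited point by point. Only continuity needs a neighbourhood, and there
  \<open>V \<inter> T\<close> lies in \<open>V'\<close>.\<close>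

lemma smooth_Rn_local:
  assumes V: "V \<subseteq> {x. \<forall>i\<ge>n. x i = 0}"
    and loc: "\<And>x. x \<in> V \<Longrightarrow> \<exists>V'. openin (Euclidean_space n) V' \<and> x \<in> V' \<and> smooth_Rn n V' f"
  shows "smooth_Rn n V f"
  unfolding smooth_Rn_def
proof (intro allI impI conjI ballI)
  fix "is" assume "is": "set is \<subseteq> {..<n}"
  show "continuous_on V (iter_partial is f)"
    unfolding continuous_on_eq_continuous_within
  proof
    fix x assume "x \<in> V"
    then obtain V' where V': "openin (Euclidean_space n) V'" "x \<in> V'" "smooth_Rn n V' f"
      using loc by blast
    then obtain T where T: "open T" "V' = T \<inter> {x. \<forall>i\<ge>n. x i = 0}"
      by (auto simp: Euclidean_space_eq openin_open Int_commute)
    have "continuous_on V' (iter_partial is f)"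
      using V'(3) "is" unfolding smooth_Rn_def by blast
    then have "continuous_on (V \<inter> T) (iter_partial is f)"
      by (rule continuous_on_subset) (use T V in auto)
    then have "continuous (at x within V \<inter> T) (iter_partial is f)"
      using \<open>x \<in> V\<close> V'(2) T(2) unfolding continuous_on_eq_continuous_within by blast
    then show "continuous (at x within V) (iter_partial is f)"
      using at_within_nhd[of x T "V \<inter> T" V] T V'(2) by (auto simp: Int_ac continuous_within)
  qed
next
  fix "is" x i assume "set is \<subseteq> {..<n}" "x \<in> V" "i < n"
  then show "(\<lambda>t. iter_partial is f (x(i := t))) field_differentiable at (x i)"
    using loc unfolding smooth_Rn_def by blast
qed

section \<open>Algebras of functions that are closed under differentiation\<close>

inductive_set fun_algebra :: "('a \<Rightarrow> real) set \<Rightarrow> ('a \<Rightarrow> real) set" for B where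
  base: "f \<in> B \<Longrightarrow> f \<in> fun_algebra B"
| add: "f \<in> fun_algebra B \<Longrightarrow> g \<in> fun_algebra B \<Longrightarrow> (\<lambda>x. f x + g x) \<in> fun_algebra B"
| mult: "f \<in> fun_algebra B \<Longrightarrow> g \<in> fun_algebra B \<Longrightarrow> (\<lambda>x. f x * g x) \<in> fun_algebra B"

text \<open>The sum and product rules carry closure under partial derivatives from the generators to
  the whole algebra, which then serves as the class for coinduction. A constant has to be generated
  like any other function, hence the constants in the generating sets below.\<close>

lemma smooth_Rn_fun_algebra:
  assumes V: "openin (Euclidean_space n) V"
    and cont: "\<And>f. f \<in> B \<Longrightarrow> continuous_on V f"
    and der: "\<And>f i. f \<in> B \<Longrightarrow> i < n \<Longrightarrow>
      \<exists>g\<in>fun_algebra B. \<forall>x\<in>V. ((\<lambda>t. f (x(i := t))) has_real_derivative g x) (at (x i))"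
    and "f \<in> fun_algebra B"
  shows "smooth_Rn n V f"
proof (rule smooth_Rn_coinduct[OF V, where P = "\<lambda>f. f \<in> fun_algebra B"])
  fix f assume "f \<in> fun_algebra B"
  then show "continuous_on V f"
    by induction (auto intro: cont continuous_intros)
next
  fix f i assume "f \<in> fun_algebra B" "i < n"
  then show "\<exists>g. g \<in> fun_algebra B \<and> (\<forall>x\<in>V. ((\<lambda>t. f (x(i := t))) has_real_derivative g x) (at (x i)))"
  proof induction
    case (base f)
    then show ?case using der by blast
  next
    case (add f g)
    then obtain f' g' where *: "f' \<in> fun_algebra B" "g' \<in> fun_algebra B"
      "\<And>x. x \<in> V \<Longrightarrow> ((\<lambda>t. f (x(i := t))) has_real_derivative f' x) (at (x i))"
      "\<And>x. x \<in> V \<Longrightarrow> ((\<lambda>t. g (x(i := t))) has_real_derivative g' x) (at (x i))"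
      by blast
    show ?case
      by (intro exI[of _ "\<lambda>x. f' x + g' x"] conjI ballI fun_algebra.add * DERIV_add)
  next
    case (mult f g)
    then obtain f' g' where *: "f' \<in> fun_algebra B" "g' \<in> fun_algebra B"
      "\<And>x. x \<in> V \<Longrightarrow> ((\<lambda>t. f (x(i := t))) has_real_derivative f' x) (at (x i))"
      "\<And>x. x \<in> V \<Longrightarrow> ((\<lambda>t. g (x(i := t))) has_real_derivative g' x) (at (x i))"
      by blast
    have "((\<lambda>t. f (x(i := t)) * g (x(i := t))) has_real_derivative f' x * g x + g' x * f x) (at (x i))"
      if "x \<in> V" for x
      using DERIV_mult[OF *(3)[OF that] *(4)[OF that]] by simp
    then show ?case
      by (intro exI[of _ "\<lambda>x. f' x * g x + g' x * f x"] conjI ballI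
          fun_algebra.add fun_algebra.mult * mult.hyps)
  qed
qed fact

lemma fun_algebra_mono: "f \<in> fun_algebra B \<Longrightarrow> B \<subseteq> C \<Longrightarrow> f \<in> fun_algebra C"
  by (induction rule: fun_algebra.induct) (auto intro: fun_algebra.intros)

lemma fun_algebra_compose:
  "h \<in> fun_algebra H \<Longrightarrow> (\<lambda>x. h (f x)) \<in> fun_algebra ((\<lambda>h x. h (f x)) ` H)"
  by (induction rule: fun_algebra.induct) (auto intro: fun_algebra.intros)

lemma smooth_Rn_const: "openin (Euclidean_space n) V \<Longrightarrow> smooth_Rn n V (\<lambda>_. r)"
  by (erule smooth_Rn_coinduct[where P = "\<lambda>f. \<exists>r. f = (\<lambda>_. r)"])
    (auto intro!: exI[of _ "\<lambda>_. 0"] continuous_intros)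

text \<open>With all smooth functions on \<open>V\<close> as generators, their partial derivatives
  are generators again. Sums and products of smooth functions are special cases.\<close>

lemma smooth_Rn_algebra:
  assumes "openin (Euclidean_space n) V" "f \<in> fun_algebra {f. smooth_Rn n V f}"
  shows "smooth_Rn n V f"
  by (rule smooth_Rn_fun_algebra[OF assms(1) _ _ assms(2)])
    (auto intro: smooth_Rn_continuous_on
      dest: smooth_Rn_has_partial intro!: bexI[OF _ fun_algebra.base] smooth_Rn_partial)

lemma smooth_Rn_add:
  assumes "openin (Euclidean_space n) V" "smooth_Rn n V f" "smooth_Rn n V g"
  shows "smooth_Rn n V (\<lambda>x. f x + g x)"
  by (rule smooth_Rn_algebra) (use assms in \<open>auto intro: fun_algebra.intros\<close>)

lemma smooth_Rn_mult:
  assumes "openin (Euclidean_space n) V" "smooth_Rn n V f" "smooth_Rn n V g"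
  shows "smooth_Rn n V (\<lambda>x. f x * g x)"
  by (rule smooth_Rn_algebra) (use assms in \<open>auto intro: fun_algebra.intros\<close>)

text \<open>\<open>H\<close> holds the outer function together with whatever its derivatives of all
  orders are built from, for example all functions \<open>flat m\<close>. By the chain rule in one
  variable, the functions \<open>h (f x)\<close> and the smooth functions generate an algebra closed
  under partial derivatives.\<close>

lemma smooth_Rn_compose_real:
  assumes V: "openin (Euclidean_space n) V" and f: "smooth_Rn n V f" "f ` V \<subseteq> D"
    and H: "\<And>h. h \<in> H \<Longrightarrow> \<exists>h'\<in>fun_algebra H. \<forall>y\<in>D. (h has_real_derivative h' y) (at y)"
    and "h \<in> H"
  shows "smooth_Rn n V (\<lambda>x. h (f x))"
proof -
  let ?B = "{f. smooth_Rn n V f} \<union> (\<lambda>h x. h (f x)) ` H"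
  show ?thesis
  proof (rule smooth_Rn_fun_algebra[OF V, where B = ?B])
  show "(\<lambda>x. h (f x)) \<in> fun_algebra ?B"
    using \<open>h \<in> H\<close> by (auto intro: fun_algebra.base)
  show "continuous_on V g" if "g \<in> ?B" for g
  proof -
    have "continuous_on V (\<lambda>x. h (f x))" if "h \<in> H" for h
    proof -
      have "continuous_on D h"
        using H[OF that] by (meson DERIV_isCont continuous_at_imp_continuous_on)
      then show ?thesis
        by (rule continuous_on_compose2) (use f in \<open>auto intro: smooth_Rn_continuous_on\<close>)
    qed
    then show ?thesis using that by (auto intro: smooth_Rn_continuous_on)
  qed
  fix g i assume "g \<in> ?B" "i < n"
  then consider "smooth_Rn n V g" | h where "h \<in> H" "g = (\<lambda>x. h (f x))" by auto
  then show "\<exists>g'\<in>fun_algebra ?B. \<forall>x\<in>V. ((\<lambda>t. g (x(i := t))) has_real_derivative g' x) (at (x i))"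
  proof cases
    case 1
    then show ?thesis
      using \<open>i < n\<close> by (intro bexI[of _ "partial i g"])
        (auto intro: fun_algebra.base smooth_Rn_has_partial smooth_Rn_partial)
  next
    case 2
    then obtain h' where h': "h' \<in> fun_algebra H" "\<And>y. y \<in> D \<Longrightarrow> (h has_real_derivative h' y) (at y)"
      using H by blast
    have "((\<lambda>t. g (x(i := t))) has_real_derivative h' (f x) * partial i f x) (at (x i))"
      if "x \<in> V" for x
      unfolding 2
      by (rule DERIV_chain2[of h "h' (f x)"])
        (use h'(2) f that \<open>i < n\<close> in \<open>auto intro: smooth_Rn_has_partial\<close>)
    moreover have "(\<lambda>x. h' (f x) * partial i f x) \<in> fun_algebra ?B"
      by (intro fun_algebra.mult fun_algebra_mono[OF fun_algebra_compose[OF h'(1)]] fun_algebra.base)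
        (use f \<open>i < n\<close> in \<open>auto intro: smooth_Rn_partial\<close>)
    ultimately show ?thesis by (intro bexI[of _ "\<lambda>x. h' (f x) * partial i f x"]) auto
  qed
  qed
qed

section \<open>Cubes in R^n and Hadamard's lemma\<close>

definition coord_box :: "nat \<Rightarrow> (nat \<Rightarrow> real) \<Rightarrow> real \<Rightarrow> (nat \<Rightarrow> real) set"
  where "coord_box n a e = {x. (\<forall>i<n. \<bar>x i - a i\<bar> < e) \<and> (\<forall>i\<ge>n. x i = 0)}"

lemma openin_coord_box: "openin (Euclidean_space n) (coord_box n a e)"
proof -
  have "coord_box n a e = {x. \<forall>i\<ge>n. x i = 0} \<inter> (\<Inter>i\<in>{..<n}. {x. \<bar>x i - a i\<bar> < e})"
    by (auto simp: coord_box_def)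
  moreover have "open (\<Inter>i\<in>{..<n}. {x :: nat \<Rightarrow> real. \<bar>x i - a i\<bar> < e})"
    by (intro open_INT finite_lessThan ballI open_Collect_less continuous_intros)
      (auto intro: continuous_on_product_coordinates)
  ultimately show ?thesis
    by (auto simp: Euclidean_space_eq openin_open)
qed

lemma coord_box_basis:
  assumes "openin (Euclidean_space n) V" "a \<in> V"
  obtains e where "e > 0" "coord_box n a e \<subseteq> V"
proof -
  obtain T where T: "open T" "V = T \<inter> {x. \<forall>i\<ge>n. x i = 0}"
    using assms(1) by (auto simp: Euclidean_space_eq openin_open Int_commute)
  have "openin (product_topology (\<lambda>i. euclidean) UNIV) T"
    using T by (simp add: euclidean_product_topology)
  then obtain U where U: "\<And>i. open (U i)" "a \<in> Pi\<^sub>E UNIV U" "Pi\<^sub>E UNIV U \<subseteq> T"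
    using assms(2) T(2) unfolding openin_product_topology_alt by simp blast
  have "\<exists>e>0. \<forall>y. \<bar>y - a i\<bar> < e \<longrightarrow> y \<in> U i" for i
  proof -
    have "a i \<in> U i" using U(2) by (auto simp: PiE_iff)
    with U(1)[of i] show ?thesis unfolding open_dist dist_real_def by blast
  qed
  then obtain d where d: "\<And>i. d i > 0" "\<And>i y. \<bar>y - a i\<bar> < d i \<Longrightarrow> y \<in> U i"
    by metis
  \<comment> \<open>The \<open>1\<close> covers dimension zero, where the minimum would otherwise be
    over the empty set. From index \<open>n\<close> on, both points have coordinate 0.\<close>
  define e where "e = Min (insert 1 (d ` {..<n}))"
  have "e > 0" using d(1) by (auto simp: e_def)
  moreover have "e \<le> d i" if "i < n" for i using that by (auto simp: e_def)
  then have "coord_box n a e \<subseteq> V"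
    using T U d assms(2) unfolding coord_box_def
    by (auto simp: PiE_iff subset_iff) (metis (no_types, lifting) abs_zero diff_self linorder_not_less order_less_le_trans)
  ultimately show ?thesis using that by blast
qed

lemma smooth_Rn_coordinate:
  assumes "openin (Euclidean_space n) V" shows "smooth_Rn n V (\<lambda>x. x m)"
proof (rule smooth_Rn_coinduct[OF assms, where P = "\<lambda>f. f = (\<lambda>x. x m) \<or> (\<exists>r. f = (\<lambda>x. r))"])
  fix f :: "(nat \<Rightarrow> real) \<Rightarrow> real" assume f: "f = (\<lambda>x. x m) \<or> (\<exists>r. f = (\<lambda>x. r))"
  show "continuous_on V f"
    using f continuous_on_subset[OF continuous_on_product_coordinates] by (auto intro: continuous_intros)
  show "\<exists>g. (g = (\<lambda>x. x m) \<or> (\<exists>r. g = (\<lambda>x. r))) \<and>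
      (\<forall>x\<in>V. ((\<lambda>t. f (x(i := t))) has_real_derivative g x) (at (x i)))" for i
    using f by (intro exI[of _ "\<lambda>_. if i = m \<and> f = (\<lambda>x. x m) then 1 else 0"]) (auto simp: fun_upd_def)
qed auto

text \<open>\<open>G\<close> is the mean over \<open>t\<close> of the \<open>i\<close>-th partial
  derivative of \<open>F\<close> along the segment from \<open>x(i := a i)\<close> to
  \<open>x\<close>, so the identity is the fundamental theorem of calculus. A cube around
  \<open>a\<close> contains all these segments.\<close>

lemma hadamard_step:
  assumes F: "smooth_Rn n (coord_box n a e) F" and "i < n"
  obtains G where "smooth_Rn n (coord_box n a e) G"
    "\<And>x. x \<in> coord_box n a e \<Longrightarrow> F x = F (x(i := a i)) + (x i - a i) * G x"
proof -
  let ?V = "coord_box n a e"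
  define \<sigma> where "\<sigma> x t = x(i := a i + t * (x i - a i))" for x :: "nat \<Rightarrow> real" and t
  \<comment> \<open>Differentiation under the integral in coordinate \<open>i\<close> produces the
    inner derivative \<open>t\<close>. The weight \<open>t ^ m\<close> makes these integrals a class
    closed under partial derivatives.\<close>
  define J where "J m H x = integral (cbox 0 (1::real)) (\<lambda>t. t ^ m * H (\<sigma> x t))" for m H x
  have \<sigma>_in: "\<sigma> x t \<in> ?V" if "x \<in> ?V" "t \<in> cbox 0 1" for x t
  proof -
    have "\<bar>t * (x i - a i)\<bar> \<le> 1 * \<bar>x i - a i\<bar>"
      using that(2) unfolding abs_mult by (intro mult_right_mono) auto
    then show ?thesis
      using that(1) \<open>i < n\<close> by (auto simp: coord_box_def \<sigma>_def intro: le_less_trans)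
  qed
  have \<sigma>_cont: "continuous_on S (\<lambda>(x, t). \<sigma> x t)" for S
  proof (rule continuous_on_coordinatewise_then_product)
    have c: "continuous_on S (\<lambda>z. fst z j)" for j :: nat and S :: "((nat \<Rightarrow> real) \<times> real) set"
      by (rule continuous_on_compose2[OF continuous_on_product_coordinates]) (auto intro: continuous_intros)
    show "continuous_on S (\<lambda>z. (case z of (x, t) \<Rightarrow> \<sigma> x t) j)" for j
      by (cases "j = i") (auto simp: \<sigma>_def split_beta intro!: continuous_intros c)
  qed
  have J_cont: "continuous_on (?V \<times> cbox 0 1) (\<lambda>(x, t). t ^ m * H (\<sigma> x t))"
    if "smooth_Rn n ?V H" for m H
  proof -
    have "continuous_on (?V \<times> cbox 0 1) (\<lambda>z. H (case z of (x, t) \<Rightarrow> \<sigma> x t))"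
      by (rule continuous_on_compose2[OF smooth_Rn_continuous_on[OF that] \<sigma>_cont]) (use \<sigma>_in in auto)
    then show ?thesis by (auto simp: split_beta intro!: continuous_intros)
  qed
  have "smooth_Rn n ?V (J 0 (partial i F))"
  proof (rule smooth_Rn_coinduct[OF openin_coord_box,
        where P = "\<lambda>g. \<exists>m H. smooth_Rn n ?V H \<and> g = J m H"])
    show "\<exists>m H. smooth_Rn n ?V H \<and> J 0 (partial i F) = J m H"
      using smooth_Rn_partial[OF F \<open>i < n\<close>] by blast
  next
    fix g assume "\<exists>m H. smooth_Rn n ?V H \<and> g = J m H"
    then obtain m H where H: "smooth_Rn n ?V H" and g: "g = J m H" by blast
    show "continuous_on ?V g"
      unfolding g J_def by (rule integral_continuous_on_param[OF J_cont[OF H]])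
    fix j assume "j < n"
    let ?H = "partial j H" and ?m = "if j = i then Suc m else m"
    have H': "smooth_Rn n ?V ?H" using smooth_Rn_partial[OF H \<open>j < n\<close>] .
    have "((\<lambda>s. g (x(j := s))) has_real_derivative J ?m ?H x) (at (x j))" if x: "x \<in> ?V" for x
    proof -
      \<comment> \<open>The range of the \<open>j\<close>-th coordinate inside the box. It is
        convex, as the Leibniz rule demands, and open, so the derivative within it is an ordinary
        one.\<close>
      let ?S = "{a j - e <..< a j + e}"
      have in_V: "x(j := s) \<in> ?V" if "s \<in> ?S" for s
        using that x \<open>j < n\<close> by (auto simp: coord_box_def)
      have xj: "x j \<in> ?S" using x \<open>j < n\<close> by (force simp: coord_box_def)
      have "((\<lambda>s. integral (cbox 0 1) (\<lambda>t. t ^ m * H (\<sigma> (x(j := s)) t))) has_real_derivative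
          integral (cbox 0 1) (\<lambda>t. t ^ ?m * ?H (\<sigma> (x(j := x j)) t))) (at (x j) within ?S)"
      proof (rule leibniz_rule_field_derivative[where fx = "\<lambda>s t. t ^ ?m * ?H (\<sigma> (x(j := s)) t)"])
        fix s t :: real assume s: "s \<in> ?S" and t: "t \<in> cbox 0 1"
        let ?y = "\<sigma> (x(j := s)) t"
        have y: "((\<lambda>r. H (?y(j := r))) has_real_derivative ?H ?y) (at (?y j))"
          by (rule smooth_Rn_has_partial[OF H \<open>j < n\<close> \<sigma>_in[OF in_V[OF s] t]])
        show "((\<lambda>s. t ^ m * H (\<sigma> (x(j := s)) t)) has_real_derivative t ^ ?m * ?H ?y) (at s within ?S)"
        proof (cases "j = i")
          case True
          have "((\<lambda>s. H (?y(j := a i + t * (s - a i)))) has_real_derivative ?H ?y * t) (at s)"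
            by (rule DERIV_chain2[where g = "\<lambda>s. a i + t * (s - a i)" and f = "\<lambda>r. H (?y(j := r))"])
              (use y True in \<open>auto simp: \<sigma>_def intro!: derivative_eq_intros\<close>)
          then have "((\<lambda>s. t ^ m * H (\<sigma> (x(j := s)) t)) has_real_derivative t ^ m * (?H ?y * t)) (at s)"
            using True by (intro DERIV_cmult) (simp add: \<sigma>_def)
          then show ?thesis using True by (auto simp: mult_ac intro: has_field_derivative_at_within)
        next
          case False
          have "((\<lambda>s. H (\<sigma> (x(j := s)) t)) has_real_derivative ?H ?y) (at s)"
            using y False by (simp add: \<sigma>_def fun_upd_twist)
          then show ?thesis
            using False by (auto intro: has_field_derivative_at_within DERIV_cmult)
        qed
      next
        have pc: "continuous_on (?S \<times> cbox 0 1) (\<lambda>z. (x(j := fst z), snd z))"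
          by (intro continuous_intros continuous_on_compose2[OF continuous_on_fun_upd[of UNIV x j]]) auto
        have *: "continuous_on (?S \<times> cbox 0 1) (\<lambda>z. case (x(j := fst z), snd z) of
            (x, t) \<Rightarrow> t ^ k * G (\<sigma> x t))" if "smooth_Rn n ?V G" for k G
          by (rule continuous_on_compose2[OF J_cont[OF that] pc]) (use in_V in auto)
        show "continuous_on (?S \<times> cbox 0 1) (\<lambda>(s, t). t ^ ?m * ?H (\<sigma> (x(j := s)) t))"
          using *[OF H', of ?m] by (simp add: split_beta)
        fix s assume "s \<in> ?S"
        show "(\<lambda>t. t ^ m * H (\<sigma> (x(j := s)) t)) integrable_on cbox 0 1"
        proof (rule integrable_continuous)
          show "continuous_on (cbox 0 1) (\<lambda>t. t ^ m * H (\<sigma> (x(j := s)) t))"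
            using continuous_on_compose2[OF *[OF H, of m], of "cbox 0 1" "\<lambda>t. (s, t)"] \<open>s \<in> ?S\<close>
            by (simp add: image_subset_iff continuous_on_Pair)
        qed
      qed (use xj in auto)
      then show ?thesis
        using xj at_within_open[of "x j" ?S] by (simp add: g J_def)
    qed
    then show "\<exists>g'. (\<exists>m H. smooth_Rn n ?V H \<and> g' = J m H) \<and>
        (\<forall>x\<in>?V. ((\<lambda>t. g (x(j := t))) has_real_derivative g' x) (at (x j)))"
      using H' by blast
  qed
  moreover have "F x = F (x(i := a i)) + (x i - a i) * J 0 (partial i F) x" if x: "x \<in> ?V" for x
  proof -
    have "((\<lambda>t. partial i F (\<sigma> x t) * (x i - a i)) has_integral (F (\<sigma> x 1) - F (\<sigma> x 0))) {0..1}"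
    proof (rule fundamental_theorem_of_calculus)
      fix t :: real assume t: "t \<in> {0..1}"
      let ?y = "\<sigma> x t"
      have "((\<lambda>r. F (?y(i := r))) has_real_derivative partial i F ?y) (at (?y i))"
        by (rule smooth_Rn_has_partial[OF F \<open>i < n\<close> \<sigma>_in[OF x]]) (use t in auto)
      then have "((\<lambda>s. F (?y(i := a i + s * (x i - a i)))) has_real_derivative
          partial i F ?y * (x i - a i)) (at t)"
        by (intro DERIV_chain2[where g = "\<lambda>s. a i + s * (x i - a i)" and f = "\<lambda>r. F (?y(i := r))"])
          (auto simp: \<sigma>_def intro!: derivative_eq_intros)
      then show "((\<lambda>t. F (\<sigma> x t)) has_vector_derivative partial i F (\<sigma> x t) * (x i - a i)) (at t within {0..1})"
        by (auto simp: \<sigma>_def has_real_derivative_iff_has_vector_derivative[symmetric]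
            intro: has_field_derivative_at_within)
    qed simp
    then have "integral {0..1} (\<lambda>t. partial i F (\<sigma> x t) * (x i - a i)) = F (\<sigma> x 1) - F (\<sigma> x 0)"
      by (rule integral_unique)
    then have "J 0 (partial i F) x * (x i - a i) = F x - F (x(i := a i))"
      by (simp add: J_def \<sigma>_def)
    then show ?thesis
      by (simp add: mult.commute)
  qed
  ultimately show ?thesis using that by blast
qed

text \<open>Coordinates are frozen one at a time: each step splits off one summand and leaves a
  function in which one more coordinate is replaced by that of \<open>a\<close>. After
  \<open>n\<close> steps the constant \<open>F a\<close> remains.\<close>

lemma hadamard_lemma:
  assumes F: "smooth_Rn n (coord_box n a e) F" and a: "a \<in> coord_box n a e"
  obtains g where "\<And>i. i < n \<Longrightarrow> smooth_Rn n (coord_box n a e) (g i)"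
    "\<And>i. i < n \<Longrightarrow> g i a = partial i F a"
    "\<And>x. x \<in> coord_box n a e \<Longrightarrow> F x = F a + (\<Sum>i<n. (x i - a i) * g i x)"
proof -
  let ?V = "coord_box n a e"
  have e: "i < n \<Longrightarrow> e > 0" for i using a by (force simp: coord_box_def)
  have "\<exists>F' g. smooth_Rn n ?V F' \<and> (\<forall>i<m. smooth_Rn n ?V (g i)) \<and>
     (\<forall>x\<in>?V. F' x = F (\<lambda>i. if i < m then a i else x i) \<and>
        F x = F' x + (\<Sum>i<m. (x i - a i) * g i x))" if "m \<le> n" for m
    using that
  proof (induction m)
    case 0
    then show ?case using F by auto
  next
    case (Suc m)
    then obtain F' g where F': "smooth_Rn n ?V F'" "\<And>i. i < m \<Longrightarrow> smooth_Rn n ?V (g i)"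
      "\<And>x. x \<in> ?V \<Longrightarrow> F' x = F (\<lambda>i. if i < m then a i else x i)"
      "\<And>x. x \<in> ?V \<Longrightarrow> F x = F' x + (\<Sum>i<m. (x i - a i) * g i x)"
    proof -
      have "m \<le> n" using Suc.prems by simp
      from Suc.IH[OF this] show ?thesis using that by blast
    qed
    have "m < n" using Suc.prems by simp
    then obtain G where G: "smooth_Rn n ?V G"
      "\<And>x. x \<in> ?V \<Longrightarrow> F' x = F' (x(m := a m)) + (x m - a m) * G x"
      using hadamard_step[OF F'(1)] by blast
    have in_V: "x(m := a m) \<in> ?V" if "x \<in> ?V" for x
      using that e[OF \<open>m < n\<close>] \<open>m < n\<close> by (auto simp: coord_box_def)
    \<comment> \<open>On the box this is \<open>F'\<close> with coordinate \<open>m\<close> frozen.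
      Written by means of \<open>G\<close>, it is smooth by the closure under sums and
      products.\<close>
    define F'' where "F'' x = F' x + ((-1) * (x m + - a m)) * G x" for x
    have "smooth_Rn n ?V F''"
      unfolding F''_def
      by (intro smooth_Rn_add smooth_Rn_mult openin_coord_box smooth_Rn_const
          smooth_Rn_coordinate F'(1) G(1))
    moreover have "F'' x = F' (x(m := a m))" if "x \<in> ?V" for x
      using G(2)[OF that] by (simp add: F''_def algebra_simps)
    moreover have "F' (x(m := a m)) = F (\<lambda>i. if i < Suc m then a i else x i)" if "x \<in> ?V" for x
      unfolding F'(3)[OF in_V[OF that]] by (rule arg_cong[of _ _ F]) (auto simp: less_Suc_eq)
    moreover have "F x = F'' x + (\<Sum>i<Suc m. (x i - a i) * (g(m := G)) i x)" if "x \<in> ?V" for x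
      using F'(4)[OF that] by (simp add: F''_def algebra_simps)
    ultimately show ?case
      using F'(2) G(1) by (intro exI[of _ F''] exI[of _ "g(m := G)"]) (auto simp: less_Suc_eq)
  qed
  from this[of n] obtain F' g where g: "\<And>i. i < n \<Longrightarrow> smooth_Rn n ?V (g i)"
    "\<And>x. x \<in> ?V \<Longrightarrow> F' x = F (\<lambda>i. if i < n then a i else x i)"
    "\<And>x. x \<in> ?V \<Longrightarrow> F x = F' x + (\<Sum>i<n. (x i - a i) * g i x)"
    by blast
  have "(\<lambda>i. if i < n then a i else x i) = a" if "x \<in> ?V" for x
    using that a by (intro ext) (auto simp: coord_box_def)
  then have *: "F x = F a + (\<Sum>i<n. (x i - a i) * g i x)" if "x \<in> ?V" for x
    using g(2,3) that by metis
  \<comment> \<open>On the coordinate line through \<open>a\<close> only the \<open>i\<close>-th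
    summand survives. Its factor \<open>t - a i\<close> vanishes at \<open>a i\<close>, so the
    product rule leaves \<open>g i a\<close>.\<close>
  have "g i a = partial i F a" if "i < n" for i
  proof -
    have line: "(\<Sum>j<n. ((a(i := t)) j - a j) * g j (a(i := t))) = (t - a i) * g i (a(i := t))" for t
      using that by (subst sum.remove[of _ i]) auto
    have "((\<lambda>t. F (a(i := t))) has_real_derivative g i a) (at (a i)) \<longleftrightarrow>
        ((\<lambda>t. F a + (t - a i) * g i (a(i := t))) has_real_derivative g i a) (at (a i))"
    proof (rule DERIV_cong_ev)
      show "\<forall>\<^sub>F t in nhds (a i). F (a(i := t)) = F a + (t - a i) * g i (a(i := t))"
        using openin_Euclidean_space_line[OF openin_coord_box a that]
        by eventually_elim (use * line in simp)
    qed auto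
    moreover have "((\<lambda>t. F a + (t - a i) * g i (a(i := t))) has_real_derivative
        0 + (1 * g i (a(i := a i)) + partial i (g i) a * (a i - a i))) (at (a i))"
      by (intro DERIV_add DERIV_const DERIV_mult smooth_Rn_has_partial[OF g(1)[OF that] that a])
        (auto intro!: derivative_eq_intros)
    ultimately have "((\<lambda>t. F (a(i := t))) has_real_derivative g i a) (at (a i))" by simp
    then show ?thesis
      unfolding partial_def by (rule DERIV_imp_deriv[symmetric])
  qed
  then show ?thesis using that g(1) * by blast
qed

section \<open>The chain rule and composition of smooth maps\<close>

lemma tendsto_fun_coordinatewise:
  fixes f :: "'a \<Rightarrow> 'i \<Rightarrow> 'b::topological_space"
  assumes "\<And>i. ((\<lambda>x. f x i) \<longlongrightarrow> l i) F"
  shows "(f \<longlongrightarrow> l) F"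
  using assms limitin_componentwise[of "\<lambda>_. euclidean" UNIV f l F]
  unfolding euclidean_product_topology by simp

text \<open>By Hadamard's lemma the difference quotient of \<open>H \<circ> \<gamma>\<close> is a sum of difference quotients of the
  components of \<open>\<gamma>\<close> with continuous coefficients.\<close>

lemma smooth_Rn_chain_rule:
  assumes V: "openin (Euclidean_space n) V" and H: "smooth_Rn n V H"
    and \<gamma>: "\<forall>\<^sub>F t in nhds s. \<gamma> t \<in> V"
    and \<gamma>': "\<And>i. i < n \<Longrightarrow> ((\<lambda>t. \<gamma> t i) has_real_derivative \<gamma>' i) (at s)"
  shows "((\<lambda>t. H (\<gamma> t)) has_real_derivative (\<Sum>i<n. partial i H (\<gamma> s) * \<gamma>' i)) (at s)"
proof -
  let ?a = "\<gamma> s"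
  have a: "?a \<in> V" using eventually_nhds_x_imp_x[OF \<gamma>] .
  have V_zero: "\<And>x i. x \<in> V \<Longrightarrow> i \<ge> n \<Longrightarrow> x i = 0"
    using openin_subset[OF V] by (auto simp: Euclidean_space_eq)
  obtain e where e: "e > 0" "coord_box n ?a e \<subseteq> V" using coord_box_basis[OF V a] .
  have a_box: "?a \<in> coord_box n ?a e" using e a V_zero by (auto simp: coord_box_def)
  obtain g where g: "\<And>i. i < n \<Longrightarrow> smooth_Rn n (coord_box n ?a e) (g i)"
    "\<And>i. i < n \<Longrightarrow> g i ?a = partial i H ?a"
    "\<And>x. x \<in> coord_box n ?a e \<Longrightarrow> H x = H ?a + (\<Sum>i<n. (x i - ?a i) * g i x)"
    using hadamard_lemma[OF smooth_Rn_subset[OF H e(2)] a_box] by blast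
  have \<gamma>_at: "\<forall>\<^sub>F t in at s. \<gamma> t \<in> V"
    using \<gamma> by (auto simp: eventually_at_filter elim: eventually_mono)
  have lim: "(\<gamma> \<longlongrightarrow> ?a) (at s)"
  proof (rule tendsto_fun_coordinatewise)
    fix i show "((\<lambda>t. \<gamma> t i) \<longlongrightarrow> ?a i) (at s)"
    proof (cases "i < n")
      case True
      then show ?thesis using DERIV_isCont[OF \<gamma>'] by (simp add: isCont_def)
    next
      case False
      have "\<forall>\<^sub>F t in at s. \<gamma> t i = ?a i"
        using \<gamma>_at by eventually_elim (metis False V_zero a not_le)
      then show ?thesis by (rule tendsto_eventually)
    qed
  qed
  obtain T where T: "open T" "coord_box n ?a e = T \<inter> {x. \<forall>i\<ge>n. x i = 0}"
    using openin_coord_box[of n ?a e] by (auto simp: Euclidean_space_eq openin_open Int_commute)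
  have \<gamma>_box: "\<forall>\<^sub>F t in at s. \<gamma> t \<in> coord_box n ?a e"
  proof -
    have "\<forall>\<^sub>F t in at s. \<gamma> t \<in> T"
      using topological_tendstoD[OF lim T(1)] a_box T(2) by simp
    with \<gamma>_at show ?thesis
      by eventually_elim (use T(2) V_zero in blast)
  qed
  have "((\<lambda>t. \<Sum>i<n. ((\<gamma> t i - ?a i) / (t - s)) * g i (\<gamma> t)) \<longlongrightarrow> (\<Sum>i<n. \<gamma>' i * g i ?a)) (at s)"
  proof (intro tendsto_sum tendsto_mult)
    fix i assume "i \<in> {..<n}"
    then show "((\<lambda>t. (\<gamma> t i - ?a i) / (t - s)) \<longlongrightarrow> \<gamma>' i) (at s)"
      using \<gamma>' by (auto simp: has_field_derivative_iff)
    show "((\<lambda>t. g i (\<gamma> t)) \<longlongrightarrow> g i ?a) (at s)"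
      by (rule continuous_on_tendsto_compose[OF smooth_Rn_continuous_on[OF g(1)] lim a_box \<gamma>_box])
        (use \<open>i \<in> {..<n}\<close> in auto)
  qed
  moreover have "\<forall>\<^sub>F t in at s. (\<Sum>i<n. ((\<gamma> t i - ?a i) / (t - s)) * g i (\<gamma> t)) = (H (\<gamma> t) - H ?a) / (t - s)"
    using \<gamma>_box by eventually_elim (simp add: g(3) sum_divide_distrib)
  ultimately have "((\<lambda>t. (H (\<gamma> t) - H ?a) / (t - s)) \<longlongrightarrow> (\<Sum>i<n. \<gamma>' i * g i ?a)) (at s)"
    by (rule Lim_transform_eventually)
  then show ?thesis
    by (simp add: has_field_derivative_iff g(2) mult.commute)
qed

lemma fun_algebra_sum:
  assumes "\<And>i. i \<in> I \<Longrightarrow> f i \<in> fun_algebra B" "(\<lambda>_. 0) \<in> fun_algebra B"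
  shows "(\<lambda>x. \<Sum>i\<in>I. f i x) \<in> fun_algebra B"
  using assms(1) by (induction I rule: infinite_finite_induct) (auto intro: fun_algebra.add assms(2))

text \<open>The generators are the smooth functions on \<open>W\<close> and the compositions with
  \<open>T\<close> of all smooth functions on \<open>V\<close>. By the chain rule, the partial
  derivatives of a composition are sums of products of generators.\<close>

lemma smooth_Rn_compose:
  assumes V: "openin (Euclidean_space n) V" and W: "openin (Euclidean_space m) W"
    and H: "smooth_Rn n V H"
    and T: "\<And>i. i < n \<Longrightarrow> smooth_Rn m W (\<lambda>x. T x i)" "T ` W \<subseteq> V"
  shows "smooth_Rn m W (\<lambda>x. H (T x))"
proof -
  let ?B = "{f. smooth_Rn m W f} \<union> (\<lambda>H x. H (T x)) ` {H. smooth_Rn n V H}"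
  have V_zero: "\<And>x i. x \<in> V \<Longrightarrow> i \<ge> n \<Longrightarrow> x i = 0"
    using openin_subset[OF V] by (auto simp: Euclidean_space_eq)
  \<comment> \<open>The values of \<open>T\<close> are whole sequences; their coordinates from
    \<open>n\<close> on are constantly 0 because \<open>T\<close> maps into
    \<open>V\<close>.\<close>
  have "continuous_on W T"
  proof (rule continuous_on_coordinatewise_then_product)
    fix i show "continuous_on W (\<lambda>x. T x i)"
    proof (cases "i < n")
      case False
      then show ?thesis
        using V_zero T(2) continuous_on_cong[of W W "\<lambda>x. T x i" "\<lambda>_. 0"] by (auto simp: image_subset_iff)
    qed (rule smooth_Rn_continuous_on[OF T(1)])
  qed
  note T_cont = continuous_on_compose2[OF smooth_Rn_continuous_on this T(2)]
  show ?thesis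
  proof (rule smooth_Rn_fun_algebra[OF W, where B = ?B])
    show "continuous_on W f" if "f \<in> ?B" for f
      using that by (auto intro: smooth_Rn_continuous_on T_cont)
    show "(\<lambda>x. H (T x)) \<in> fun_algebra ?B" using H by (auto intro: fun_algebra.base)
    fix f i assume "f \<in> ?B" "i < m"
    then consider "smooth_Rn m W f" | H where "smooth_Rn n V H" "f = (\<lambda>x. H (T x))" by auto
    then show "\<exists>g\<in>fun_algebra ?B. \<forall>x\<in>W. ((\<lambda>t. f (x(i := t))) has_real_derivative g x) (at (x i))"
    proof cases
      case 1
      then show ?thesis
        using \<open>i < m\<close> by (intro bexI[of _ "partial i f"])
          (auto intro: fun_algebra.base smooth_Rn_has_partial smooth_Rn_partial)
    next
      case 2
      let ?g = "\<lambda>x. \<Sum>j<n. partial j H (T x) * partial i (\<lambda>x. T x j) x"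
      have "?g \<in> fun_algebra ?B"
        using 2(1) T(1) \<open>i < m\<close> smooth_Rn_const[OF W]
        by (intro fun_algebra_sum fun_algebra.mult fun_algebra.base) (auto intro: smooth_Rn_partial)
      moreover have "((\<lambda>t. f (x(i := t))) has_real_derivative ?g x) (at (x i))" if "x \<in> W" for x
      proof -
        have "\<forall>\<^sub>F t in nhds (x i). T (x(i := t)) \<in> V"
          using openin_Euclidean_space_line[OF W that \<open>i < m\<close>] by eventually_elim (use T(2) in auto)
        from smooth_Rn_chain_rule[OF V 2(1) this smooth_Rn_has_partial[OF T(1) \<open>i < m\<close> that]]
        show ?thesis
          unfolding 2(2) fun_upd_triv .
      qed
      ultimately show ?thesis by (intro bexI[of _ ?g] ballI)
    qed
  qed
qed

subsection \<open>Smooth functions on a manifold\<close>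

definition flat :: "nat \<Rightarrow> real \<Rightarrow> real"
  where "flat m y = (if y > 0 then inverse y ^ m / exp (inverse y) else 0)"

text \<open>Substituting x = 1/y turns the limit from the right into that of x^m / exp x at
  infinity.\<close>

lemma flat_tendsto_0: "(flat m \<longlongrightarrow> 0) (at 0)"
proof (rule filterlim_split_at)
  have "\<forall>\<^sub>F y in at_left 0. flat m y = 0"
    by (auto simp: flat_def eventually_at_filter)
  then show "(flat m \<longlongrightarrow> 0) (at_left 0)" by (rule tendsto_eventually)
  have "((\<lambda>y. inverse y ^ m / exp (inverse y)) \<longlongrightarrow> 0) (at_right (0 :: real))"
    by (rule filterlim_compose[where g = "\<lambda>x. x ^ m / exp x",
          OF tendsto_power_div_exp_0 filterlim_inverse_at_top_right])
  moreover have "\<forall>\<^sub>F y in at_right 0. inverse y ^ m / exp (inverse y) = flat m y"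
    by (auto simp: flat_def eventually_at_filter)
  ultimately show "(flat m \<longlongrightarrow> 0) (at_right 0)" by (rule Lim_transform_eventually)
qed

text \<open>The powers of 1/y are part of the definition of \<open>flat\<close> for the sake of this
  formula: with the constants, the family generates an algebra closed under differentiation.\<close>

lemma flat_has_derivative:
  "(flat m has_real_derivative - real m * flat (m + 1) y + flat (m + 2) y) (at y)"
proof -
  consider "y > 0" | "y = 0" | "y < 0" by linarith
  then show ?thesis
  proof cases
    case 1
    have "((\<lambda>y. inverse y ^ m * exp (- inverse y)) has_real_derivative
        - real m * inverse y ^ (m + 1) * exp (- inverse y) + inverse y ^ (m + 2) * exp (- inverse y)) (at y)"
    proof -
      have y: "y \<noteq> 0" using 1 by simp
      show ?thesis
        by (rule DERIV_cong[OF DERIV_mult[OF DERIV_power[OF DERIV_inverse[OF y], of m]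
                DERIV_fun_exp[OF DERIV_minus[OF DERIV_inverse[OF y]]]]])
          (cases m; simp add: algebra_simps)
    qed
    moreover have "(flat m has_real_derivative D) (at y) \<longleftrightarrow>
        ((\<lambda>y. inverse y ^ m * exp (- inverse y)) has_real_derivative D) (at y)" for D
    proof (rule DERIV_cong_ev)
      have "\<forall>\<^sub>F x in nhds y. x > 0"
        using eventually_nhds_in_open[of "{0<..}" y] 1 by simp
      then show "\<forall>\<^sub>F x in nhds y. flat m x = inverse x ^ m * exp (- inverse x)"
        by eventually_elim (simp add: flat_def exp_minus field_simps)
    qed auto
    ultimately show ?thesis using 1 by (simp add: flat_def exp_minus field_simps)
  next
    \<comment> \<open>At 0 the difference quotient of \<open>flat m\<close> is
      \<open>flat (m + 1)\<close>, which tends to 0.\<close>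
    case 2
    have "\<forall>\<^sub>F h in at 0. flat (m + 1) h = (flat m h - flat m 0) / (h - 0)"
      by (auto simp: flat_def field_simps eventually_at_filter)
    then have "(flat m has_real_derivative 0) (at 0)"
      using Lim_transform_eventually[OF flat_tendsto_0[of "m + 1"]] by (auto simp: has_field_derivative_iff)
    then show ?thesis using 2 by (simp add: flat_def)
  next
    case 3
    have "(flat m has_real_derivative 0) (at y) \<longleftrightarrow> ((\<lambda>_. 0) has_real_derivative 0) (at y)"
    proof (rule DERIV_cong_ev)
      have "\<forall>\<^sub>F x in nhds y. x < 0"
        using eventually_nhds_in_open[of "{..<0}" y] 3 by simp
      then show "\<forall>\<^sub>F x in nhds y. flat m x = 0"
        by eventually_elim (simp add: flat_def)
    qed auto
    then show ?thesis using 3 by (simp add: flat_def)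
  qed
qed

section \<open>Charts and smooth functions on a manifold\<close>

locale smooth_mfd =
  fixes M :: "('m::{t2_space, second_countable_topology}) manifold"
  assumes smooth_manifold: "smooth_manifold M"
begin

abbreviation "n \<equiv> mdim M"

lemma chart_cover: "\<exists>U c. (U, c) \<in> atlas M \<and> p \<in> U"
proof -
  have "(\<Union>(U, c)\<in>atlas M. U) = UNIV"
    using smooth_manifold unfolding smooth_manifold_def by (elim conjE)
  then have "p \<in> (\<Union>(U, c)\<in>atlas M. U)" by simp
  then show ?thesis by auto
qed

lemma chart:
  assumes "(U, c) \<in> atlas M"
  shows chart_open: "open U"
    and chart_image_openin: "openin (Euclidean_space n) (c ` U)"
    and chart_homeomorphic: "homeomorphic_map (top_of_set U) (subtopology (Euclidean_space n) (c ` U)) c"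
proof -
  have "\<forall>(U, c)\<in>atlas M. open U \<and> openin (Euclidean_space n) (c ` U) \<and>
       homeomorphic_map (top_of_set U) (subtopology (Euclidean_space n) (c ` U)) c"
    using smooth_manifold unfolding smooth_manifold_def by (elim conjE)
  from bspec[OF this assms]
  show "open U" "openin (Euclidean_space n) (c ` U)"
    "homeomorphic_map (top_of_set U) (subtopology (Euclidean_space n) (c ` U)) c" by auto
qed

lemma chart_transition:
  assumes "(U, c) \<in> atlas M" "(V, d) \<in> atlas M" "i < n"
  shows "smooth_Rn n (c ` (U \<inter> V)) (\<lambda>x. d (inv_into U c x) i)"
proof -
  have "\<forall>(U, c)\<in>atlas M. \<forall>(V, d)\<in>atlas M. \<forall>i<n.
       smooth_Rn n (c ` (U \<inter> V)) (\<lambda>x. d (inv_into U c x) i)"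
    using smooth_manifold unfolding smooth_manifold_def by (elim conjE)
  from bspec[OF this assms(1)] show ?thesis using assms by auto
qed

lemma chart_inj: "(U, c) \<in> atlas M \<Longrightarrow> inj_on c U"
  using homeomorphic_imp_injective_map[OF chart_homeomorphic] by simp

lemma chart_inv_into [simp]: "(U, c) \<in> atlas M \<Longrightarrow> p \<in> U \<Longrightarrow> inv_into U c (c p) = p"
  using chart_inj by (rule inv_into_f_f)

lemma chart_openin_image:
  assumes "(U, c) \<in> atlas M" "open W"
  shows "openin (Euclidean_space n) (c ` (U \<inter> W))"
proof -
  have "openin (subtopology (Euclidean_space n) (c ` U)) (c ` (U \<inter> W))"
    using homeomorphic_map_openness[OF chart_homeomorphic[OF assms(1)], of "U \<inter> W"] assms(2)
    by (simp add: openin_open_Int)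
  then show ?thesis
    using openin_open_subtopology[OF chart_image_openin[OF assms(1)]] by blast
qed

lemma chart_open_preimage:
  assumes "(U, c) \<in> atlas M" "openin (Euclidean_space n) V"
  shows "open {q \<in> U. c q \<in> V}"
proof -
  have "continuous_map (top_of_set U) (Euclidean_space n) c"
    using homeomorphic_imp_continuous_map[OF chart_homeomorphic[OF assms(1)]]
    by (simp add: continuous_map_in_subtopology)
  from openin_continuous_map_preimage[OF this assms(2)]
  show ?thesis using openin_open_trans[OF _ chart_open[OF assms(1)]] by simp
qed

lemma chart_zero: "(U, c) \<in> atlas M \<Longrightarrow> q \<in> U \<Longrightarrow> i \<ge> n \<Longrightarrow> c q i = 0"
  using openin_subset[OF chart_image_openin] by (auto simp: Euclidean_space_eq)

lemma smooth_onD: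
  "smooth_on M W f \<Longrightarrow> (U, c) \<in> atlas M \<Longrightarrow> smooth_Rn n (c ` (U \<inter> W)) (f \<circ> inv_into U c)"
  unfolding smooth_on_def by blast

lemma smooth_onI:
  "(\<And>U c. (U, c) \<in> atlas M \<Longrightarrow> smooth_Rn n (c ` (U \<inter> W)) (\<lambda>x. f (inv_into U c x))) \<Longrightarrow> smooth_on M W f"
  unfolding smooth_on_def by (auto simp: comp_def)

lemma smooth_on_subset: "smooth_on M W f \<Longrightarrow> W' \<subseteq> W \<Longrightarrow> smooth_on M W' f"
  unfolding smooth_on_def by (blast intro: smooth_Rn_subset)

lemma smooth_on_cong:
  assumes "open W" "smooth_on M W f" "\<And>p. p \<in> W \<Longrightarrow> f p = g p"
  shows "smooth_on M W g"
proof (rule smooth_onI)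
  fix U c assume C: "(U, c) \<in> atlas M"
  show "smooth_Rn n (c ` (U \<inter> W)) (\<lambda>x. g (inv_into U c x))"
    by (rule smooth_Rn_cong[OF chart_openin_image[OF C assms(1)] smooth_onD[OF assms(2) C]])
      (use C assms(3) in auto)
qed

lemma smooth_on_local:
  assumes "\<And>p. p \<in> W \<Longrightarrow> \<exists>W'. open W' \<and> p \<in> W' \<and> smooth_on M W' f"
  shows "smooth_on M W f"
proof (rule smooth_onI, rule smooth_Rn_local)
  fix U c assume C: "(U, c) \<in> atlas M"
  show "c ` (U \<inter> W) \<subseteq> {x. \<forall>i\<ge>n. x i = 0}"
    using chart_zero[OF C] by auto
  fix x assume "x \<in> c ` (U \<inter> W)"
  then obtain p where p: "p \<in> U" "p \<in> W" "x = c p" by auto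
  then obtain W' where "open W'" "p \<in> W'" "smooth_on M W' f" using assms by blast
  then show "\<exists>V'. openin (Euclidean_space n) V' \<and> x \<in> V' \<and> smooth_Rn n V' (\<lambda>x. f (inv_into U c x))"
    using chart_openin_image[OF C] smooth_onD[OF _ C, of W' f] p
    by (intro exI[of _ "c ` (U \<inter> W')"]) (auto simp: comp_def)
qed

lemma smooth_on_const: "open W \<Longrightarrow> smooth_on M W (\<lambda>_. r)"
  by (intro smooth_onI smooth_Rn_const chart_openin_image)

lemma smooth_on_add:
  "open W \<Longrightarrow> smooth_on M W f \<Longrightarrow> smooth_on M W g \<Longrightarrow> smooth_on M W (\<lambda>p. f p + g p)"
  by (rule smooth_onI, rule smooth_Rn_add) (auto intro: chart_openin_image dest: smooth_onD simp: comp_def)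

lemma smooth_on_mult:
  "open W \<Longrightarrow> smooth_on M W f \<Longrightarrow> smooth_on M W g \<Longrightarrow> smooth_on M W (\<lambda>p. f p * g p)"
  by (rule smooth_onI, rule smooth_Rn_mult) (auto intro: chart_openin_image dest: smooth_onD simp: comp_def)

lemma smooth_on_diff:
  assumes "open W" "smooth_on M W f" "smooth_on M W g"
  shows "smooth_on M W (\<lambda>p. f p - g p)"
  using smooth_on_add[OF assms(1,2) smooth_on_mult[OF assms(1) smooth_on_const[OF assms(1), of "-1"] assms(3)]]
  by simp

lemma smooth_on_sum:
  "open W \<Longrightarrow> (\<And>i. i \<in> I \<Longrightarrow> smooth_on M W (f i)) \<Longrightarrow> smooth_on M W (\<lambda>p. \<Sum>i\<in>I. f i p)"
  by (induction I rule: infinite_finite_induct) (auto intro: smooth_on_const smooth_on_add)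

lemma smooth_on_prod:
  "open W \<Longrightarrow> (\<And>i. i \<in> I \<Longrightarrow> smooth_on M W (f i)) \<Longrightarrow> smooth_on M W (\<lambda>p. \<Prod>i\<in>I. f i p)"
  by (induction I rule: infinite_finite_induct) (auto intro: smooth_on_const smooth_on_mult)

lemma smooth_on_compose_real:
  assumes W: "open W" and f: "smooth_on M W f" "f ` W \<subseteq> D"
    and H: "\<And>h. h \<in> H \<Longrightarrow> \<exists>h'\<in>fun_algebra H. \<forall>y\<in>D. (h has_real_derivative h' y) (at y)"
    and "h \<in> H"
  shows "smooth_on M W (\<lambda>p. h (f p))"
proof (rule smooth_onI)
  fix U c assume C: "(U, c) \<in> atlas M"
  show "smooth_Rn n (c ` (U \<inter> W)) (\<lambda>x. h (f (inv_into U c x)))"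
    by (rule smooth_Rn_compose_real[OF chart_openin_image[OF C W]
          smooth_onD[OF f(1) C, unfolded comp_def] _ H \<open>h \<in> H\<close>]) (use f(2) C in auto)
qed

lemma smooth_on_inverse:
  assumes "open W" "smooth_on M W f" "\<And>p. p \<in> W \<Longrightarrow> f p \<noteq> 0"
  shows "smooth_on M W (\<lambda>p. inverse (f p))"
\<comment> \<open>\<open>-1\<close> is the factor in the derivative of \<open>inverse\<close>, and
  \<open>0\<close> is the derivative of the constants.\<close>
proof (rule smooth_on_compose_real[OF assms(1,2), where D = "- {0}" and H = "{inverse, \<lambda>_. -1, \<lambda>_. 0}"])
  fix h :: "real \<Rightarrow> real" assume h: "h \<in> {inverse, \<lambda>_. -1, \<lambda>_. 0}"
  let ?A = "fun_algebra {inverse, \<lambda>_. -1, \<lambda>_. 0 :: real}"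
  have "(\<lambda>y. -1 * (inverse y * inverse y)) \<in> ?A"
    by (intro fun_algebra.mult fun_algebra.base) auto
  moreover have "(inverse has_real_derivative -1 * (inverse y * inverse y)) (at y)" if "y \<noteq> 0" for y
    using DERIV_inverse[OF that] by (simp add: power2_eq_square)
  moreover have "(\<lambda>_. 0) \<in> ?A" by (intro fun_algebra.base) auto
  ultimately show "\<exists>h'\<in>?A. \<forall>y\<in>- {0}. (h has_real_derivative h' y) (at y)"
    using h
    apply (elim insertE emptyE)
      apply (intro bexI[of _ "\<lambda>y. -1 * (inverse y * inverse y)"], blast, assumption)
     apply (intro bexI[of _ "\<lambda>_. 0"], simp, assumption)+
    done
qed (use assms in auto)

text \<open>Read in another chart, the function is \<open>G\<close> after a transition map, so
  smoothness of compositions applies.\<close>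

lemma smooth_on_chart_fun:
  assumes C: "(U, c) \<in> atlas M" and V: "openin (Euclidean_space n) V" and G: "smooth_Rn n V G"
    and W: "open W" "W \<subseteq> U" "c ` W \<subseteq> V"
  shows "smooth_on M W (\<lambda>q. G (c q))"
proof (rule smooth_onI)
  fix U' d assume D: "(U', d) \<in> atlas M"
  show "smooth_Rn n (d ` (U' \<inter> W)) (\<lambda>x. G (c (inv_into U' d x)))"
  proof (rule smooth_Rn_compose[OF V chart_openin_image[OF D W(1)] G])
    fix i assume "i < n"
    then have "smooth_Rn n (d ` (U' \<inter> U)) (\<lambda>x. c (inv_into U' d x) i)"
      using chart_transition[OF D C] by blast
    then show "smooth_Rn n (d ` (U' \<inter> W)) (\<lambda>x. c (inv_into U' d x) i)"
      by (rule smooth_Rn_subset) (use W(2) in auto)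
  qed (use W D in auto)
qed

lemma smooth_on_coordinate: "(U, c) \<in> atlas M \<Longrightarrow> smooth_on M U (\<lambda>q. c q i)"
  using smooth_on_chart_fun[OF _ chart_image_openin smooth_Rn_coordinate[OF chart_image_openin] chart_open]
  by blast

text \<open>In a chart, a product of flat functions is positive inside a cube and zero elsewhere.
  Its extension by zero is smooth because \<open>K\<close> is closed in all of \<open>M\<close>, not
  just in the chart domain: \<open>K\<close> is compact and \<open>M\<close> is Hausdorff.\<close>

lemma smooth_bump:
  assumes "open W" "p \<in> W"
  obtains f K where "smooth_on M UNIV f" "closed K" "K \<subseteq> W" "f p = 1" "\<And>q. q \<notin> K \<Longrightarrow> f q = 0"
proof -
  obtain U c where C: "(U, c) \<in> atlas M" and p: "p \<in> U" using chart_cover by blast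
  obtain e where e: "e > 0" "coord_box n (c p) e \<subseteq> c ` (U \<inter> W)"
    using coord_box_basis[OF chart_openin_image[OF C assms(1)], of "c p"] p assms(2) by blast
  \<comment> \<open>Smaller than \<open>e\<close>, so that the closed cube of this half-width lies
    in the open box and hence in the image of the chart.\<close>
  define \<delta> where "\<delta> = e / 2"
  have \<delta>: "\<delta> > 0" "\<delta> < e" using e by (auto simp: \<delta>_def)
  define K where "K = {q \<in> U. \<forall>i<n. \<bar>c q i - c p i\<bar> \<le> \<delta>}"
  define B where "B i = (if i < n then {c p i - \<delta>..c p i + \<delta>} else {0})" for i
  have cK: "c q \<in> coord_box n (c p) e" if "q \<in> K" for q
    using that \<delta> chart_zero[OF C] unfolding K_def coord_box_def by force
  have KW: "K \<subseteq> W"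
  proof
    fix q assume q: "q \<in> K"
    then obtain q' where "q' \<in> U \<inter> W" "c q = c q'" using cK e(2) by blast
    then show "q \<in> W" using chart_inj[OF C] q by (auto simp: K_def inj_on_def)
  qed
  have "c ` K = Pi\<^sub>E UNIV B"
  proof
    show "c ` K \<subseteq> Pi\<^sub>E UNIV B"
      using chart_zero[OF C] by (auto simp: K_def B_def abs_le_iff)
    show "Pi\<^sub>E UNIV B \<subseteq> c ` K"
    proof
      fix x assume x: "x \<in> Pi\<^sub>E UNIV B"
      have x': "i < n \<Longrightarrow> \<bar>x i - c p i\<bar> \<le> \<delta>" "i \<ge> n \<Longrightarrow> x i = 0" for i
        using PiE_mem[OF x, of i] by (auto simp: B_def)
      then have "x \<in> coord_box n (c p) e"
        using \<delta>(2) by (force simp: coord_box_def)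
      then obtain q where "q \<in> U" "x = c q" using e(2) by blast
      then show "x \<in> c ` K" using x' by (auto simp: K_def)
    qed
  qed
  moreover have "compactin (product_topology (\<lambda>_. euclidean) UNIV) (Pi\<^sub>E UNIV B)"
    unfolding compactin_PiE by (auto simp: B_def)
  moreover have "c ` K \<subseteq> {x. \<forall>i\<ge>n. x i = 0}" using chart_zero[OF C] by (auto simp: K_def)
  ultimately have "compactin (Euclidean_space n) (c ` K)"
    by (simp add: Euclidean_space_def compactin_subtopology)
  then have "compactin (subtopology (Euclidean_space n) (c ` U)) (c ` K)"
    by (auto simp: compactin_subtopology K_def)
  then have "compactin (top_of_set U) K"
    using homeomorphic_map_compactness[OF chart_homeomorphic[OF C], of K] by (auto simp: K_def)
  then have "compact K" by (simp add: compactin_subtopology)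
  then have K: "closed K" by (rule compact_imp_closed)
  \<comment> \<open>The factor \<open>inverse (flat 0 (\<delta>\<^sup>2))\<close> normalizes the
    value at \<open>p\<close>, where all coordinate differences are 0.\<close>
  define f where "f q = (if q \<in> U then \<Prod>i<n. flat 0 (\<delta>\<^sup>2 - (c q i - c p i)\<^sup>2) * inverse (flat 0 (\<delta>\<^sup>2)) else 0)" for q
  have f0: "f q = 0" if q: "q \<notin> K" for q
  proof (cases "q \<in> U")
    case True
    then obtain i where i: "i < n" "\<bar>c q i - c p i\<bar> > \<delta>" using q by (auto simp: K_def not_le)
    then have "\<bar>\<delta>\<bar> < \<bar>c q i - c p i\<bar>" using \<delta>(1) by simp
    then have "\<delta>\<^sup>2 \<le> (c q i - c p i)\<^sup>2" by (simp add: abs_le_square_iff[symmetric])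
    then have "flat 0 (\<delta>\<^sup>2 - (c q i - c p i)\<^sup>2) = 0" by (simp add: flat_def)
    then show ?thesis using i(1) by (auto simp: f_def intro!: prod_zero)
  qed (simp add: f_def)
  have fp: "f p = 1"
    using p \<delta>(1) by (simp add: f_def flat_def)
  have U: "open U" using chart_open[OF C] .
  have "smooth_on M U (\<lambda>q. \<Prod>i<n. flat 0 (\<delta>\<^sup>2 - (c q i - c p i)\<^sup>2) * inverse (flat 0 (\<delta>\<^sup>2)))"
  proof (intro smooth_on_prod smooth_on_mult smooth_on_const U)
    fix i assume "i \<in> {..<n}"
    have c: "smooth_on M U (\<lambda>q. \<delta>\<^sup>2 - (c q i - c p i)\<^sup>2)"
      unfolding power2_eq_square
      by (intro smooth_on_diff smooth_on_mult smooth_on_const smooth_on_coordinate[OF C] U)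
    \<comment> \<open>All constants are included because the factor \<open>- real m\<close> in the
      derivative of \<open>flat m\<close> varies with \<open>m\<close>.\<close>
    let ?H = "range flat \<union> {\<lambda>_. r | r. True}"
    show "smooth_on M U (\<lambda>q. flat 0 (\<delta>\<^sup>2 - (c q i - c p i)\<^sup>2))"
    proof (rule smooth_on_compose_real[OF U c, where D = UNIV and H = ?H])
      fix h assume "h \<in> ?H"
      then consider m where "h = flat m" | r where "h = (\<lambda>_. r)" by blast
      then show "\<exists>h'\<in>fun_algebra ?H. \<forall>y\<in>UNIV. (h has_real_derivative h' y) (at y)"
      proof cases
        case 1
        have "(\<lambda>y. - real m * flat (m + 1) y + flat (m + 2) y) \<in> fun_algebra ?H"
          by (intro fun_algebra.add fun_algebra.mult fun_algebra.base) auto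
        then show ?thesis unfolding 1 by (rule rev_bexI) (intro ballI flat_has_derivative)
      next
        case 2
        then show ?thesis
          by (intro bexI[of _ "\<lambda>_. 0"] fun_algebra.base) auto
      qed
    qed auto
  qed
  then have "smooth_on M U f"
    by (rule smooth_on_cong[OF U]) (simp add: f_def)
  moreover have "smooth_on M (- K) f"
    by (rule smooth_on_cong[OF _ smooth_on_const[where r = 0]]) (use K f0 in auto)
  moreover have "q \<in> U \<or> q \<in> - K" for q by (auto simp: K_def)
  ultimately have "smooth_on M UNIV f"
    using U K by (intro smooth_on_local) (metis open_Compl)
  then show ?thesis using that K KW fp f0 by blast
qed

end

lemma sum_fun_apply: "(\<Sum>i\<in>I. f i) x = (\<Sum>i\<in>I. f i x)"
  by (induction I rule: infinite_finite_induct) auto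

lemma linear_over_0:
  assumes "linear_over V f" "subspace V" shows "f 0 = 0"
proof -
  have "f (0 *\<^sub>R 0) = 0 *\<^sub>R f 0"
    using assms subspace_0 unfolding linear_over_def by blast
  then show ?thesis by simp
qed

lemma linear_over_sum:
  assumes "linear_over V f" "subspace V" "\<And>i. i \<in> I \<Longrightarrow> x i \<in> V"
  shows "f (\<Sum>i\<in>I. r i *\<^sub>R x i) = (\<Sum>i\<in>I. r i *\<^sub>R f (x i))"
  using assms(3)
proof (induction I rule: infinite_finite_induct)
  case (insert i I)
  then have "r i *\<^sub>R x i \<in> V" "(\<Sum>i\<in>I. r i *\<^sub>R x i) \<in> V"
    using assms(2) by (auto intro: subspace_scale subspace_sum)
  then have "f (r i *\<^sub>R x i + (\<Sum>i\<in>I. r i *\<^sub>R x i)) = r i *\<^sub>R f (x i) + f (\<Sum>i\<in>I. r i *\<^sub>R x i)"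
    using assms(1) insert.prems unfolding linear_over_def by simp
  then show ?case using insert by simp
qed (auto intro: linear_over_0[OF assms(1,2)])

context smooth_mfd
begin

subsection \<open>Tangent vectors and forms in coordinates\<close>

lemma smooth_nearI: "open W \<Longrightarrow> p \<in> W \<Longrightarrow> smooth_on M W f \<Longrightarrow> smooth_near M p f"
  unfolding smooth_near_def by blast

lemma smooth_near_const: "smooth_near M p (\<lambda>_. r)"
  by (rule smooth_nearI[of UNIV]) (auto intro: smooth_on_const)

lemma smooth_near_binop:
  assumes "smooth_near M p f" "smooth_near M p g"
    and "\<And>W. open W \<Longrightarrow> smooth_on M W f \<Longrightarrow> smooth_on M W g \<Longrightarrow> smooth_on M W h"
  shows "smooth_near M p h"
proof -
  obtain V W where "open V" "p \<in> V" "smooth_on M V f" "open W" "p \<in> W" "smooth_on M W g"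
    using assms(1,2) unfolding smooth_near_def by blast
  then show ?thesis
    by (intro smooth_nearI[of "V \<inter> W"] assms(3)) (auto intro: smooth_on_subset)
qed

lemma smooth_near_add:
  "smooth_near M p f \<Longrightarrow> smooth_near M p g \<Longrightarrow> smooth_near M p (\<lambda>q. f q + g q)"
  by (erule smooth_near_binop, assumption, rule smooth_on_add)

lemma smooth_near_mult:
  "smooth_near M p f \<Longrightarrow> smooth_near M p g \<Longrightarrow> smooth_near M p (\<lambda>q. f q * g q)"
  by (erule smooth_near_binop, assumption, rule smooth_on_mult)

lemma smooth_near_sum:
  "(\<And>i. i \<in> I \<Longrightarrow> smooth_near M p (f i)) \<Longrightarrow> smooth_near M p (\<lambda>q. \<Sum>i\<in>I. f i q)"
  by (induction I rule: infinite_finite_induct) (auto intro: smooth_near_const smooth_near_add)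

lemma smooth_near_coordinate: "(U, c) \<in> atlas M \<Longrightarrow> p \<in> U \<Longrightarrow> smooth_near M p (\<lambda>q. c q i)"
  by (intro smooth_nearI[of U] smooth_on_coordinate chart_open)

lemma tangent_space_rules:
  assumes "v \<in> tangent_space M p" "smooth_near M p f" "smooth_near M p g"
  shows tangent_add: "v (\<lambda>q. f q + g q) = v f + v g"
    and tangent_mult: "v (\<lambda>q. f q * g q) = f p * v g + g p * v f"
    and tangent_cong: "\<forall>\<^sub>F q in nhds p. f q = g q \<Longrightarrow> v f = v g"
  using assms unfolding tangent_space_def by blast+

lemma tangent_scale: "v \<in> tangent_space M p \<Longrightarrow> smooth_near M p f \<Longrightarrow> v (\<lambda>q. r * f q) = r * v f"
  unfolding tangent_space_def by blast

lemma tangent_not_smooth: "v \<in> tangent_space M p \<Longrightarrow> \<not> smooth_near M p f \<Longrightarrow> v f = 0"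
  unfolding tangent_space_def by blast

text \<open>Since 1 = 1 * 1, the product rule forces the value on 1 to equal twice itself.\<close>

lemma tangent_const:
  assumes "v \<in> tangent_space M p" shows "v (\<lambda>_. r) = 0"
proof -
  have "v (\<lambda>_. 1) = 0"
    using tangent_mult[OF assms smooth_near_const[of p 1] smooth_near_const[of p 1]] by simp
  then show ?thesis using tangent_scale[OF assms smooth_near_const[of p 1], of r] by simp
qed

lemma tangent_sum:
  assumes "v \<in> tangent_space M p" "\<And>i. i \<in> I \<Longrightarrow> smooth_near M p (f i)"
  shows "v (\<lambda>q. \<Sum>i\<in>I. f i q) = (\<Sum>i\<in>I. v (f i))"
  using assms(2)
  by (induction I rule: infinite_finite_induct)
    (auto simp: tangent_const[OF assms(1)] tangent_add[OF assms(1)] smooth_near_sum)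

lemma subspace_tangent_space: "subspace (tangent_space M p)"
  unfolding subspace_def
proof (intro conjI ballI allI)
  show "0 \<in> tangent_space M p" by (auto simp: tangent_space_def)
next
  fix v w assume v: "v \<in> tangent_space M p" and w: "w \<in> tangent_space M p"
  show "v + w \<in> tangent_space M p"
    unfolding tangent_space_def mem_Collect_eq
  proof (intro conjI allI impI)
    fix f g assume fg: "smooth_near M p f" "smooth_near M p g"
    show "(v + w) (\<lambda>q. f q + g q) = (v + w) f + (v + w) g"
      using tangent_add[OF v fg] tangent_add[OF w fg] by simp
    show "(v + w) (\<lambda>q. f q * g q) = f p * (v + w) g + g p * (v + w) f"
      using tangent_mult[OF v fg] tangent_mult[OF w fg] by (simp add: algebra_simps)
    assume "\<forall>\<^sub>F q in nhds p. f q = g q"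
    then show "(v + w) f = (v + w) g"
      using tangent_cong[OF v fg] tangent_cong[OF w fg] by simp
  next
    fix r f assume f: "smooth_near M p f"
    show "(v + w) (\<lambda>q. r * f q) = r * (v + w) f"
      using tangent_scale[OF v f] tangent_scale[OF w f] by (simp add: algebra_simps)
  next
    fix f assume f: "\<not> smooth_near M p f"
    show "(v + w) f = 0"
      using tangent_not_smooth[OF v f] tangent_not_smooth[OF w f] by simp
  qed
next
  fix r v assume v: "v \<in> tangent_space M p"
  show "r *\<^sub>R v \<in> tangent_space M p"
    unfolding tangent_space_def mem_Collect_eq scaleR_fun_def
  proof (intro conjI allI impI)
    fix f g assume fg: "smooth_near M p f" "smooth_near M p g"
    show "r *\<^sub>R v (\<lambda>q. f q + g q) = r *\<^sub>R v f + r *\<^sub>R v g"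
      using tangent_add[OF v fg] by (simp add: algebra_simps)
    show "r *\<^sub>R v (\<lambda>q. f q * g q) = f p * (r *\<^sub>R v g) + g p * (r *\<^sub>R v f)"
      using tangent_mult[OF v fg] by (simp add: algebra_simps)
    assume "\<forall>\<^sub>F q in nhds p. f q = g q"
    then show "r *\<^sub>R v f = r *\<^sub>R v g"
      using tangent_cong[OF v fg] by simp
  next
    fix s f assume f: "smooth_near M p f"
    show "r *\<^sub>R v (\<lambda>q. s * f q) = s * (r *\<^sub>R v f)"
      using tangent_scale[OF v f] by simp
  next
    fix f assume f: "\<not> smooth_near M p f"
    show "r *\<^sub>R v f = 0"
      using tangent_not_smooth[OF v f] by simp
  qed
qed

lemma coord_vec_deriv:
  assumes "(U, c) \<in> atlas M" "p \<in> U" "smooth_near M p f" "i < n"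
  shows "((\<lambda>t. f (inv_into U c ((c p)(i := t)))) has_real_derivative coord_vec M (U, c) p i f) (at (c p i))"
proof -
  obtain W where W: "open W" "p \<in> W" "smooth_on M W f"
    using assms(3) unfolding smooth_near_def by blast
  from smooth_Rn_has_partial[OF smooth_onD[OF W(3) assms(1)] assms(4), of "c p"]
  show ?thesis using assms W by (simp add: coord_vec_def)
qed

text \<open>Trades the operator \<open>deriv\<close> for the uniqueness of an existing derivative,
  so that the derivation laws for \<open>coord_vec\<close> come from the differentiation
  rules.\<close>

lemma coord_vec_eqI:
  assumes "(U, c) \<in> atlas M" "p \<in> U" "smooth_near M p f" "i < n"
    and "((\<lambda>t. f (inv_into U c ((c p)(i := t)))) has_real_derivative D) (at (c p i))"
  shows "coord_vec M (U, c) p i f = D"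
  using DERIV_unique[OF coord_vec_deriv[OF assms(1-4)] assms(5)] .

lemma coord_vec_in_tangent_space:
  assumes C: "(U, c) \<in> atlas M" and p: "p \<in> U" and i: "i < n"
  shows "coord_vec M (U, c) p i \<in> tangent_space M p"
proof -
  note deriv = coord_vec_deriv[OF C p _ i] and eqI = coord_vec_eqI[OF C p _ i]
  have pp: "inv_into U c ((c p)(i := c p i)) = p" using C p by simp
  show ?thesis
    unfolding tangent_space_def mem_Collect_eq
  proof (intro conjI allI impI)
    fix f g assume f: "smooth_near M p f" and g: "smooth_near M p g"
    show "coord_vec M (U, c) p i (\<lambda>q. f q + g q) = coord_vec M (U, c) p i f + coord_vec M (U, c) p i g"
      by (intro eqI smooth_near_add f g DERIV_add deriv)
    show "coord_vec M (U, c) p i (\<lambda>q. f q * g q) =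
        f p * coord_vec M (U, c) p i g + g p * coord_vec M (U, c) p i f"
      using DERIV_mult[OF deriv[OF f] deriv[OF g]] unfolding pp
      by (intro eqI smooth_near_mult f g) (simp add: mult.commute add.commute)
    assume ev: "\<forall>\<^sub>F q in nhds p. f q = g q"
    then obtain W where W: "open W" "p \<in> W" "\<And>q. q \<in> W \<Longrightarrow> f q = g q"
      unfolding eventually_nhds by blast
    show "coord_vec M (U, c) p i f = coord_vec M (U, c) p i g"
      by (rule eqI[OF f], subst has_derivative_line_cong[OF chart_openin_image[OF C W(1)] _ i, where
            g = "\<lambda>x. g (inv_into U c x)"]) (use C p W deriv[OF g] in auto)
  next
    fix r f assume f: "smooth_near M p f"
    show "coord_vec M (U, c) p i (\<lambda>q. r * f q) = r * coord_vec M (U, c) p i f"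
      by (intro eqI smooth_near_mult smooth_near_const f DERIV_cmult deriv)
  next
    fix f assume "\<not> smooth_near M p f"
    then show "coord_vec M (U, c) p i f = 0" by (simp add: coord_vec_def)
  qed
qed

text \<open>Hadamard's lemma writes \<open>f\<close> near \<open>p\<close> as a constant plus
  products of \<open>c q i - c p i\<close> with smooth \<open>g i\<close>. The first factor vanishes
  at \<open>p\<close>, so a derivation sends each product to \<open>g i (c p)\<close> times its
  value on the coordinate, and \<open>g i (c p)\<close> is the \<open>i\<close>-th partial
  derivative of \<open>f\<close>.\<close>

lemma tangent_expansion:
  assumes v: "v \<in> tangent_space M p" and C: "(U, c) \<in> atlas M" and p: "p \<in> U"
  shows "v = (\<Sum>i<n. v (\<lambda>q. c q i) *\<^sub>R coord_vec M (U, c) p i)"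
proof
  fix f
  have "v f = (\<Sum>i<n. v (\<lambda>q. c q i) * coord_vec M (U, c) p i f)"
  \<comment> \<open>On functions that are not smooth near \<open>p\<close> both sides are 0 by
    convention.\<close>
  proof (cases "smooth_near M p f")
    case False
    then show ?thesis using tangent_not_smooth[OF v] by (simp add: coord_vec_def)
  next
    case True
    then obtain W where W: "open W" "p \<in> W" "smooth_on M W f" unfolding smooth_near_def by blast
    obtain e where e: "e > 0" "coord_box n (c p) e \<subseteq> c ` (U \<inter> W)"
      using coord_box_basis[OF chart_openin_image[OF C W(1)], of "c p"] p W(2) by blast
    let ?F = "f \<circ> inv_into U c" and ?B = "coord_box n (c p) e"
    have cp: "c p \<in> ?B" using e chart_zero[OF C p] by (simp add: coord_box_def)
    obtain g where g: "\<And>i. i < n \<Longrightarrow> smooth_Rn n ?B (g i)"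
      "\<And>i. i < n \<Longrightarrow> g i (c p) = partial i ?F (c p)"
      "\<And>x. x \<in> ?B \<Longrightarrow> ?F x = ?F (c p) + (\<Sum>i<n. (x i - c p i) * g i x)"
      using hadamard_lemma[OF smooth_Rn_subset[OF smooth_onD[OF W(3) C] e(2)] cp] by blast
    \<comment> \<open>The coefficients \<open>g i\<close> are known to be smooth only on the box, so
      the equality of germs is set up on its preimage.\<close>
    define W' where "W' = {q \<in> U. c q \<in> ?B}"
    have W': "open W'" "p \<in> W'"
      using chart_open_preimage[OF C openin_coord_box] cp p by (auto simp: W'_def)
    have near_g: "smooth_near M p (\<lambda>q. g i (c q))" if "i < n" for i
      by (rule smooth_nearI[OF W'], rule smooth_on_chart_fun[OF C openin_coord_box g(1)[OF that] W'(1)])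
        (auto simp: W'_def)
    have near_c: "smooth_near M p (\<lambda>q. c q i + - c p i)" for i
      by (intro smooth_near_add smooth_near_coordinate[OF C p] smooth_near_const)
    define h where "h q = f p + (\<Sum>i<n. (c q i + - c p i) * g i (c q))" for q
    have near_h: "smooth_near M p h"
      unfolding h_def
      by (intro smooth_near_add smooth_near_const smooth_near_sum smooth_near_mult near_c near_g) auto
    have "\<forall>\<^sub>F q in nhds p. f q = h q"
      using eventually_nhds_in_open[OF W']
    proof eventually_elim
      case (elim q)
      then show ?case using g(3)[of "c q"] C p by (auto simp: W'_def h_def)
    qed
    then have "v f = v h" using tangent_cong[OF v True near_h] by blast
    also have "\<dots> = (\<Sum>i<n. v (\<lambda>q. (c q i + - c p i) * g i (c q)))"
      unfolding h_def
      by (subst tangent_add[OF v]; (subst tangent_sum[OF v])?)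
        (auto simp: tangent_const[OF v] intro!: smooth_near_const smooth_near_sum smooth_near_mult near_g near_c[simplified])
    also have "\<dots> = (\<Sum>i<n. v (\<lambda>q. c q i) * coord_vec M (U, c) p i f)"
    proof (intro sum.cong refl)
      fix i assume "i \<in> {..<n}"
      then have "v (\<lambda>q. (c q i + - c p i) * g i (c q)) = g i (c p) * v (\<lambda>q. c q i + - c p i)"
        using tangent_mult[OF v near_c near_g] by simp
      also have "v (\<lambda>q. c q i + - c p i) = v (\<lambda>q. c q i)"
        unfolding tangent_add[OF v smooth_near_coordinate[OF C p, of i] smooth_near_const[of p "- c p i"]]
          tangent_const[OF v] by simp
      also have "g i (c p) = coord_vec M (U, c) p i f"
        using g(2) \<open>i \<in> {..<n}\<close> True by (simp add: coord_vec_def)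
      finally show "v (\<lambda>q. (c q i + - c p i) * g i (c q)) = v (\<lambda>q. c q i) * coord_vec M (U, c) p i f"
        by simp
    qed
    finally show ?thesis .
  qed
  then show "v f = (\<Sum>i<n. v (\<lambda>q. c q i) *\<^sub>R coord_vec M (U, c) p i) f"
    by (simp add: sum_fun_apply scaleR_fun_def)
qed

section \<open>Alternating forms and their components\<close>

lemma subspace_ext_power: "subspace (ext_power M k p)"
  unfolding subspace_def
proof (intro conjI ballI allI)
  show "0 \<in> ext_power M k p" by (auto simp: ext_power_def linear_over_def)
next
  fix \<alpha> \<beta> assume "\<alpha> \<in> ext_power M k p" "\<beta> \<in> ext_power M k p"
  then show "\<alpha> + \<beta> \<in> ext_power M k p"
    by (auto simp: ext_power_def linear_over_def algebra_simps)
next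
  fix r \<alpha> assume "\<alpha> \<in> ext_power M k p"
  then show "r *\<^sub>R \<alpha> \<in> ext_power M k p"
    by (auto simp: ext_power_def linear_over_def scaleR_fun_def algebra_simps)
qed

lemma tuples_update: "vs \<in> tuples M k p \<Longrightarrow> v \<in> tangent_space M p \<Longrightarrow> vs[i := v] \<in> tuples M k p"
  using set_update_subset_insert[of vs i v] by (auto simp: tuples_def)

lemma ext_power_rules:
  assumes "\<alpha> \<in> ext_power M k p" "vs \<in> tuples M k p" "i < k"
  shows ext_power_linear: "linear_over (tangent_space M p) (\<lambda>v. \<alpha> (vs[i := v]))"
    and ext_power_alternating: "j < k \<Longrightarrow> i \<noteq> j \<Longrightarrow> vs ! i = vs ! j \<Longrightarrow> \<alpha> vs = 0"
  using assms unfolding ext_power_def by blast+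

text \<open>Polarization: the value with \<open>a + b\<close> in both slots is 0, and is expanded in
  each slot.\<close>

lemma ext_power_swap:
  assumes \<alpha>: "\<alpha> \<in> ext_power M k p" and vs: "vs \<in> tuples M k p" and ij: "i < k" "j < k" "i \<noteq> j"
    and a: "a \<in> tangent_space M p" and b: "b \<in> tangent_space M p"
  shows "\<alpha> (vs[i := b, j := a]) = - \<alpha> (vs[i := a, j := b])"
proof -
  have ab: "a + b \<in> tangent_space M p" using subspace_add[OF subspace_tangent_space a b] .
  have len: "length vs = k" using vs by (simp add: tuples_def)
  have alt: "\<alpha> (vs[i := v, j := v]) = 0" if "v \<in> tangent_space M p" for v
    by (rule ext_power_alternating[OF \<alpha> _ ij])
      (use vs that ij len in \<open>auto intro: tuples_update\<close>)
  have lin_j: "\<alpha> (vs[i := v, j := a + b]) = \<alpha> (vs[i := v, j := a]) + \<alpha> (vs[i := v, j := b])"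
    if "v \<in> tangent_space M p" for v
    using ext_power_linear[OF \<alpha> tuples_update[OF vs that] ij(2)] a b unfolding linear_over_def by blast
  have "\<alpha> (vs[i := a + b, j := a + b]) = \<alpha> (vs[i := a, j := a + b]) + \<alpha> (vs[i := b, j := a + b])"
    using ext_power_linear[OF \<alpha> tuples_update[OF vs ab] ij(1), of j] a b ij(3)
    unfolding linear_over_def by (simp add: list_update_swap)
  then show ?thesis using alt[OF ab] alt[OF a] alt[OF b] lin_j[OF a] lin_j[OF b] by simp
qed

text \<open>Multilinearity reduces arbitrary arguments to coordinate vectors, a repeated index gives
  0, and distinct indices can be sorted at the cost of a sign.\<close>

lemma ext_power_eq_0I:
  assumes \<alpha>: "\<alpha> \<in> ext_power M k p" and C: "(U, c) \<in> atlas M" and p: "p \<in> U"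
    and zero: "\<And>is. is \<in> multi_indices n k \<Longrightarrow> \<alpha> (map (coord_vec M (U, c) p) is) = 0"
  shows "\<alpha> = 0"
proof -
  let ?d = "coord_vec M (U, c) p"
  have tup: "map ?d is \<in> tuples M k p" if "length is = k" "set is \<subseteq> {..<n}" for "is"
    using that coord_vec_in_tangent_space[OF C p] by (auto simp: tuples_def)
  \<comment> \<open>Only vanishing is tracked, so the sign of a transposition disappears.\<close>
  have swap: "\<alpha> (map ?d (xs @ a # b # ys)) = 0 \<longleftrightarrow> \<alpha> (map ?d (xs @ b # a # ys)) = 0"
    if "length (xs @ a # b # ys) = k" "set (xs @ a # b # ys) \<subseteq> {..<n}" for xs a b ys
    using ext_power_swap[OF \<alpha> tup[OF that], of "length xs" "Suc (length xs)" "?d a" "?d b"]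
      that coord_vec_in_tangent_space[OF C p]
    by (simp add: list_update_append)
  \<comment> \<open>Insertion sort is a sequence of adjacent transpositions. The prefix
    \<open>pre\<close> holds the entries already passed and makes the induction go through.\<close>
  have insort: "\<alpha> (map ?d (pre @ insort x xs)) = 0 \<longleftrightarrow> \<alpha> (map ?d (pre @ x # xs)) = 0"
    if "length (pre @ x # xs) = k" "set (pre @ x # xs) \<subseteq> {..<n}" for pre x xs
    using that
  proof (induction xs arbitrary: pre)
    case (Cons y ys)
    have "\<alpha> (map ?d ((pre @ [y]) @ insort x ys)) = 0 \<longleftrightarrow> \<alpha> (map ?d ((pre @ [y]) @ x # ys)) = 0"
      by (rule Cons.IH) (use Cons.prems in auto)
    then show ?case using swap[of pre y x ys] Cons.prems by auto
  qed auto
  have sort: "\<alpha> (map ?d (pre @ sort xs)) = 0 \<longleftrightarrow> \<alpha> (map ?d (pre @ xs)) = 0"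
    if "length (pre @ xs) = k" "set (pre @ xs) \<subseteq> {..<n}" for pre xs
    using that
  proof (induction xs arbitrary: pre)
    case (Cons x xs)
    have "\<alpha> (map ?d ((pre @ [x]) @ sort xs)) = 0 \<longleftrightarrow> \<alpha> (map ?d ((pre @ [x]) @ xs)) = 0"
      by (rule Cons.IH) (use Cons.prems in auto)
    then show ?case using insort[of pre x "sort xs"] Cons.prems by auto
  qed auto
  have base: "\<alpha> (map ?d is) = 0" if "is": "length is = k" "set is \<subseteq> {..<n}" for "is"
  proof (cases "distinct is")
    case True
    then have "sort is \<in> multi_indices n k"
      using "is" by (auto simp: multi_indices_def strict_sorted_iff)
    then show ?thesis using zero sort[of "[]" "is"] "is" by simp
  next
    case False
    then obtain i j where "i < k" "j < k" "i \<noteq> j" "is ! i = is ! j"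
      using "is"(1) by (auto simp: distinct_conv_nth)
    then show ?thesis using ext_power_alternating[OF \<alpha> tup[OF "is"]] "is"(1) by auto
  qed
  \<comment> \<open>\<open>m\<close> bounds the slots that may still hold arbitrary vectors; the
    induction step expands slot \<open>m\<close> in coordinate vectors. For \<open>m = k\<close> the
    last condition is void.\<close>
  have "\<alpha> vs = 0" if "m \<le> k" "vs \<in> tuples M k p" "\<And>i. m \<le> i \<Longrightarrow> i < k \<Longrightarrow> vs ! i \<in> ?d ` {..<n}" for m vs
    using that
  proof (induction m arbitrary: vs)
    case 0
    then have "set vs \<subseteq> ?d ` {..<n}" by (auto simp: tuples_def in_set_conv_nth)
    then have "vs \<in> map ?d ` lists {..<n}" by (auto simp flip: lists_image)
    then obtain "is" where "vs = map ?d is" "set is \<subseteq> {..<n}" by auto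
    then show ?case using base 0 by (auto simp: tuples_def)
  next
    case (Suc m)
    have len: "length vs = k" and vm: "vs ! m \<in> tangent_space M p"
      using Suc.prems by (auto simp: tuples_def)
    have "\<alpha> (vs[m := vs ! m]) = \<alpha> (vs[m := \<Sum>i<n. (vs ! m) (\<lambda>q. c q i) *\<^sub>R ?d i])"
      using tangent_expansion[OF vm C p] by simp
    also have "\<dots> = (\<Sum>i<n. (vs ! m) (\<lambda>q. c q i) *\<^sub>R \<alpha> (vs[m := ?d i]))"
      by (rule linear_over_sum[OF ext_power_linear[OF \<alpha> Suc.prems(2)] subspace_tangent_space])
        (use Suc.prems coord_vec_in_tangent_space[OF C p] in auto)
    also have "\<dots> = 0"
    proof (intro sum.neutral ballI)
      fix i assume i: "i \<in> {..<n}"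
      have "\<alpha> (vs[m := ?d i]) = 0"
      proof (rule Suc.IH)
        show "vs[m := ?d i] \<in> tuples M k p"
          using i by (intro tuples_update Suc.prems coord_vec_in_tangent_space[OF C p]) auto
        fix l assume "m \<le> l" "l < k"
        then show "vs[m := ?d i] ! l \<in> ?d ` {..<n}"
          using i Suc.prems(3) len by (cases "l = m") auto
      qed (use Suc.prems in auto)
      then show "(vs ! m) (\<lambda>q. c q i) *\<^sub>R \<alpha> (vs[m := ?d i]) = 0" by simp
    qed
    finally show ?case by simp
  qed
  then have "\<alpha> vs = 0" if "vs \<in> tuples M k p" for vs
    using that by (metis leD le_refl)
  moreover have "\<alpha> vs = 0" if "vs \<notin> tuples M k p" for vs
    using \<alpha> that unfolding ext_power_def by blast
  ultimately show ?thesis by (intro ext) (simp add: zero_fun_def, blast)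
qed

end

subsection \<open>Bundles\<close>

text \<open>\<open>local_frame\<close> speaks of the set of frame vectors and of injectivity.
  Coefficients need the indexed form, which this lemma and the next provide.\<close>

lemma independent_family_iff:
  fixes f :: "'i \<Rightarrow> 'v::real_vector"
  assumes "finite I"
  shows "inj_on f I \<and> independent (f ` I) \<longleftrightarrow> (\<forall>d. (\<Sum>i\<in>I. d i *\<^sub>R f i) = 0 \<longrightarrow> (\<forall>i\<in>I. d i = 0))"
    (is "?L \<longleftrightarrow> ?R")
proof
  assume L: ?L
  show ?R
  proof (intro allI impI ballI)
    fix d i assume d: "(\<Sum>i\<in>I. d i *\<^sub>R f i) = 0" and i: "i \<in> I"
    have "(\<Sum>v\<in>f ` I. d (inv_into I f v) *\<^sub>R v) = (\<Sum>i\<in>I. d i *\<^sub>R f i)"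
      using L by (auto simp: sum.reindex intro!: sum.cong)
    then have "d (inv_into I f (f i)) = 0"
      using independentD[of "f ` I" "f ` I" "\<lambda>v. d (inv_into I f v)" "f i"] L d i assms by auto
    then show "d i = 0" using L i by auto
  qed
next
  assume R: ?R
  have inj: "inj_on f I"
  proof (rule inj_onI, rule ccontr)
    fix i j assume ij: "i \<in> I" "j \<in> I" "f i = f j" "i \<noteq> j"
    \<comment> \<open>The coefficients of the relation \<open>f i - f j = 0\<close>.\<close>
    let ?d = "\<lambda>l. (if l = i then 1 else 0) - (if l = j then 1 else (0 :: real))"
    have "(\<Sum>l\<in>I. ?d l *\<^sub>R f l) = 0"
      using ij assms by (simp add: scaleR_left_diff_distrib sum_subtractf if_distrib[of "\<lambda>r. r *\<^sub>R _"]
          cong: if_cong)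
    then have "\<forall>l\<in>I. ?d l = 0" using R[rule_format, of ?d] by blast
    then show False using ij by auto
  qed
  moreover have "independent (f ` I)"
  proof
    assume "dependent (f ` I)"
    then obtain u v where u: "v \<in> f ` I" "u v \<noteq> 0" "(\<Sum>v\<in>f ` I. u v *\<^sub>R v) = 0"
      using dependent_finite[of "f ` I"] assms by auto
    have "(\<Sum>i\<in>I. u (f i) *\<^sub>R f i) = 0" using u(3) inj by (simp add: sum.reindex)
    then show False using R[rule_format, of "\<lambda>i. u (f i)"] u by auto
  qed
  ultimately show ?L by blast
qed

lemma span_family:
  fixes f :: "'i \<Rightarrow> 'v::real_vector"
  assumes "finite I" "inj_on f I"
  shows "span (f ` I) = range (\<lambda>d. \<Sum>i\<in>I. d i *\<^sub>R f i)"
proof -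
  have "(\<Sum>v\<in>f ` I. u v *\<^sub>R v) = (\<Sum>i\<in>I. u (f i) *\<^sub>R f i)" for u
    using assms by (simp add: sum.reindex)
  then have "span (f ` I) = range (\<lambda>u. \<Sum>i\<in>I. u (f i) *\<^sub>R f i)"
    using assms(1) by (simp add: span_finite)
  also have "\<dots> = range (\<lambda>d. \<Sum>i\<in>I. d i *\<^sub>R f i)"
  proof
    show "range (\<lambda>d. \<Sum>i\<in>I. d i *\<^sub>R f i) \<subseteq> range (\<lambda>u. \<Sum>i\<in>I. u (f i) *\<^sub>R f i)"
    proof clarify
      fix d :: "'i \<Rightarrow> real"
      have "(\<Sum>i\<in>I. d i *\<^sub>R f i) = (\<Sum>i\<in>I. (\<lambda>v. d (inv_into I f v)) (f i) *\<^sub>R f i)"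
        using assms by (intro sum.cong) auto
      then show "(\<Sum>i\<in>I. d i *\<^sub>R f i) \<in> range (\<lambda>u. \<Sum>i\<in>I. u (f i) *\<^sub>R f i)"
        by (intro image_eqI[where x = "\<lambda>v. d (inv_into I f v)"]) auto
    qed
  qed auto
  finally show ?thesis .
qed

section \<open>Frames and coordinates of a vector bundle\<close>

lemma vector_bundleD:
  assumes "vector_bundle M E" "(U, \<psi>) \<in> triv E"
  shows "open U"
    and "\<And>p. p \<in> U \<Longrightarrow> linear_over (fib E p) (\<psi> p)"
    and "\<And>p. p \<in> U \<Longrightarrow> bij_betw (\<psi> p) (fib E p) (coord_space (idx E))"
proof -
  have "\<forall>(U, \<psi>)\<in>triv E. open U \<and>
       (\<forall>p\<in>U. linear_over (fib E p) (\<psi> p) \<and> bij_betw (\<psi> p) (fib E p) (coord_space (idx E)))"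
    using assms(1) unfolding vector_bundle_def by (elim conjE)
  from bspec[OF this assms(2)]
  show "open U" "\<And>p. p \<in> U \<Longrightarrow> linear_over (fib E p) (\<psi> p)"
    "\<And>p. p \<in> U \<Longrightarrow> bij_betw (\<psi> p) (fib E p) (coord_space (idx E))" by auto
qed

lemma vector_bundle_finite_idx: "vector_bundle M E \<Longrightarrow> finite (idx E)"
  unfolding vector_bundle_def by (elim conjE)

lemma vector_bundle_subspace: "vector_bundle M E \<Longrightarrow> subspace (fib E p)"
  unfolding vector_bundle_def by (elim conjE) (erule spec)

lemma vector_bundle_cover:
  assumes "vector_bundle M E" obtains U \<psi> where "(U, \<psi>) \<in> triv E" "p \<in> U"
proof -
  have "(\<Union>(U, \<psi>)\<in>triv E. U) = UNIV" using assms unfolding vector_bundle_def by (elim conjE)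
  then have "p \<in> (\<Union>(U, \<psi>)\<in>triv E. U)" by simp
  then show ?thesis using that by auto
qed

lemma vector_bundle_transition:
  assumes "vector_bundle M E" "(U, \<psi>) \<in> triv E" "(V, \<theta>) \<in> triv E" "i \<in> idx E" "j \<in> idx E"
  shows "smooth_on M (U \<inter> V) (\<lambda>p. \<theta> p (frame_vec E \<psi> p j) i)"
proof -
  have "\<forall>(U, \<psi>)\<in>triv E. \<forall>(V, \<theta>)\<in>triv E. \<forall>i\<in>idx E. \<forall>j\<in>idx E.
       smooth_on M (U \<inter> V) (\<lambda>p. \<theta> p (frame_vec E \<psi> p j) i)"
    using assms(1) unfolding vector_bundle_def by (elim conjE)
  from bspec[OF this assms(2)] show ?thesis using assms by auto
qed

lemma frame_vec:
  assumes "vector_bundle M E" "(U, \<psi>) \<in> triv E" "p \<in> U" "j \<in> idx E"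
  shows frame_vec_in_fib: "frame_vec E \<psi> p j \<in> fib E p"
    and triv_frame_vec: "\<psi> p (frame_vec E \<psi> p j) = (\<lambda>i. if i = j then 1 else 0)"
proof -
  have "(\<lambda>i. if i = j then 1 else 0) \<in> \<psi> p ` fib E p"
    using vector_bundleD(3)[OF assms(1-3)] assms(4) by (auto simp: bij_betw_def coord_space_def)
  then show "frame_vec E \<psi> p j \<in> fib E p" "\<psi> p (frame_vec E \<psi> p j) = (\<lambda>i. if i = j then 1 else 0)"
    unfolding frame_vec_def by (auto intro: inv_into_into f_inv_into_f)
qed

lemma triv_frame_sum:
  assumes E: "vector_bundle M E" "(U, \<psi>) \<in> triv E" "p \<in> U" and "i \<in> idx E"
  shows "\<psi> p (\<Sum>j\<in>idx E. d j *\<^sub>R frame_vec E \<psi> p j) i = d i"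
proof -
  have "\<psi> p (\<Sum>j\<in>idx E. d j *\<^sub>R frame_vec E \<psi> p j) = (\<Sum>j\<in>idx E. d j *\<^sub>R \<psi> p (frame_vec E \<psi> p j))"
    using vector_bundleD(2)[OF E] vector_bundle_subspace[OF E(1)] frame_vec_in_fib[OF E]
    by (rule linear_over_sum)
  then show ?thesis
    using \<open>i \<in> idx E\<close> vector_bundle_finite_idx[OF E(1)] triv_frame_vec[OF E]
    by (simp add: sum_fun_apply scaleR_fun_def if_distrib[of "\<lambda>x. _ * x"] cong: if_cong)
qed

lemma frame_expansion:
  assumes E: "vector_bundle M E" "(U, \<psi>) \<in> triv E" "p \<in> U" and a: "a \<in> fib E p"
  shows "a = (\<Sum>j\<in>idx E. \<psi> p a j *\<^sub>R frame_vec E \<psi> p j)" (is "a = ?b")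
proof (rule inj_onD)
  show "inj_on (\<psi> p) (fib E p)" using vector_bundleD(3)[OF E] by (simp add: bij_betw_def)
  show "a \<in> fib E p" by fact
  show b: "?b \<in> fib E p"
    using vector_bundle_subspace[OF E(1)] frame_vec_in_fib[OF E] by (intro subspace_sum subspace_scale)
  show "\<psi> p a = \<psi> p ?b"
  proof
    fix i
    have "\<psi> p a \<in> coord_space (idx E)" "\<psi> p ?b \<in> coord_space (idx E)"
      using vector_bundleD(3)[OF E] a b by (auto simp: bij_betw_def)
    then show "\<psi> p a i = \<psi> p ?b i"
      using triv_frame_sum[OF E] by (cases "i \<in> idx E") (auto simp: coord_space_def)
  qed
qed

lemma frame_independent:
  assumes E: "vector_bundle M E" "(U, \<psi>) \<in> triv E" "p \<in> U"
    and "(\<Sum>j\<in>idx E. d j *\<^sub>R frame_vec E \<psi> p j) = 0" "j \<in> idx E"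
  shows "d j = 0"
  using triv_frame_sum[OF E assms(5), of d] assms(4)
    linear_over_0[OF vector_bundleD(2)[OF E] vector_bundle_subspace[OF E(1)]] by simp

text \<open>What is left of a vector bundle when smoothness of the transition functions and surjectivity of the
  coordinates are dropped.  The bundle \<open>higher_TM\<close> has this property at once.\<close>

definition coordinatized :: "('m::topological_space, 'a::real_vector, 'i, 'z) vbundle_scheme \<Rightarrow> bool"
  where "coordinatized E \<longleftrightarrow>
    finite (idx E) \<and> (\<forall>p. subspace (fib E p)) \<and> (\<forall>p. \<exists>U \<psi>. (U, \<psi>) \<in> triv E \<and> p \<in> U) \<and>
    (\<forall>U \<psi>. (U, \<psi>) \<in> triv E \<longrightarrow> open U \<and>
       (\<forall>p\<in>U. linear_over (fib E p) (\<psi> p) \<and> (\<forall>a\<in>fib E p. (\<forall>i\<in>idx E. \<psi> p a i = 0) \<longrightarrow> a = 0)))"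

lemma coordinatizedD:
  assumes "coordinatized E"
  shows "finite (idx E)" "subspace (fib E p)" "\<exists>U \<psi>. (U, \<psi>) \<in> triv E \<and> p \<in> U"
    and "(U, \<psi>) \<in> triv E \<Longrightarrow> open U"
    and "(U, \<psi>) \<in> triv E \<Longrightarrow> p \<in> U \<Longrightarrow> linear_over (fib E p) (\<psi> p)"
    and "(U, \<psi>) \<in> triv E \<Longrightarrow> p \<in> U \<Longrightarrow> a \<in> fib E p \<Longrightarrow> (\<And>i. i \<in> idx E \<Longrightarrow> \<psi> p a i = 0) \<Longrightarrow> a = 0"
  using assms unfolding coordinatized_def by blast+

lemma vector_bundle_coordinatized:
  assumes E: "vector_bundle M E" shows "coordinatized E"
  unfolding coordinatized_def
proof (intro conjI allI impI ballI)
  show "\<exists>U \<psi>. (U, \<psi>) \<in> triv E \<and> p \<in> U" for p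
    using vector_bundle_cover[OF E] by blast
  fix U \<psi> p a assume *: "(U, \<psi>) \<in> triv E" "p \<in> U" "a \<in> fib E p" "\<forall>i\<in>idx E. \<psi> p a i = 0"
  show "a = 0" using frame_expansion[OF E *(1-3)] *(4) by simp
qed (use vector_bundle_finite_idx[OF E] vector_bundle_subspace[OF E] vector_bundleD[OF E] in auto)

lemma smooth_sectionD:
  assumes "smooth_section M E W s"
  shows "p \<in> W \<Longrightarrow> s p \<in> fib E p"
    and "(U, \<psi>) \<in> triv E \<Longrightarrow> i \<in> idx E \<Longrightarrow> smooth_on M (U \<inter> W) (\<lambda>p. \<psi> p (s p) i)"
  using assms unfolding smooth_section_def by blast+

lemma smooth_sectionI:
  assumes "\<And>p. p \<in> W \<Longrightarrow> s p \<in> fib E p"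
    and "\<And>U \<psi> i. (U, \<psi>) \<in> triv E \<Longrightarrow> i \<in> idx E \<Longrightarrow> smooth_on M (U \<inter> W) (\<lambda>p. \<psi> p (s p) i)"
  shows "smooth_section M E W s"
  using assms unfolding smooth_section_def by blast

lemma vb_mapD:
  assumes "vb_map M E F \<Phi>"
  shows "a \<in> fib E p \<Longrightarrow> \<Phi> p a \<in> fib F p" "linear_over (fib E p) (\<Phi> p)"
    and "(U, \<psi>) \<in> triv E \<Longrightarrow> (V, \<theta>) \<in> triv F \<Longrightarrow> j \<in> idx E \<Longrightarrow> i \<in> idx F \<Longrightarrow>
      smooth_on M (U \<inter> V) (\<lambda>p. \<theta> p (\<Phi> p (frame_vec E \<psi> p j)) i)"
proof -
  show "a \<in> fib E p \<Longrightarrow> \<Phi> p a \<in> fib F p" "linear_over (fib E p) (\<Phi> p)"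
    using assms unfolding vb_map_def by auto
  have *: "\<forall>(U, \<psi>)\<in>triv E. \<forall>(V, \<theta>)\<in>triv F. \<forall>j\<in>idx E. \<forall>i\<in>idx F.
       smooth_on M (U \<inter> V) (\<lambda>p. \<theta> p (\<Phi> p (frame_vec E \<psi> p j)) i)"
    using assms unfolding vb_map_def by (elim conjE)
  show "smooth_on M (U \<inter> V) (\<lambda>p. \<theta> p (\<Phi> p (frame_vec E \<psi> p j)) i)"
    if "(U, \<psi>) \<in> triv E" "(V, \<theta>) \<in> triv F" "j \<in> idx E" "i \<in> idx F"
  proof -
    from bspec[OF * that(1)]
    have "\<forall>(V, \<theta>)\<in>triv F. \<forall>j\<in>idx E. \<forall>i\<in>idx F.
       smooth_on M (U \<inter> V) (\<lambda>p. \<theta> p (\<Phi> p (frame_vec E \<psi> p j)) i)" by simp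
    from bspec[OF this that(2)] show ?thesis using that(3,4) by simp
  qed
qed

lemma vb_mapI:
  assumes "\<And>p a. a \<in> fib E p \<Longrightarrow> \<Phi> p a \<in> fib F p" "\<And>p. linear_over (fib E p) (\<Phi> p)"
    and "\<And>U \<psi> V \<theta> j i. (U, \<psi>) \<in> triv E \<Longrightarrow> (V, \<theta>) \<in> triv F \<Longrightarrow> j \<in> idx E \<Longrightarrow> i \<in> idx F \<Longrightarrow>
      smooth_on M (U \<inter> V) (\<lambda>p. \<theta> p (\<Phi> p (frame_vec E \<psi> p j)) i)"
  shows "vb_map M E F \<Phi>"
  unfolding vb_map_def
proof (intro conjI allI)
  show "\<Phi> p ` fib E p \<subseteq> fib F p" "linear_over (fib E p) (\<Phi> p)" for p
    using assms(1,2) by auto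
  show "\<forall>(U, \<psi>)\<in>triv E. \<forall>(V, \<theta>)\<in>triv F. \<forall>j\<in>idx E. \<forall>i\<in>idx F.
       smooth_on M (U \<inter> V) (\<lambda>p. \<theta> p (\<Phi> p (frame_vec E \<psi> p j)) i)"
    using assms(3) by auto
qed

section \<open>Local frames and subbundles\<close>

lemma local_frameI:
  fixes e :: "nat \<Rightarrow> 'm::topological_space \<Rightarrow> 'a::real_vector"
  assumes "open U" "\<And>i. i < r \<Longrightarrow> smooth_section M E U (e i)"
    and ind: "\<And>p d. p \<in> U \<Longrightarrow> (\<Sum>i<r. d i *\<^sub>R e i p) = 0 \<Longrightarrow> \<forall>i<r. d i = 0"
    and span: "\<And>p. p \<in> U \<Longrightarrow> L p = range (\<lambda>d. \<Sum>i<r. d i *\<^sub>R e i p)"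
  shows "local_frame M E r L U e"
  unfolding local_frame_def
proof (intro conjI ballI)
  fix p assume p: "p \<in> U"
  then have "inj_on (\<lambda>i. e i p) {..<r} \<and> independent ((\<lambda>i. e i p) ` {..<r})"
    by (subst independent_family_iff) (use ind in auto)
  then show "inj_on (\<lambda>i. e i p) {..<r}" "independent ((\<lambda>i. e i p) ` {..<r})"
    "span ((\<lambda>i. e i p) ` {..<r}) = L p"
    using span[OF p] by (auto simp: span_family)
qed (use assms in auto)

lemma local_frameD:
  assumes "local_frame M E r L U e"
  shows "open U" "i < r \<Longrightarrow> smooth_section M E U (e i)"
    and local_frame_independent: "p \<in> U \<Longrightarrow> (\<Sum>i<r. d i *\<^sub>R e i p) = 0 \<Longrightarrow> i < r \<Longrightarrow> d i = 0"
    and local_frame_span: "p \<in> U \<Longrightarrow> L p = range (\<lambda>d. \<Sum>i<r. d i *\<^sub>R e i p)"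
proof -
  show "open U" "i < r \<Longrightarrow> smooth_section M E U (e i)"
    using assms unfolding local_frame_def by auto
  assume p: "p \<in> U"
  then have *: "inj_on (\<lambda>i. e i p) {..<r}" "independent ((\<lambda>i. e i p) ` {..<r})"
    "span ((\<lambda>i. e i p) ` {..<r}) = L p"
    using assms unfolding local_frame_def by auto
  then show "(\<Sum>i<r. d i *\<^sub>R e i p) = 0 \<Longrightarrow> i < r \<Longrightarrow> d i = 0"
    using independent_family_iff[of "{..<r}" "\<lambda>i. e i p"] by blast
  show "L p = range (\<lambda>d. \<Sum>i<r. d i *\<^sub>R e i p)"
    using * by (simp add: span_family)
qed

lemma local_frame_in:
  assumes "local_frame M E r L U e" "p \<in> U" "j < r" shows "e j p \<in> L p"
proof -
  have "span ((\<lambda>i. e i p) ` {..<r}) = L p" using assms unfolding local_frame_def by auto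
  then show ?thesis using span_base[of "e j p" "(\<lambda>i. e i p) ` {..<r}"] assms(3) by auto
qed

lemma local_frame_unique:
  assumes "local_frame M E r L U e" "p \<in> U" "d \<in> coord_space {..<r}" "d' \<in> coord_space {..<r}"
    and "(\<Sum>i<r. d i *\<^sub>R e i p) = (\<Sum>i<r. d' i *\<^sub>R e i p)"
  shows "d = d'"
proof
  fix i
  have "(\<Sum>i<r. (d i - d' i) *\<^sub>R e i p) = 0"
    using assms(5) by (simp add: scaleR_left_diff_distrib sum_subtractf)
  then show "d i = d' i"
    using local_frame_independent[OF assms(1,2), of "\<lambda>i. d i - d' i" i] assms(3,4)
    by (cases "i < r") (auto simp: coord_space_def)
qed

lemma subbundle_simps [simp]:
  "fib (subbundle M E r L) = L" "idx (subbundle M E r L) = {..<r}"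
  by (simp_all add: subbundle_def)

text \<open>A trivialization of the subbundle is only required to return coordinates in some local
  frame. Independence makes these coordinates unique; linearity, bijectivity and the identification
  of its frame with \<open>e\<close> follow from that.\<close>

lemma subbundle_triv:
  assumes "(U, \<psi>) \<in> triv (subbundle M E r L)"
  obtains e where "local_frame M E r L U e"
    "\<And>p. p \<in> U \<Longrightarrow> linear_over (L p) (\<psi> p)"
    "\<And>p. p \<in> U \<Longrightarrow> bij_betw (\<psi> p) (L p) (coord_space {..<r})"
    "\<And>p a. p \<in> U \<Longrightarrow> a \<in> L p \<Longrightarrow> a = (\<Sum>i<r. \<psi> p a i *\<^sub>R e i p)"
    "\<And>p j. p \<in> U \<Longrightarrow> j < r \<Longrightarrow> frame_vec (subbundle M E r L) \<psi> p j = e j p"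
proof -
  obtain e where e: "local_frame M E r L U e"
    and c: "\<And>p a. p \<in> U \<Longrightarrow> a \<in> L p \<Longrightarrow> \<psi> p a \<in> coord_space {..<r}"
    and x: "\<And>p a. p \<in> U \<Longrightarrow> a \<in> L p \<Longrightarrow> a = (\<Sum>i<r. \<psi> p a i *\<^sub>R e i p)"
    using assms unfolding subbundle_def by auto
  have in_L: "(\<Sum>i<r. d i *\<^sub>R e i p) \<in> L p" if "p \<in> U" for p d
    using local_frame_span[OF e that] by blast
  have coords: "\<psi> p (\<Sum>i<r. d i *\<^sub>R e i p) = d" if "p \<in> U" "d \<in> coord_space {..<r}" for p d
    using x[OF that(1) in_L[OF that(1), of d]]
    by (intro local_frame_unique[OF e that(1) c[OF that(1) in_L[OF that(1)]] that(2)]) simp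
  have bij: "bij_betw (\<psi> p) (L p) (coord_space {..<r})" if "p \<in> U" for p
    by (rule bij_betw_byWitness[where f' = "\<lambda>d. \<Sum>i<r. d i *\<^sub>R e i p"])
      (use x c coords in_L that in auto)
  have lin: "linear_over (L p) (\<psi> p)" if p: "p \<in> U" for p
    unfolding linear_over_def
  proof (intro conjI ballI allI)
    fix a b assume ab: "a \<in> L p" "b \<in> L p"
    have "a + b = (\<Sum>i<r. (\<psi> p a + \<psi> p b) i *\<^sub>R e i p)"
      using x[OF p ab(1)] x[OF p ab(2)] by (simp add: scaleR_left_distrib sum.distrib)
    moreover have "\<psi> p a + \<psi> p b \<in> coord_space {..<r}"
      using c[OF p] ab by (auto simp: coord_space_def)
    ultimately show "\<psi> p (a + b) = \<psi> p a + \<psi> p b" using coords[OF p] by metis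
  next
    fix s a assume a: "a \<in> L p"
    have "s *\<^sub>R a = (\<Sum>i<r. (s *\<^sub>R \<psi> p a) i *\<^sub>R e i p)"
      using arg_cong[OF x[OF p a], of "\<lambda>a. s *\<^sub>R a"] by (simp add: scaleR_sum_right scaleR_fun_def)
    moreover have "s *\<^sub>R \<psi> p a \<in> coord_space {..<r}"
      using c[OF p a] by (auto simp: coord_space_def scaleR_fun_def)
    ultimately show "\<psi> p (s *\<^sub>R a) = s *\<^sub>R \<psi> p a" using coords[OF p] by metis
  qed
  have frame: "frame_vec (subbundle M E r L) \<psi> p j = e j p" if p: "p \<in> U" and j: "j < r" for p j
  proof -
    let ?d = "\<lambda>i. if i = j then 1 else (0 :: real)"
    have d: "?d \<in> coord_space {..<r}" using j by (auto simp: coord_space_def)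
    have ej: "(\<Sum>i<r. ?d i *\<^sub>R e i p) = e j p"
      using j by (simp add: if_distrib[of "\<lambda>s. s *\<^sub>R _"] cong: if_cong)
    have "\<psi> p (e j p) = ?d" "e j p \<in> L p"
      using coords[OF p d] in_L[OF p, of ?d] unfolding ej by auto
    then show ?thesis
      using bij[OF p] inv_into_f_f[of "\<psi> p" "L p" "e j p"]
      unfolding frame_vec_def by (simp add: bij_betw_def)
  qed
  show ?thesis using that[OF e lin bij x frame] by blast
qed

lemma subbundle_cover:
  assumes "is_subbundle M E r L"
  obtains U \<psi> where "(U, \<psi>) \<in> triv (subbundle M E r L)" "p \<in> U"
proof -
  obtain U e where U: "p \<in> U" and e: "local_frame M E r L U e"
    using assms unfolding is_subbundle_def by blast
  \<comment> \<open>Coordinates are prescribed only over \<open>U\<close> and on the fibres of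
    \<open>L\<close>. The implications leave all other values free, so that a single choice serves
    for all \<open>q\<close> and \<open>a\<close>.\<close>
  have "\<exists>d. q \<in> U \<longrightarrow> a \<in> L q \<longrightarrow> d \<in> coord_space {..<r} \<and> a = (\<Sum>i<r. d i *\<^sub>R e i q)" for q a
  proof (cases "q \<in> U \<and> a \<in> L q")
    case True
    then obtain d where "a = (\<Sum>i<r. d i *\<^sub>R e i q)" using local_frame_span[OF e] by blast
    then show ?thesis
      by (intro exI[of _ "\<lambda>i. if i < r then d i else 0"]) (auto simp: coord_space_def)
  qed auto
  then obtain \<psi> where "\<And>q a. q \<in> U \<Longrightarrow> a \<in> L q \<Longrightarrow> \<psi> q a \<in> coord_space {..<r} \<and> a = (\<Sum>i<r. \<psi> q a i *\<^sub>R e i q)"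
    by metis
  then have "(U, \<psi>) \<in> triv (subbundle M E r L)"
    using e unfolding subbundle_def by auto
  then show ?thesis using that U by blast
qed

section \<open>Smooth sections and their coefficients\<close>

context smooth_mfd
begin

lemma smooth_section_subset: "smooth_section M E W s \<Longrightarrow> W' \<subseteq> W \<Longrightarrow> smooth_section M E W' s"
  unfolding smooth_section_def by (blast intro: smooth_on_subset)

lemma smooth_section_add:
  assumes E: "coordinatized E" and W: "open W" and "smooth_section M E W s" "smooth_section M E W t"
  shows "smooth_section M E W (\<lambda>p. s p + t p)"
proof (rule smooth_sectionI)
  note st = smooth_sectionD[OF assms(3)] smooth_sectionD[OF assms(4)]
  show "s p + t p \<in> fib E p" if "p \<in> W" for p
    using st that coordinatizedD(2)[OF E] by (auto intro: subspace_add)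
  fix U \<psi> i assume U: "(U, \<psi>) \<in> triv E" and "i \<in> idx E"
  show "smooth_on M (U \<inter> W) (\<lambda>p. \<psi> p (s p + t p) i)"
  proof (rule smooth_on_cong[of _ "\<lambda>p. \<psi> p (s p) i + \<psi> p (t p) i"])
    show "open (U \<inter> W)" using W coordinatizedD(4)[OF E U] by auto
    then show "smooth_on M (U \<inter> W) (\<lambda>p. \<psi> p (s p) i + \<psi> p (t p) i)"
      using st(2,4)[OF U \<open>i \<in> idx E\<close>] by (rule smooth_on_add)
    show "\<psi> p (s p) i + \<psi> p (t p) i = \<psi> p (s p + t p) i" if "p \<in> U \<inter> W" for p
      using coordinatizedD(5)[OF E U] st(1,3) that unfolding linear_over_def by simp
  qed
qed

lemma smooth_section_scale:
  assumes E: "coordinatized E" and W: "open W" and f: "smooth_on M W f" and "smooth_section M E W s"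
  shows "smooth_section M E W (\<lambda>p. f p *\<^sub>R s p)"
proof (rule smooth_sectionI)
  note s = smooth_sectionD[OF assms(4)]
  show "f p *\<^sub>R s p \<in> fib E p" if "p \<in> W" for p
    using s that coordinatizedD(2)[OF E] by (auto intro: subspace_scale)
  fix U \<psi> i assume U: "(U, \<psi>) \<in> triv E" and "i \<in> idx E"
  show "smooth_on M (U \<inter> W) (\<lambda>p. \<psi> p (f p *\<^sub>R s p) i)"
  proof (rule smooth_on_cong[of _ "\<lambda>p. f p * \<psi> p (s p) i"])
    show "open (U \<inter> W)" using W coordinatizedD(4)[OF E U] by auto
    then show "smooth_on M (U \<inter> W) (\<lambda>p. f p * \<psi> p (s p) i)"
      using smooth_on_subset[OF f] s(2)[OF U \<open>i \<in> idx E\<close>] by (intro smooth_on_mult) auto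
    show "f p * \<psi> p (s p) i = \<psi> p (f p *\<^sub>R s p) i" if "p \<in> U \<inter> W" for p
      using coordinatizedD(5)[OF E U] s(1) that unfolding linear_over_def by (simp add: scaleR_fun_def)
  qed
qed

lemma smooth_section_zero:
  assumes E: "coordinatized E" and W: "open W"
  shows "smooth_section M E W (\<lambda>_. 0)"
proof (rule smooth_sectionI)
  show "0 \<in> fib E p" for p using coordinatizedD(2)[OF E] by (rule subspace_0)
  fix U \<psi> i assume U: "(U, \<psi>) \<in> triv E"
  show "smooth_on M (U \<inter> W) (\<lambda>p. \<psi> p 0 i)"
    by (rule smooth_on_cong[OF _ smooth_on_const[of _ 0]])
      (use W coordinatizedD(4)[OF E U] linear_over_0[OF coordinatizedD(5)[OF E U] coordinatizedD(2)[OF E]] in auto)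
qed

lemma smooth_section_sum:
  assumes E: "coordinatized E" and W: "open W" and "\<And>i. i \<in> I \<Longrightarrow> smooth_section M E W (s i)"
  shows "smooth_section M E W (\<lambda>p. \<Sum>i\<in>I. s i p)"
  using assms(3)
  by (induction I rule: infinite_finite_induct)
    (auto intro: smooth_section_zero[OF E W] smooth_section_add[OF E W])

lemma smooth_section_frame_vec:
  assumes "vector_bundle M E" "(U, \<psi>) \<in> triv E" "j \<in> idx E"
  shows "smooth_section M E U (\<lambda>p. frame_vec E \<psi> p j)"
  by (rule smooth_sectionI)
    (use frame_vec_in_fib[OF assms(1,2)] vector_bundle_transition[OF assms(1,2)] assms(3)
      in \<open>auto simp: Int_commute\<close>)

lemma smooth_section_local:
  assumes "\<And>p. p \<in> W \<Longrightarrow> \<exists>W'. open W' \<and> p \<in> W' \<and> smooth_section M E W' s"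
    and "\<And>U \<psi>. (U, \<psi>) \<in> triv E \<Longrightarrow> open U"
  shows "smooth_section M E W s"
proof (rule smooth_sectionI)
  show "s p \<in> fib E p" if "p \<in> W" for p
    using assms(1)[OF that] smooth_sectionD(1) by metis
  fix U \<psi> i assume U: "(U, \<psi>) \<in> triv E" "i \<in> idx E"
  show "smooth_on M (U \<inter> W) (\<lambda>p. \<psi> p (s p) i)"
  proof (rule smooth_on_local)
    fix p assume p: "p \<in> U \<inter> W"
    then obtain W' where "open W'" "p \<in> W'" "smooth_section M E W' s" using assms(1) by blast
    then show "\<exists>W'. open W' \<and> p \<in> W' \<and> smooth_on M W' (\<lambda>p. \<psi> p (s p) i)"
      using p U assms(2) smooth_sectionD(2)[of M E W' s U \<psi> i] by (intro exI[of _ "U \<inter> W'"]) auto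
  qed
qed

lemma smooth_section_cong:
  assumes "smooth_section M E W s" "\<And>p. p \<in> W \<Longrightarrow> s p = t p" "open W"
    and "\<And>U \<psi>. (U, \<psi>) \<in> triv E \<Longrightarrow> open U"
  shows "smooth_section M E W t"
proof (rule smooth_sectionI)
  fix U \<psi> i assume U: "(U, \<psi>) \<in> triv E" "i \<in> idx E"
  show "smooth_on M (U \<inter> W) (\<lambda>p. \<psi> p (t p) i)"
    by (rule smooth_on_cong[OF _ smooth_sectionD(2)[OF assms(1) U]]) (use assms U in auto)
qed (use assms smooth_sectionD(1)[OF assms(1)] in metis)

lemma section_through:
  assumes E: "vector_bundle M E" and a: "a \<in> fib E p"
  obtains s where "s \<in> sections M E" "s p = a"
proof -
  have E': "coordinatized E" using vector_bundle_coordinatized[OF E] .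
  obtain U \<psi> where U: "(U, \<psi>) \<in> triv E" "p \<in> U" using vector_bundle_cover[OF E] .
  have "open U" using vector_bundleD(1)[OF E U(1)] .
  then obtain f K where f: "smooth_on M UNIV f" "closed K" "K \<subseteq> U" "f p = 1" "\<And>q. q \<notin> K \<Longrightarrow> f q = 0"
    using smooth_bump[OF _ U(2)] by metis
  \<comment> \<open>The coefficients are frozen at \<open>p\<close>. Outside \<open>U\<close> the
    frame vectors are arbitrary, which the factor \<open>f\<close> hides, being 0 off
    \<open>K\<close>.\<close>
  define s where "s q = f q *\<^sub>R (\<Sum>j\<in>idx E. \<psi> p a j *\<^sub>R frame_vec E \<psi> q j)" for q
  have "smooth_section M E U s"
    unfolding s_def using f(1)
    by (intro smooth_section_scale[OF E' \<open>open U\<close>] smooth_section_sum[OF E' \<open>open U\<close>]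
        smooth_on_const smooth_section_frame_vec[OF E U(1)] \<open>open U\<close>) (auto intro: smooth_on_subset)
  moreover have "smooth_section M E (- K) s"
    by (rule smooth_section_cong[OF smooth_section_zero[OF E']])
      (use f in \<open>auto simp: s_def dest: vector_bundleD(1)[OF E]\<close>)
  ultimately have "smooth_section M E UNIV s"
    using \<open>open U\<close> f(2,3) vector_bundleD(1)[OF E]
    by (intro smooth_section_local) (metis ComplI open_Compl subsetD, metis)
  moreover have "s p = a" using frame_expansion[OF E U a] f(4) by (simp add: s_def)
  ultimately show ?thesis using that by (auto simp: sections_def)
qed

text \<open>\<open>vb_map\<close> states smoothness on frame vectors only. Expanding the section in
  a local frame turns its image into a sum of products of smooth functions.\<close>

lemma vb_map_section:
  assumes E: "vector_bundle M E" and F: "coordinatized F" and \<Phi>: "vb_map M E F \<Phi>"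
    and W: "open W" and s: "smooth_section M E W s"
  shows "smooth_section M F W (\<lambda>p. \<Phi> p (s p))"
proof (rule smooth_sectionI)
  show "\<Phi> p (s p) \<in> fib F p" if "p \<in> W" for p
    using vb_mapD(1)[OF \<Phi>] smooth_sectionD(1)[OF s that] .
  fix V \<theta> i assume V: "(V, \<theta>) \<in> triv F" and i: "i \<in> idx F"
  have "open V" using coordinatizedD(4)[OF F V] .
  show "smooth_on M (V \<inter> W) (\<lambda>p. \<theta> p (\<Phi> p (s p)) i)"
  proof (rule smooth_on_local)
    fix p assume p: "p \<in> V \<inter> W"
    obtain U \<psi> where U: "(U, \<psi>) \<in> triv E" "p \<in> U" using vector_bundle_cover[OF E] .
    let ?W = "U \<inter> (V \<inter> W)"
    have W': "open ?W" using vector_bundleD(1)[OF E U(1)] \<open>open V\<close> W by auto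
    have "smooth_on M ?W (\<lambda>q. \<psi> q (s q) j)" if "j \<in> idx E" for j
      by (rule smooth_on_subset[OF smooth_sectionD(2)[OF s U(1) that]]) auto
    moreover have "smooth_on M ?W (\<lambda>q. \<theta> q (\<Phi> q (frame_vec E \<psi> q j)) i)" if "j \<in> idx E" for j
      by (rule smooth_on_subset[OF vb_mapD(3)[OF \<Phi> U(1) V that i]]) auto
    ultimately have "smooth_on M ?W (\<lambda>q. \<Sum>j\<in>idx E. \<psi> q (s q) j * \<theta> q (\<Phi> q (frame_vec E \<psi> q j)) i)"
      by (intro smooth_on_sum smooth_on_mult W')
    then have "smooth_on M ?W (\<lambda>p. \<theta> p (\<Phi> p (s p)) i)"
    proof (rule smooth_on_cong[OF W'])
      fix q assume q: "q \<in> ?W"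
      have fr: "frame_vec E \<psi> q j \<in> fib E q" if "j \<in> idx E" for j
        using frame_vec_in_fib[OF E U(1)] q that by auto
      have "\<Phi> q (s q) = \<Phi> q (\<Sum>j\<in>idx E. \<psi> q (s q) j *\<^sub>R frame_vec E \<psi> q j)"
        using frame_expansion[OF E U(1) _ smooth_sectionD(1)[OF s]] q by simp
      also have "\<dots> = (\<Sum>j\<in>idx E. \<psi> q (s q) j *\<^sub>R \<Phi> q (frame_vec E \<psi> q j))"
        using vb_mapD(2)[OF \<Phi>] vector_bundle_subspace[OF E] fr by (rule linear_over_sum)
      also have "\<theta> q \<dots> = (\<Sum>j\<in>idx E. \<psi> q (s q) j *\<^sub>R \<theta> q (\<Phi> q (frame_vec E \<psi> q j)))"
        by (rule linear_over_sum[OF coordinatizedD(5)[OF F V] coordinatizedD(2)[OF F]])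
          (use q vb_mapD(1)[OF \<Phi> fr] in auto)
      finally show "(\<Sum>j\<in>idx E. \<psi> q (s q) j * \<theta> q (\<Phi> q (frame_vec E \<psi> q j)) i) = \<theta> q (\<Phi> q (s q)) i"
        by (simp add: sum_fun_apply scaleR_fun_def)
    qed
    then show "\<exists>W'. open W' \<and> p \<in> W' \<and> smooth_on M W' (\<lambda>p. \<theta> p (\<Phi> p (s p)) i)"
      using W' U(2) p by blast
  qed
qed

text \<open>Project away one of the independent vectors \<open>x\<^sub>j\<close> at a time.\<close>

lemma smooth_coefficients_Rn:
  assumes W: "open W" and "finite J" "finite I"
    and "\<And>j a. j \<in> J \<Longrightarrow> a \<in> I \<Longrightarrow> smooth_on M W (\<lambda>p. x j p a)"
    and "\<And>a. a \<in> I \<Longrightarrow> smooth_on M W (\<lambda>p. s p a)"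
    and "\<And>p a. p \<in> W \<Longrightarrow> a \<in> I \<Longrightarrow> s p a = (\<Sum>j\<in>J. c j p * x j p a)"
    and "\<And>p d. p \<in> W \<Longrightarrow> (\<And>a. a \<in> I \<Longrightarrow> (\<Sum>j\<in>J. d j * x j p a) = 0) \<Longrightarrow> \<forall>j\<in>J. d j = (0::real)"
    and "j \<in> J"
  shows "smooth_on M W (c j)"
  using assms(2,4-)
proof (induction J arbitrary: x s j)
  case (insert l J)
  note x = insert.prems(1) and s = insert.prems(2) and eq = insert.prems(3) and ind = insert.prems(4)
  \<comment> \<open>\<open>N\<close> is the squared length of \<open>x l\<close>, and
    \<open>pr y\<close> is the coefficient of the orthogonal projection of \<open>y\<close> onto
    \<open>x l\<close>.\<close>
  define N where "N p = (\<Sum>a\<in>I. x l p a * x l p a)" for p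
  define pr where "pr y p = (\<Sum>a\<in>I. y p a * x l p a) * inverse (N p)" for y p
  have N: "N p \<noteq> 0" if p: "p \<in> W" for p
  proof
    assume "N p = 0"
    then have "x l p a = 0" if "a \<in> I" for a
      using that \<open>finite I\<close> by (simp add: N_def sum_nonneg_eq_0_iff)
    \<comment> \<open>A vanishing \<open>x l\<close> would satisfy the relation with coefficient 1
      at \<open>l\<close> and 0 elsewhere.\<close>
    then have "\<forall>j\<in>insert l J. (if j = l then 1 else 0) = (0::real)"
      using insert.hyps by (intro ind[OF p]) (auto intro!: sum.neutral)
    then show False by simp
  qed
  have pr_smooth: "smooth_on M W (pr y)" if "\<And>a. a \<in> I \<Longrightarrow> smooth_on M W (\<lambda>p. y p a)" for y
  proof -
    have "smooth_on M W N"
      unfolding N_def by (intro smooth_on_mult smooth_on_sum W x) auto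
    then show ?thesis
      unfolding pr_def by (intro smooth_on_mult smooth_on_sum smooth_on_inverse W that N x) auto
  qed
  have pr_l: "pr (x l) p = 1" if "p \<in> W" for p
    using N[OF that] by (simp add: pr_def N_def)
  have pr_s: "pr s p = c l p + (\<Sum>j\<in>J. c j p * pr (x j) p)" if p: "p \<in> W" for p
  proof -
    have "pr s p = (\<Sum>a\<in>I. (\<Sum>j\<in>insert l J. c j p * x j p a) * x l p a) * inverse (N p)"
      unfolding pr_def using eq[OF p] by simp
    also have "\<dots> = (\<Sum>j\<in>insert l J. c j p * pr (x j) p)"
      unfolding pr_def sum_distrib_right sum_distrib_left
      by (subst sum.swap) (simp add: mult.assoc)
    finally show ?thesis using insert.hyps pr_l[OF p] by simp
  qed
  define x' where "x' j p a = x j p a - pr (x j) p * x l p a" for j p a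
  define s' where "s' p a = s p a - pr s p * x l p a" for p a
  have IH: "smooth_on M W (c j)" if "j \<in> J" for j
  proof (rule insert.IH[of x' s'])
    show "smooth_on M W (\<lambda>p. x' j p a)" if "j \<in> J" "a \<in> I" for j a
      unfolding x'_def using that by (intro smooth_on_diff smooth_on_mult W x pr_smooth) auto
    show "smooth_on M W (\<lambda>p. s' p a)" if "a \<in> I" for a
      unfolding s'_def using that by (intro smooth_on_diff smooth_on_mult W x s pr_smooth) auto
    show "s' p a = (\<Sum>j\<in>J. c j p * x' j p a)" if "p \<in> W" "a \<in> I" for p a
      using eq[OF that] insert.hyps
      by (simp add: s'_def x'_def pr_s[OF that(1)] algebra_simps sum_subtractf sum_distrib_left)
    show "\<forall>j\<in>J. d j = 0" if p: "p \<in> W" and d: "\<And>a. a \<in> I \<Longrightarrow> (\<Sum>j\<in>J. d j * x' j p a) = 0" for p d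
    proof -
      \<comment> \<open>A relation among the projected vectors becomes one among the original
        vectors once \<open>x l\<close> receives the coefficient that collects the subtracted
        projections.\<close>
      let ?d = "d(l := - (\<Sum>j\<in>J. d j * pr (x j) p))"
      have "(\<Sum>j\<in>insert l J. ?d j * x j p a) = 0" if "a \<in> I" for a
      proof -
        have "(\<Sum>j\<in>J. ?d j * x j p a) = (\<Sum>j\<in>J. d j * x j p a)"
          using insert.hyps by (intro sum.cong) auto
        then show ?thesis
          using d[OF that] insert.hyps
          by (simp add: x'_def algebra_simps sum_subtractf sum_distrib_left)
      qed
      then have *: "\<forall>j\<in>insert l J. ?d j = 0" by (rule ind[OF p])
      show ?thesis
      proof
        fix j assume j: "j \<in> J"
        then have "j \<noteq> l" using insert.hyps by auto
        then show "d j = 0" using bspec[OF *, of j] j by (simp only: insert_iff fun_upd_other simp_thms)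
      qed
    qed
  qed fact
  \<comment> \<open>The coefficient of \<open>x l\<close> comes last, from the linearity of
    \<open>pr\<close> and \<open>pr (x l) = 1\<close>.\<close>
  have "smooth_on M W (\<lambda>p. pr s p - (\<Sum>j\<in>J. c j p * pr (x j) p))"
    by (intro smooth_on_diff smooth_on_sum smooth_on_mult W IH pr_smooth s x) auto
  then have "smooth_on M W (c l)"
    by (rule smooth_on_cong[OF W]) (simp add: pr_s)
  then show ?case using IH insert.prems(5) by auto
qed simp

text \<open>Coordinates on the fibres separate vectors, so independent vectors have independent
  coordinate columns, and the statement about columns of functions applies locally.\<close>

lemma smooth_coefficients:
  assumes E: "coordinatized E" and W: "open W" and J: "finite J"
    and e: "\<And>j. j \<in> J \<Longrightarrow> smooth_section M E W (e j)" and s: "smooth_section M E W s"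
    and eq: "\<And>p. p \<in> W \<Longrightarrow> s p = (\<Sum>j\<in>J. c j p *\<^sub>R e j p)"
    and ind: "\<And>p d j. p \<in> W \<Longrightarrow> (\<Sum>j\<in>J. d j *\<^sub>R e j p) = 0 \<Longrightarrow> j \<in> J \<Longrightarrow> d j = 0"
    and j: "j \<in> J"
  shows "smooth_on M W (c j)"
proof (rule smooth_on_local)
  fix p assume p: "p \<in> W"
  obtain V \<xi> where V: "(V, \<xi>) \<in> triv E" "p \<in> V" using coordinatizedD(3)[OF E] by blast
  let ?W = "V \<inter> W"
  have W': "open ?W" using coordinatizedD(4)[OF E V(1)] W by auto
  have sum: "\<xi> q (\<Sum>j\<in>J. d j *\<^sub>R e j q) a = (\<Sum>j\<in>J. d j * \<xi> q (e j q) a)" if "q \<in> ?W" for q d a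
    using linear_over_sum[OF coordinatizedD(5)[OF E V(1)] coordinatizedD(2)[OF E], of q J "\<lambda>j. e j q" d]
      that smooth_sectionD(1)[OF e] by (simp add: sum_fun_apply scaleR_fun_def)
  have "smooth_on M ?W (c j)"
  proof (rule smooth_coefficients_Rn[OF W' J coordinatizedD(1)[OF E], where
        x = "\<lambda>j p. \<xi> p (e j p)" and s = "\<lambda>p. \<xi> p (s p)"])
    show "\<xi> q (s q) a = (\<Sum>j\<in>J. c j q * \<xi> q (e j q) a)" if "q \<in> ?W" for q a
      using sum[OF that, of "\<lambda>j. c j q" a] eq that by simp
    fix q d assume q: "q \<in> ?W" and d: "\<And>a. a \<in> idx E \<Longrightarrow> (\<Sum>j\<in>J. d j * \<xi> q (e j q) a) = 0"
    have "(\<Sum>j\<in>J. d j *\<^sub>R e j q) \<in> fib E q"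
      using q smooth_sectionD(1)[OF e] coordinatizedD(2)[OF E] by (intro subspace_sum subspace_scale) auto
    then have "(\<Sum>j\<in>J. d j *\<^sub>R e j q) = 0"
      using coordinatizedD(6)[OF E V(1), of q] sum[OF q] d q by auto
    then show "\<forall>j\<in>J. d j = 0" using ind q by blast
  qed (use smooth_sectionD(2)[OF e V(1)] smooth_sectionD(2)[OF s V(1)] j in auto)
  then show "\<exists>W'. open W' \<and> p \<in> W' \<and> smooth_on M W' (c j)"
    using W' V p by blast
qed

lemma smooth_local_frame_coefficients:
  assumes "coordinatized E" "local_frame M E r L V e" "open U" "smooth_section M E U s"
    and "\<And>p. p \<in> U \<inter> V \<Longrightarrow> s p = (\<Sum>i<r. c i p *\<^sub>R e i p)" "i < r"
  shows "smooth_on M (U \<inter> V) (c i)"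
  by (rule smooth_coefficients[OF assms(1), where J = "{..<r}" and e = e and s = s])
    (use assms local_frameD[OF assms(2)] in \<open>auto intro: smooth_section_subset\<close>)

text \<open>A transition function consists of the coefficients of one local frame in another. Both
  are made of smooth sections of \<open>E\<close>, so these coefficients are smooth.\<close>

lemma vector_bundle_subbundle:
  assumes E: "coordinatized E" and L: "is_subbundle M E r L"
  shows "vector_bundle M (subbundle M E r L)" (is "vector_bundle M ?B")
  unfolding vector_bundle_def
proof (intro conjI allI ballI)
  show "finite (idx ?B)" by simp
  show "subspace (fib ?B p)" for p using L by (simp add: is_subbundle_def)
  show "(\<Union>(U, \<psi>)\<in>triv ?B. U) = UNIV"
    using subbundle_cover[OF L] by auto
next
  fix b assume b: "b \<in> triv ?B"
  obtain U \<psi> where U: "b = (U, \<psi>)" "(U, \<psi>) \<in> triv ?B" using b by (cases b) auto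
  obtain e where e: "local_frame M E r L U e"
    "\<And>p. p \<in> U \<Longrightarrow> linear_over (L p) (\<psi> p)"
    "\<And>p. p \<in> U \<Longrightarrow> bij_betw (\<psi> p) (L p) (coord_space {..<r})"
    "\<And>p j. p \<in> U \<Longrightarrow> j < r \<Longrightarrow> frame_vec ?B \<psi> p j = e j p"
    by (rule subbundle_triv[OF U(2)]) (rule that)
  show "case b of (U, \<psi>) \<Rightarrow> open U \<and>
       (\<forall>p\<in>U. linear_over (fib ?B p) (\<psi> p) \<and> bij_betw (\<psi> p) (fib ?B p) (coord_space (idx ?B)))"
    using e local_frameD(1)[OF e(1)] by (simp add: U(1))
  show "case b of (U, \<psi>) \<Rightarrow> \<forall>(V, \<theta>)\<in>triv ?B. \<forall>i\<in>idx ?B. \<forall>j\<in>idx ?B.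
       smooth_on M (U \<inter> V) (\<lambda>p. \<theta> p (frame_vec ?B \<psi> p j) i)"
    unfolding U(1) prod.case
  proof (intro ballI, clarify)
    fix V \<theta> i j assume V: "(V, \<theta>) \<in> triv ?B" and "i \<in> idx ?B" "j \<in> idx ?B"
    then have ij: "i < r" "j < r" by auto
    obtain e' where e': "local_frame M E r L V e'"
      "\<And>p a. p \<in> V \<Longrightarrow> a \<in> L p \<Longrightarrow> a = (\<Sum>i<r. \<theta> p a i *\<^sub>R e' i p)"
      by (rule subbundle_triv[OF V]) (rule that)
    have "e j p \<in> L p" if "p \<in> U" for p
      using local_frame_in[OF e(1) that ij(2)] .
    then show "smooth_on M (U \<inter> V) (\<lambda>p. \<theta> p (frame_vec ?B \<psi> p j) i)"
    proof -
      assume ej: "\<And>p. p \<in> U \<Longrightarrow> e j p \<in> L p"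
      have "e j p = (\<Sum>i<r. \<theta> p (frame_vec ?B \<psi> p j) i *\<^sub>R e' i p)" if p: "p \<in> U \<inter> V" for p
      proof -
        have "p \<in> U" "p \<in> V" using p by auto
        then show ?thesis unfolding e(4)[OF \<open>p \<in> U\<close> ij(2)] by (intro e'(2) ej)
      qed
      then show ?thesis
        by (rule smooth_local_frame_coefficients[OF E e'(1) local_frameD(1)[OF e(1)]
              local_frameD(2)[OF e(1) ij(2)] _ ij(1)])
    qed
  qed
qed

section \<open>The bundle of pairs of a vector and a form in coordinates\<close>

lemma triv_higher_TM:
  "triv (higher_TM M k) = {(U \<inter> V, \<lambda>p (a, b). case_sum (\<psi> p a) (\<theta> p b)) | U \<psi> V \<theta>.
      (U, \<psi>) \<in> triv (tangent_bundle M) \<and> (V, \<theta>) \<in> triv (ext_bundle M k)}"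
  by (simp add: higher_TM_def direct_sum_def)

lemma higher_TM_simps:
  "fib (higher_TM M k) p = tangent_space M p \<times> ext_power M k p"
  "idx (higher_TM M k) = idx (tangent_bundle M) <+> idx (ext_bundle M k)"
  by (simp_all add: higher_TM_def direct_sum_def tangent_bundle_def ext_bundle_def)

text \<open>That coordinates separate vectors is \<open>tangent_expansion\<close> for the first
  component and \<open>ext_power_eq_0I\<close> for the second. The two components may be read in
  different charts, each expansion being used in its own.\<close>

lemma coordinatized_higher_TM: "coordinatized (higher_TM M k)"
proof -
  let ?E = "higher_TM M k"
  have idx: "idx ?E = {..<n} <+> multi_indices n k"
    by (simp_all add: higher_TM_simps tangent_bundle_def ext_bundle_def)
  note fib = higher_TM_simps(1)
  have triv_T: "(U, \<psi>) \<in> triv (tangent_bundle M) \<longleftrightarrow>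
      (\<exists>c. (U, c) \<in> atlas M \<and> \<psi> = (\<lambda>p v i. if i < n then v (\<lambda>q. c q i) else 0))" for U \<psi>
    by (auto simp: tangent_bundle_def)
  have triv_ext: "(V, \<theta>) \<in> triv (ext_bundle M k) \<longleftrightarrow>
      (\<exists>d. (V, d) \<in> atlas M \<and> \<theta> = (\<lambda>p \<alpha> is. if is \<in> multi_indices n k
        then \<alpha> (map (coord_vec M (V, d) p) is) else 0))" for V \<theta>
    by (auto simp: ext_bundle_def)
  have "finite (multi_indices n k)"
    by (rule finite_subset[OF _ finite_lists_length_eq[of "{..<n}" k]]) (auto simp: multi_indices_def)
  show ?thesis
    unfolding coordinatized_def
  proof (intro conjI allI impI ballI)
    show "finite (idx ?E)" using \<open>finite (multi_indices n k)\<close> by (simp add: idx)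
    show "subspace (fib ?E p)" for p
      unfolding fib by (intro subspace_Times subspace_tangent_space subspace_ext_power)
    show "\<exists>U \<psi>. (U, \<psi>) \<in> triv ?E \<and> p \<in> U" for p
    proof -
      obtain U c where "(U, c) \<in> atlas M" "p \<in> U" using chart_cover[of p] by blast
      moreover from this(1) obtain \<psi> \<theta> where
        "(U, \<psi>) \<in> triv (tangent_bundle M)" "(U, \<theta>) \<in> triv (ext_bundle M k)"
        unfolding triv_T triv_ext by blast
      ultimately have "(U \<inter> U, \<lambda>p (a, b). case_sum (\<psi> p a) (\<theta> p b)) \<in> triv ?E" "p \<in> U \<inter> U"
        unfolding triv_higher_TM by blast+
      then show ?thesis by blast
    qed
  next
    fix W \<xi> assume "(W, \<xi>) \<in> triv ?E"
    then obtain U c V d where C: "(U, c) \<in> atlas M" "(V, d) \<in> atlas M" and W: "W = U \<inter> V"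
      and \<xi>: "\<xi> = (\<lambda>p (a, b). case_sum (\<lambda>i. if i < n then a (\<lambda>q. c q i) else 0)
        (\<lambda>is. if is \<in> multi_indices n k then b (map (coord_vec M (V, d) p) is) else 0))"
    proof -
      obtain U \<psi> V \<theta> where *: "W = U \<inter> V" "\<xi> = (\<lambda>p (a, b). case_sum (\<psi> p a) (\<theta> p b))"
        "(U, \<psi>) \<in> triv (tangent_bundle M)" "(V, \<theta>) \<in> triv (ext_bundle M k)"
        using \<open>(W, \<xi>) \<in> triv ?E\<close> unfolding triv_higher_TM by blast
      obtain c d where "(U, c) \<in> atlas M" "\<psi> = (\<lambda>p v i. if i < n then v (\<lambda>q. c q i) else 0)"
        "(V, d) \<in> atlas M" "\<theta> = (\<lambda>p \<alpha> is. if is \<in> multi_indices n k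
          then \<alpha> (map (coord_vec M (V, d) p) is) else 0)"
        using *(3,4) unfolding triv_T triv_ext by blast
      with * that show ?thesis by simp
    qed
    show "open W" unfolding W using chart_open C by blast
    fix p assume p: "p \<in> W"
    show "linear_over (fib ?E p) (\<xi> p)"
      unfolding linear_over_def \<xi>
      by (auto simp: fun_eq_iff scaleR_fun_def split: sum.splits)
    fix a assume "a \<in> fib ?E p" and zero: "\<forall>i\<in>idx ?E. \<xi> p a i = 0"
    then obtain v \<alpha> where a: "a = (v, \<alpha>)" "v \<in> tangent_space M p" "\<alpha> \<in> ext_power M k p"
      unfolding fib by blast
    have "v (\<lambda>q. c q i) = 0" if "i < n" for i
      using bspec[OF zero, of "Inl i"] that by (simp add: idx \<xi> a(1) InlI)
    then have "v = 0" using tangent_expansion[OF a(2) C(1)] p W by simp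
    moreover have "\<alpha> = 0"
    proof (rule ext_power_eq_0I[OF a(3) C(2)])
      show "p \<in> V" using p W by simp
      show "\<alpha> (map (coord_vec M (V, d) p) is) = 0" if "is \<in> multi_indices n k" for "is"
        using bspec[OF zero, of "Inr is"] that by (simp add: idx \<xi> a(1) InrI)
    qed
    ultimately show "a = 0" by (simp add: a(1) zero_prod_def)
  qed
qed

end

subsection \<open>The graph of a \<open>k\<close>-Poisson structure\<close>

lemma linear_over_image_subspace:
  assumes "linear_over V f" "subspace V" shows "subspace (f ` V)"
  unfolding subspace_def
proof (intro conjI ballI allI)
  show "0 \<in> f ` V" using linear_over_0[OF assms] subspace_0[OF assms(2)] by (metis imageI)
  fix x r assume "x \<in> f ` V"
  then obtain a where a: "a \<in> V" "x = f a" by blast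
  then have "f (r *\<^sub>R a) = r *\<^sub>R x" using assms(1) by (simp add: linear_over_def)
  then show "r *\<^sub>R x \<in> f ` V" using a subspace_scale[OF assms(2)] by (metis imageI)
  fix y assume "y \<in> f ` V"
  then obtain b where b: "b \<in> V" "y = f b" by blast
  then have "f (a + b) = x + y" using assms(1) a by (simp add: linear_over_def)
  then show "x + y \<in> f ` V" using a b subspace_add[OF assms(2)] by (metis imageI)
qed

lemma linear_over_inj_on:
  assumes f: "linear_over V f" and V: "subspace V" and ker: "\<And>a. a \<in> V \<Longrightarrow> f a = 0 \<Longrightarrow> a = 0"
  shows "inj_on f V"
proof (rule inj_onI)
  fix a b assume ab: "a \<in> V" "b \<in> V" "f a = f b"
  have "f (a + (-1) *\<^sub>R b) = f a + (-1) *\<^sub>R f b"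
    using f ab subspace_scale[OF V] unfolding linear_over_def by metis
  then show "a = b" using ker[of "a + (-1) *\<^sub>R b"] subspace_diff[OF V ab(1,2)] ab(3) by simp
qed

lemma linear_over_inv_into:
  assumes f: "linear_over V f" and V: "subspace V" and inj: "inj_on f V"
  shows "linear_over (f ` V) (inv_into V f)"
  unfolding linear_over_def
proof (intro conjI ballI allI)
  fix x r assume "x \<in> f ` V"
  then obtain a where a: "a \<in> V" "x = f a" by blast
  have "r *\<^sub>R x = f (r *\<^sub>R a)" using f a by (simp add: linear_over_def)
  then show "inv_into V f (r *\<^sub>R x) = r *\<^sub>R inv_into V f x"
    using a inv_into_f_f[OF inj] subspace_scale[OF V] by metis
  fix y assume "y \<in> f ` V"
  then obtain b where b: "b \<in> V" "y = f b" by blast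
  have "x + y = f (a + b)" using f a b by (simp add: linear_over_def)
  then show "inv_into V f (x + y) = inv_into V f x + inv_into V f y"
    using a b inv_into_f_f[OF inj] subspace_add[OF V] by metis
qed

lemma subbundle_algebroid_simps [simp]:
  "fib (subbundle_algebroid M k r L) = L"
  "idx (subbundle_algebroid M k r L) = {..<r}"
  "triv (subbundle_algebroid M k r L) = triv (subbundle M (higher_TM M k) r L)"
  "anchor (subbundle_algebroid M k r L) = (\<lambda>p. fst)"
  "bracket (subbundle_algebroid M k r L) = courant_bracket M k"
  by (simp_all add: subbundle_algebroid_def vbundle.extend_def lie_algebroid.fields_def subbundle_def)

lemma frame_vec_subbundle_algebroid [simp]:
  "frame_vec (subbundle_algebroid M k r L) = frame_vec (subbundle M (higher_TM M k) r L)"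
  by (simp add: fun_eq_iff frame_vec_def)

text \<open>The algebroid is an extension of the bundle record, and the bundle notions read only the
  fields that the two share. This and the next lemma carry facts across the two record
  types.\<close>

lemma vector_bundle_subbundle_algebroid:
  "vector_bundle M (subbundle_algebroid M k r L) \<longleftrightarrow> vector_bundle M (subbundle M (higher_TM M k) r L)"
  by (simp add: vector_bundle_def)

lemma sections_subbundle_algebroid:
  "sections M (subbundle_algebroid M k r L) = sections M (subbundle M (higher_TM M k) r L)"
  by (simp add: sections_def smooth_section_def)

lemma sections_in_fib: "s \<in> sections M E \<Longrightarrow> s p \<in> fib E p"
  by (simp add: sections_def smooth_section_def)

context smooth_mfd
begin

lemma sections_closed:
  assumes E: "vector_bundle M E" and s: "s \<in> sections M E"
  shows sections_add: "t \<in> sections M E \<Longrightarrow> s + t \<in> sections M E"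
    and sections_mult: "smooth_on M UNIV f \<Longrightarrow> (\<lambda>p. f p *\<^sub>R s p) \<in> sections M E"
    and sections_scale: "r *\<^sub>R s \<in> sections M E"
proof -
  note E' = vector_bundle_coordinatized[OF E]
  show "t \<in> sections M E \<Longrightarrow> s + t \<in> sections M E"
    using s smooth_section_add[OF E', of UNIV s t] by (simp add: sections_def plus_fun_def)
  show *: "smooth_on M UNIV f \<Longrightarrow> (\<lambda>p. f p *\<^sub>R s p) \<in> sections M E" for f
    using s smooth_section_scale[OF E', of UNIV f s] by (simp add: sections_def)
  show "r *\<^sub>R s \<in> sections M E"
    using *[OF smooth_on_const] by (simp add: scaleR_fun_def)
qed

lemma smooth_section_fst:
  assumes s: "smooth_section M (higher_TM M k) W s"
  shows "smooth_section M (tangent_bundle M) W (\<lambda>p. fst (s p))"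
proof (rule smooth_sectionI)
  show "fst (s p) \<in> fib (tangent_bundle M) p" if "p \<in> W" for p
    using smooth_sectionD(1)[OF s that] by (auto simp: higher_TM_simps tangent_bundle_def)
  fix U \<psi> i assume U: "(U, \<psi>) \<in> triv (tangent_bundle M)" "i \<in> idx (tangent_bundle M)"
  then obtain c where "(U, c) \<in> atlas M" by (auto simp: tangent_bundle_def)
  \<comment> \<open>Using the same chart for the forms makes the domain of the combined
    trivialization \<open>U\<close> itself.\<close>
  then obtain \<theta> where "(U, \<theta>) \<in> triv (ext_bundle M k)" by (auto simp: ext_bundle_def)
  then have "(U \<inter> U, \<lambda>p (a, b). case_sum (\<psi> p a) (\<theta> p b)) \<in> triv (higher_TM M k)"
    using U unfolding triv_higher_TM by blast
  from smooth_sectionD(2)[OF s this, of "Inl i"]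
  show "smooth_on M (U \<inter> W) (\<lambda>p. \<psi> p (fst (s p)) i)"
    using InlI[OF U(2), of "idx (ext_bundle M k)"] by (simp add: higher_TM_simps split_beta)
qed

end

section \<open>The image of the anchor paired with \<mu>, as a subbundle\<close>

locale k_poisson_mfd = smooth_mfd M
  for M :: "('m::{t2_space, second_countable_topology}) manifold" +
  fixes k :: nat and A :: "('m, 'a::real_vector, 'i) lie_algebroid" and \<mu> :: "'m \<Rightarrow> 'a \<Rightarrow> 'm form"
  assumes lie_algebroid: "lie_algebroid M A"
    and k_poisson: "k_poisson M k A \<mu>"
begin

definition graph_map :: "'m \<Rightarrow> 'a \<Rightarrow> 'm gvec" ("\<phi>")
  where "\<phi> p a = (anchor A p a, \<mu> p a)"

definition graph :: "'m \<Rightarrow> 'm gvec set" ("L")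
  where "L p = \<phi> p ` fib A p"

abbreviation "E \<equiv> higher_TM M k"
abbreviation "r \<equiv> card (idx A)"
abbreviation "B \<equiv> subbundle_algebroid M k r L"

lemma fst_snd_graph_map [simp]: "fst (\<phi> p a) = anchor A p a" "snd (\<phi> p a) = \<mu> p a"
  by (simp_all add: graph_map_def)

lemma vector_bundle_A: "vector_bundle M A"
  using lie_algebroid unfolding lie_algebroid_def by (elim conjE)

lemma vb_map_anchor: "vb_map M A (tangent_bundle M) (anchor A)"
  using lie_algebroid unfolding lie_algebroid_def by (elim conjE)

lemma vb_map_mu: "vb_map M A (ext_bundle M k) \<mu>"
  using k_poisson unfolding k_poisson_def closed_IM_form_def by (elim conjE)

lemma ker_mu: "{a \<in> fib A p. \<mu> p a = 0} = {0}"
  using k_poisson unfolding k_poisson_def by (elim conjE) (erule spec)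

lemma nondegenerate: "{X \<in> tangent_space M p. \<forall>a\<in>fib A p. contract X (\<mu> p a) = 0} = {0}"
  using k_poisson unfolding k_poisson_def by (elim conjE) (erule spec)

lemma IM_rules:
  assumes "u \<in> sections M A" "v \<in> sections M A"
  shows IM_skew: "contract (anchor A p (u p)) (\<mu> p (v p)) = - contract (anchor A p (v p)) (\<mu> p (u p))"
    and IM_bracket: "\<mu> p (bracket A u v p) =
      lie_deriv M k (anchor_section A u) (\<lambda>q. \<mu> q (v q)) p -
      contract (anchor A p (v p)) (ext_deriv M k (\<lambda>q. \<mu> q (u q)) p)"
proof -
  have "\<forall>u\<in>sections M A. \<forall>v\<in>sections M A. \<forall>p.
       contract (anchor A p (u p)) (\<mu> p (v p)) = - contract (anchor A p (v p)) (\<mu> p (u p)) \<and>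
       \<mu> p (bracket A u v p) =
         lie_deriv M k (anchor_section A u) (\<lambda>q. \<mu> q (v q)) p -
         contract (anchor A p (v p)) (ext_deriv M k (\<lambda>q. \<mu> q (u q)) p)"
    using k_poisson unfolding k_poisson_def closed_IM_form_def by (elim conjE)
  note * = spec[OF bspec[OF bspec[OF this assms(1)] assms(2)], of p]
  show "contract (anchor A p (u p)) (\<mu> p (v p)) = - contract (anchor A p (v p)) (\<mu> p (u p))"
    by (rule conjunct1[OF *])
  show "\<mu> p (bracket A u v p) = lie_deriv M k (anchor_section A u) (\<lambda>q. \<mu> q (v q)) p -
      contract (anchor A p (v p)) (ext_deriv M k (\<lambda>q. \<mu> q (u q)) p)"
    by (rule conjunct2[OF *])
qed

lemma subspace_fib: "subspace (fib A p)"
  using vector_bundle_subspace[OF vector_bundle_A] .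

lemma vb_map_graph_map: "vb_map M A E \<phi>"
proof (rule vb_mapI)
  show "\<phi> p a \<in> fib E p" if "a \<in> fib A p" for p a
    using vb_mapD(1)[OF vb_map_anchor that] vb_mapD(1)[OF vb_map_mu that]
    by (simp add: graph_map_def higher_TM_simps tangent_bundle_def ext_bundle_def)
  show "linear_over (fib A p) (\<phi> p)" for p
    using vb_mapD(2)[OF vb_map_anchor, of p] vb_mapD(2)[OF vb_map_mu, of p]
    by (simp add: graph_map_def linear_over_def)
  fix U \<psi> W \<xi> j i
  assume U: "(U, \<psi>) \<in> triv A" "j \<in> idx A" and W: "(W, \<xi>) \<in> triv E" and i: "i \<in> idx E"
  obtain V \<theta> V' \<theta>' where *: "W = V \<inter> V'" "\<xi> = (\<lambda>p (a, b). case_sum (\<theta> p a) (\<theta>' p b))"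
    "(V, \<theta>) \<in> triv (tangent_bundle M)" "(V', \<theta>') \<in> triv (ext_bundle M k)"
    using W unfolding triv_higher_TM by blast
  show "smooth_on M (U \<inter> W) (\<lambda>p. \<xi> p (\<phi> p (frame_vec A \<psi> p j)) i)"
  proof (cases i)
    case (Inl l)
    then have "smooth_on M (U \<inter> V) (\<lambda>p. \<theta> p (anchor A p (frame_vec A \<psi> p j)) l)"
      using vb_mapD(3)[OF vb_map_anchor U(1) *(3) U(2)] i by (auto simp: higher_TM_simps)
    then have "smooth_on M (U \<inter> W) (\<lambda>p. \<theta> p (anchor A p (frame_vec A \<psi> p j)) l)"
      by (rule smooth_on_subset) (auto simp: *(1))
    then show ?thesis by (simp add: *(2) graph_map_def Inl)
  next
    case (Inr l)
    then have "smooth_on M (U \<inter> V') (\<lambda>p. \<theta>' p (\<mu> p (frame_vec A \<psi> p j)) l)"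
      using vb_mapD(3)[OF vb_map_mu U(1) *(4) U(2)] i by (auto simp: higher_TM_simps)
    then have "smooth_on M (U \<inter> W) (\<lambda>p. \<theta>' p (\<mu> p (frame_vec A \<psi> p j)) l)"
      by (rule smooth_on_subset) (auto simp: *(1))
    then show ?thesis by (simp add: *(2) graph_map_def Inr)
  qed
qed

lemmas linear_graph_map = vb_mapD(2)[OF vb_map_graph_map]

lemma graph_map_eq_0: "a \<in> fib A p \<Longrightarrow> \<phi> p a = 0 \<Longrightarrow> a = 0"
  using ker_mu[of p] by (auto simp: graph_map_def zero_prod_def)

lemma inj_graph_map: "inj_on (\<phi> p) (fib A p)"
  by (rule linear_over_inj_on[OF linear_graph_map subspace_fib graph_map_eq_0])

lemma graph_subset: "L p \<subseteq> fib E p"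
  using vb_mapD(1)[OF vb_map_graph_map] by (auto simp: graph_def)

lemma subspace_graph: "subspace (L p)"
  unfolding graph_def by (rule linear_over_image_subspace[OF linear_graph_map subspace_fib])

context
  fixes U \<psi> assumes U: "(U, \<psi>) \<in> triv A"
begin

lemma smooth_section_graph_frame:
  "j \<in> idx A \<Longrightarrow> smooth_section M E U (\<lambda>p. \<phi> p (frame_vec A \<psi> p j))"
  using vb_map_section[OF vector_bundle_A coordinatized_higher_TM vb_map_graph_map
      vector_bundleD(1)[OF vector_bundle_A U] smooth_section_frame_vec[OF vector_bundle_A U]] .

lemma graph_frame_sum:
  assumes "p \<in> U"
  shows "(\<Sum>j\<in>idx A. d j *\<^sub>R \<phi> p (frame_vec A \<psi> p j)) = \<phi> p (\<Sum>j\<in>idx A. d j *\<^sub>R frame_vec A \<psi> p j)"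
  by (rule linear_over_sum[OF linear_graph_map subspace_fib, symmetric])
    (rule frame_vec_in_fib[OF vector_bundle_A U assms])

lemma frame_sum_in_fib: "p \<in> U \<Longrightarrow> (\<Sum>j\<in>idx A. d j *\<^sub>R frame_vec A \<psi> p j) \<in> fib A p"
  using frame_vec_in_fib[OF vector_bundle_A U] subspace_fib by (intro subspace_sum subspace_scale)

lemma graph_frame_independent:
  assumes "p \<in> U" "(\<Sum>j\<in>idx A. d j *\<^sub>R \<phi> p (frame_vec A \<psi> p j)) = 0" "j \<in> idx A"
  shows "d j = 0"
proof (rule frame_independent[OF vector_bundle_A U assms(1) _ assms(3)])
  show "(\<Sum>j\<in>idx A. d j *\<^sub>R frame_vec A \<psi> p j) = 0"
    by (rule graph_map_eq_0[OF frame_sum_in_fib[OF assms(1)]])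
      (use assms(2) graph_frame_sum[OF assms(1)] in simp)
qed

lemma graph_frame_span:
  assumes "p \<in> U" shows "L p = range (\<lambda>d. \<Sum>j\<in>idx A. d j *\<^sub>R \<phi> p (frame_vec A \<psi> p j))"
proof -
  have "fib A p = range (\<lambda>d. \<Sum>j\<in>idx A. d j *\<^sub>R frame_vec A \<psi> p j)"
  proof
    show "fib A p \<subseteq> range (\<lambda>d. \<Sum>j\<in>idx A. d j *\<^sub>R frame_vec A \<psi> p j)"
      by (intro subsetI range_eqI) (rule frame_expansion[OF vector_bundle_A U assms])
  qed (use frame_sum_in_fib[OF assms] in auto)
  then show ?thesis
    unfolding graph_def graph_frame_sum[OF assms] by (simp add: image_image)
qed

text \<open>Frames of a subbundle are numbered by \<open>{..<r}\<close>, those of \<open>A\<close>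
  by \<open>idx A\<close>; the bijection \<open>h\<close> translates between the two.\<close>

lemma local_frame_graph:
  assumes h: "bij_betw h {..<r} (idx A)"
  shows "local_frame M E r L U (\<lambda>i p. \<phi> p (frame_vec A \<psi> p (h i)))"
proof -
  have reindex: "(\<Sum>i<r. d (h i) *\<^sub>R \<phi> p (frame_vec A \<psi> p (h i))) =
      (\<Sum>j\<in>idx A. d j *\<^sub>R \<phi> p (frame_vec A \<psi> p j))" for d p
    by (rule sum.reindex_bij_betw[OF h])
  have inv: "h (inv_into {..<r} h j) = j" if "j \<in> idx A" for j
    using h that by (simp add: bij_betw_inv_into_right)
  have inv': "inv_into {..<r} h (h i) = i" if "i < r" for i
    using h that by (simp add: bij_betw_inv_into_left)
  have reindex': "(\<Sum>i<r. d i *\<^sub>R \<phi> p (frame_vec A \<psi> p (h i))) =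
      (\<Sum>j\<in>idx A. d (inv_into {..<r} h j) *\<^sub>R \<phi> p (frame_vec A \<psi> p j))" for d p
    unfolding reindex[symmetric] by (intro sum.cong) (auto simp: inv')
  have h_in: "h i \<in> idx A" if "i < r" for i using h that by (auto simp: bij_betw_def)
  show ?thesis
  proof (rule local_frameI)
    show "open U" using vector_bundleD(1)[OF vector_bundle_A U] .
    show "smooth_section M E U (\<lambda>p. \<phi> p (frame_vec A \<psi> p (h i)))" if "i < r" for i
      by (rule smooth_section_graph_frame[OF h_in[OF that]])
    fix p assume p: "p \<in> U"
    show "\<forall>i<r. d i = 0" if "(\<Sum>i<r. d i *\<^sub>R \<phi> p (frame_vec A \<psi> p (h i))) = 0" for d
      using graph_frame_independent[OF p that[unfolded reindex']] h_in inv' by metis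
    show "L p = range (\<lambda>d. \<Sum>i<r. d i *\<^sub>R \<phi> p (frame_vec A \<psi> p (h i)))"
    proof
      show "L p \<subseteq> range (\<lambda>d. \<Sum>i<r. d i *\<^sub>R \<phi> p (frame_vec A \<psi> p (h i)))"
        unfolding graph_frame_span[OF p] reindex[symmetric] by auto
      show "range (\<lambda>d. \<Sum>i<r. d i *\<^sub>R \<phi> p (frame_vec A \<psi> p (h i))) \<subseteq> L p"
        unfolding graph_frame_span[OF p] reindex' by auto
    qed
  qed
qed

end

lemma is_subbundle_graph: "is_subbundle M E r L"
  unfolding is_subbundle_def
proof (intro conjI allI)
  show "subspace (L p)" "L p \<subseteq> fib E p" for p by (fact subspace_graph graph_subset)+
  fix p
  obtain U \<psi> where U: "(U, \<psi>) \<in> triv A" "p \<in> U" using vector_bundle_cover[OF vector_bundle_A] .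
  obtain h where "bij_betw h {..<r} (idx A)"
    using ex_bij_betw_nat_finite[OF vector_bundle_finite_idx[OF vector_bundle_A]]
    by (auto simp: atLeast0LessThan)
  then show "\<exists>U e. p \<in> U \<and> local_frame M E r L U e"
    using local_frame_graph[OF U(1)] U(2) by blast
qed

section \<open>The bundle isomorphism\<close>

lemma vector_bundle_B: "vector_bundle M B"
  unfolding vector_bundle_subbundle_algebroid
  by (rule vector_bundle_subbundle[OF coordinatized_higher_TM is_subbundle_graph])

text \<open>The matrix entries are the coefficients of the image of a frame section, which is smooth
  in the ambient bundle, with respect to a local frame of the image.\<close>

lemma vb_map_A_B: "vb_map M A B \<phi>"
proof (rule vb_mapI)
  fix U \<psi> V \<theta> j i
  assume U: "(U, \<psi>) \<in> triv A" and V: "(V, \<theta>) \<in> triv B" and j: "j \<in> idx A" and i: "i \<in> idx B"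
  obtain e where e: "local_frame M E r L V e"
    "\<And>p a. p \<in> V \<Longrightarrow> a \<in> L p \<Longrightarrow> a = (\<Sum>i<r. \<theta> p a i *\<^sub>R e i p)"
    by (rule subbundle_triv[OF V[unfolded subbundle_algebroid_simps]]) (rule that)
  show "smooth_on M (U \<inter> V) (\<lambda>p. \<theta> p (\<phi> p (frame_vec A \<psi> p j)) i)"
  proof (rule smooth_local_frame_coefficients[OF coordinatized_higher_TM e(1)
        vector_bundleD(1)[OF vector_bundle_A U] smooth_section_graph_frame[OF U j]])
    fix p assume p: "p \<in> U \<inter> V"
    show "\<phi> p (frame_vec A \<psi> p j) = (\<Sum>i<r. \<theta> p (\<phi> p (frame_vec A \<psi> p j)) i *\<^sub>R e i p)"
      by (rule e(2)) (use p frame_vec_in_fib[OF vector_bundle_A U _ j] in \<open>auto simp: graph_def\<close>)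
  qed (use i in auto)
qed (auto simp: graph_def linear_graph_map)

text \<open>The matrix entries of the inverse are the coefficients of a frame section
  \<open>e j\<close> of the image with respect to the images of the frame vectors of
  \<open>A\<close>. Both sides are smooth in the ambient bundle.\<close>

lemma vb_map_B_A: "vb_map M B A (\<lambda>p. inv_into (fib A p) (\<phi> p))"
proof (rule vb_mapI)
  show "inv_into (fib A p) (\<phi> p) x \<in> fib A p" if "x \<in> fib B p" for p x
    using that by (auto simp: graph_def intro: inv_into_into)
  show "linear_over (fib B p) (inv_into (fib A p) (\<phi> p))" for p
    using linear_over_inv_into[OF linear_graph_map subspace_fib inj_graph_map] by (simp add: graph_def)
  fix V \<theta> U \<psi> j i
  assume V: "(V, \<theta>) \<in> triv B" and U: "(U, \<psi>) \<in> triv A" and j: "j \<in> idx B" and i: "i \<in> idx A"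
  obtain e where e: "local_frame M E r L V e"
    "\<And>p j. p \<in> V \<Longrightarrow> j < r \<Longrightarrow> frame_vec (subbundle M E r L) \<theta> p j = e j p"
    by (rule subbundle_triv[OF V[unfolded subbundle_algebroid_simps]]) (rule that)
  have j: "j < r" using j by simp
  let ?a = "\<lambda>p. inv_into (fib A p) (\<phi> p) (frame_vec B \<theta> p j)"
  have UV: "open (V \<inter> U)"
    using local_frameD(1)[OF e(1)] vector_bundleD(1)[OF vector_bundle_A U] by (rule open_Int)
  show "smooth_on M (V \<inter> U) (\<lambda>p. \<psi> p (?a p) i)"
  proof (rule smooth_coefficients[OF coordinatized_higher_TM UV vector_bundle_finite_idx[OF vector_bundle_A],
        where e = "\<lambda>i p. \<phi> p (frame_vec A \<psi> p i)" and s = "e j"])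
    show "smooth_section M E (V \<inter> U) (\<lambda>p. \<phi> p (frame_vec A \<psi> p i))" if "i \<in> idx A" for i
      by (rule smooth_section_subset[OF smooth_section_graph_frame[OF U that]]) auto
    show "smooth_section M E (V \<inter> U) (e j)"
      by (rule smooth_section_subset[OF local_frameD(2)[OF e(1) j]]) auto
    fix p assume p: "p \<in> V \<inter> U"
    then have "p \<in> U" "p \<in> V" by auto
    have ej: "e j p \<in> \<phi> p ` fib A p"
      using local_frame_in[OF e(1) \<open>p \<in> V\<close> j] by (simp add: graph_def)
    have a: "?a p = inv_into (fib A p) (\<phi> p) (e j p)" using e(2)[OF \<open>p \<in> V\<close> j] by simp
    have "?a p \<in> fib A p" unfolding a by (rule inv_into_into[OF ej])
    then have "\<phi> p (?a p) = (\<Sum>i\<in>idx A. \<psi> p (?a p) i *\<^sub>R \<phi> p (frame_vec A \<psi> p i))"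
      unfolding graph_frame_sum[OF U \<open>p \<in> U\<close>]
      by (intro arg_cong[of _ _ "\<phi> p"] frame_expansion[OF vector_bundle_A U \<open>p \<in> U\<close>])
    moreover have "\<phi> p (?a p) = e j p" unfolding a by (rule f_inv_into_f[OF ej])
    ultimately show "e j p = (\<Sum>i\<in>idx A. \<psi> p (?a p) i *\<^sub>R \<phi> p (frame_vec A \<psi> p i))" by simp
  next
    fix p d l assume "p \<in> V \<inter> U" "(\<Sum>j\<in>idx A. d j *\<^sub>R \<phi> p (frame_vec A \<psi> p j)) = 0" "l \<in> idx A"
    then show "d l = 0" using graph_frame_independent[OF U] by blast
  qed fact
qed

lemma vb_iso_graph: "vb_iso M A B \<phi>"
  using vb_map_A_B vb_map_B_A inj_graph_map by (simp add: vb_iso_def bij_betw_def graph_def)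

section \<open>Transport of the Lie algebroid structure\<close>

lemma graph_section: "u \<in> sections M A \<Longrightarrow> (\<lambda>p. \<phi> p (u p)) \<in> sections M B"
  using vb_map_section[OF vector_bundle_A vector_bundle_coordinatized[OF vector_bundle_B] vb_map_A_B, of UNIV u]
  by (simp add: sections_def)

text \<open>Smoothness of the inverse map is used here: it lets every axiom for sections of the
  image be checked on sections of \<open>A\<close>.\<close>

lemma graph_sectionE:
  assumes "s \<in> sections M B"
  obtains u where "u \<in> sections M A" "s = (\<lambda>p. \<phi> p (u p))"
proof
  show "(\<lambda>p. inv_into (fib A p) (\<phi> p) (s p)) \<in> sections M A"
    using vb_map_section[OF vector_bundle_B vector_bundle_coordinatized[OF vector_bundle_A] vb_map_B_A, of UNIV s]
      assms by (simp add: sections_def)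
  show "s = (\<lambda>p. \<phi> p (inv_into (fib A p) (\<phi> p) (s p)))"
    using sections_in_fib[OF assms] by (simp add: graph_def f_inv_into_f)
qed

lemma lie_algebroid_rules:
  assumes "u \<in> sections M A" "v \<in> sections M A"
  shows bracket_section: "bracket A u v \<in> sections M A"
    and bracket_skew: "bracket A u v = - bracket A v u"
    and bracket_add: "w \<in> sections M A \<Longrightarrow> bracket A u (v + w) = bracket A u v + bracket A u w"
    and bracket_jacobi: "w \<in> sections M A \<Longrightarrow>
      bracket A u (bracket A v w) + bracket A v (bracket A w u) + bracket A w (bracket A u v) = 0"
    and bracket_scale: "bracket A u (c *\<^sub>R v) = c *\<^sub>R bracket A u v"
    and bracket_leibniz: "smooth_on M UNIV f \<Longrightarrow> bracket A u (\<lambda>p. f p *\<^sub>R v p) =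
      (\<lambda>p. f p *\<^sub>R bracket A u v p + anchor A p (u p) f *\<^sub>R v p)"
    and bracket_anchor: "anchor_section A (bracket A u v) =
      lie_bracket M (anchor_section A u) (anchor_section A v)"
proof -
  have "\<forall>u\<in>sections M A. \<forall>v\<in>sections M A.
       bracket A u v \<in> sections M A \<and>
       bracket A u v = - bracket A v u \<and>
       (\<forall>w\<in>sections M A.
          bracket A u (v + w) = bracket A u v + bracket A u w \<and>
          bracket A u (bracket A v w) + bracket A v (bracket A w u) + bracket A w (bracket A u v) = 0) \<and>
       (\<forall>r. bracket A u (r *\<^sub>R v) = r *\<^sub>R bracket A u v) \<and>
       (\<forall>f. smooth_on M UNIV f \<longrightarrow>
          bracket A u (\<lambda>p. f p *\<^sub>R v p) =
            (\<lambda>p. f p *\<^sub>R bracket A u v p + anchor A p (u p) f *\<^sub>R v p)) \<and>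
       anchor_section A (bracket A u v) =
         lie_bracket M (anchor_section A u) (anchor_section A v)"
    using lie_algebroid unfolding lie_algebroid_def by (elim conjE)
  note * = bspec[OF bspec[OF this assms(1)] assms(2)]
  note rules = conjunct1[OF *] conjunct1[OF conjunct2[OF *]]
    conjunct1[OF conjunct2[OF conjunct2[OF *]]] conjunct1[OF conjunct2[OF conjunct2[OF conjunct2[OF *]]]]
    conjunct1[OF conjunct2[OF conjunct2[OF conjunct2[OF conjunct2[OF *]]]]]
    conjunct2[OF conjunct2[OF conjunct2[OF conjunct2[OF conjunct2[OF *]]]]]
  show "bracket A u v \<in> sections M A" by (rule rules(1))
  show "bracket A u v = - bracket A v u" by (rule rules(2))
  show "w \<in> sections M A \<Longrightarrow> bracket A u (v + w) = bracket A u v + bracket A u w"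
    by (rule conjunct1[OF bspec[OF rules(3)]])
  show "w \<in> sections M A \<Longrightarrow>
      bracket A u (bracket A v w) + bracket A v (bracket A w u) + bracket A w (bracket A u v) = 0"
    by (rule conjunct2[OF bspec[OF rules(3)]])
  show "bracket A u (c *\<^sub>R v) = c *\<^sub>R bracket A u v" by (rule spec[OF rules(4)])
  show "smooth_on M UNIV f \<Longrightarrow> bracket A u (\<lambda>p. f p *\<^sub>R v p) =
      (\<lambda>p. f p *\<^sub>R bracket A u v p + anchor A p (u p) f *\<^sub>R v p)"
    by (rule mp[OF spec[OF rules(5)]])
  show "anchor_section A (bracket A u v) = lie_bracket M (anchor_section A u) (anchor_section A v)"
    by (rule rules(6))
qed

lemma courant_bracket_graph:
  assumes "u \<in> sections M A" "v \<in> sections M A"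
  shows "courant_bracket M k (\<lambda>p. \<phi> p (u p)) (\<lambda>p. \<phi> p (v p)) = (\<lambda>p. \<phi> p (bracket A u v p))"
proof
  fix p
  have "anchor A p (bracket A u v p) = lie_bracket M (anchor_section A u) (anchor_section A v) p"
    using fun_cong[OF bracket_anchor[OF assms], of p] by (simp add: anchor_section_def)
  then show "courant_bracket M k (\<lambda>p. \<phi> p (u p)) (\<lambda>p. \<phi> p (v p)) p = \<phi> p (bracket A u v p)"
    using IM_bracket[OF assms, of p]
    unfolding courant_bracket_def fst_snd_graph_map graph_map_def[of p "bracket A u v p"] anchor_section_def
    by simp
qed

lemma graph_map_linear:
  assumes "a \<in> fib A p"
  shows graph_map_add: "b \<in> fib A p \<Longrightarrow> \<phi> p (a + b) = \<phi> p a + \<phi> p b"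
    and graph_map_scale: "\<phi> p (c *\<^sub>R a) = c *\<^sub>R \<phi> p a"
  using linear_graph_map[of p] assms unfolding linear_over_def by blast+

lemma lie_algebroid_B: "lie_algebroid M B"
  unfolding lie_algebroid_def
proof (intro conjI ballI)
  show "vector_bundle M B" by (fact vector_bundle_B)
  show "vb_map M B (tangent_bundle M) (anchor B)"
  proof (rule vb_mapI)
    show "anchor B p a \<in> fib (tangent_bundle M) p" if "a \<in> fib B p" for p a
      using that graph_subset[of p] by (auto simp: higher_TM_simps tangent_bundle_def)
    show "linear_over (fib B p) (anchor B p)" for p by (simp add: linear_over_def)
    fix U \<psi> V \<theta> j i
    assume U: "(U, \<psi>) \<in> triv B" and V: "(V, \<theta>) \<in> triv (tangent_bundle M)"
      and j: "j \<in> idx B" and i: "i \<in> idx (tangent_bundle M)"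
    obtain e where e: "local_frame M E r L U e"
      "\<And>p j. p \<in> U \<Longrightarrow> j < r \<Longrightarrow> frame_vec (subbundle M E r L) \<psi> p j = e j p"
      by (rule subbundle_triv[OF U[unfolded subbundle_algebroid_simps]]) (rule that)
    have j: "j < r" using j by simp
    have "open V" using V chart_open by (auto simp: tangent_bundle_def)
    \<comment> \<open>A frame of the subbundle consists of smooth sections of the ambient bundle, so
      its first components are smooth vector fields.\<close>
    have "smooth_on M (V \<inter> U) (\<lambda>p. \<theta> p (fst (e j p)) i)"
      using smooth_sectionD(2)[OF smooth_section_fst[OF local_frameD(2)[OF e(1) j]] V i] .
    then have "smooth_on M (U \<inter> V) (\<lambda>p. \<theta> p (fst (e j p)) i)" by (simp add: Int_commute)
    then show "smooth_on M (U \<inter> V) (\<lambda>p. \<theta> p (anchor B p (frame_vec B \<psi> p j)) i)"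
      by (rule smooth_on_cong[rotated])
        (use e(2)[OF _ j] local_frameD(1)[OF e(1)] \<open>open V\<close> in auto)
  qed
next
  fix s t assume s: "s \<in> sections M B" and t: "t \<in> sections M B"
  obtain u where u: "u \<in> sections M A" "s = (\<lambda>p. \<phi> p (u p))" using graph_sectionE[OF s] .
  obtain v where v: "v \<in> sections M A" "t = (\<lambda>p. \<phi> p (v p))" using graph_sectionE[OF t] .
  note br = courant_bracket_graph and sec = bracket_section
  have fib: "u p \<in> fib A p" if "u \<in> sections M A" for u p using sections_in_fib[OF that] .
  have st: "bracket B s t = (\<lambda>p. \<phi> p (bracket A u v p))"
    using br[OF u(1) v(1)] by (simp add: u v)
  show "bracket B s t \<in> sections M B"
    unfolding st by (rule graph_section[OF sec[OF u(1) v(1)]])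
  show "bracket B s t = - bracket B t s"
  proof
    fix p
    have "\<phi> p (bracket A u v p) = \<phi> p ((-1) *\<^sub>R bracket A v u p)"
      using fun_cong[OF bracket_skew[OF u(1) v(1)], of p] by simp
    also have "\<dots> = (-1) *\<^sub>R \<phi> p (bracket A v u p)"
      by (rule graph_map_scale[OF fib[OF sec[OF v(1) u(1)]]])
    finally show "bracket B s t p = (- bracket B t s) p"
      using br[OF u(1) v(1)] br[OF v(1) u(1)] by (simp add: u v)
  qed
  show "\<forall>c. bracket B s (c *\<^sub>R t) = c *\<^sub>R bracket B s t"
  proof (intro allI ext)
    fix c p
    have "c *\<^sub>R t = (\<lambda>p. \<phi> p ((c *\<^sub>R v) p))"
      by (simp add: v scaleR_fun_def graph_map_scale[OF fib[OF v(1)]])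
    then have "bracket B s (c *\<^sub>R t) = (\<lambda>p. \<phi> p (bracket A u (c *\<^sub>R v) p))"
      using br[OF u(1) sections_scale[OF vector_bundle_A v(1)]] by (simp add: u)
    then show "bracket B s (c *\<^sub>R t) p = (c *\<^sub>R bracket B s t) p"
      unfolding st bracket_scale[OF u(1) v(1)]
      by (simp add: scaleR_fun_def graph_map_scale[OF fib[OF sec[OF u(1) v(1)]]])
  qed
  show "\<forall>f. smooth_on M UNIV f \<longrightarrow> bracket B s (\<lambda>p. f p *\<^sub>R t p) =
      (\<lambda>p. f p *\<^sub>R bracket B s t p + anchor B p (s p) f *\<^sub>R t p)"
  proof (intro allI impI)
    fix f assume f: "smooth_on M UNIV f"
    have "(\<lambda>p. f p *\<^sub>R t p) = (\<lambda>p. \<phi> p (f p *\<^sub>R v p))"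
      by (simp add: v graph_map_scale[OF fib[OF v(1)]])
    then have "bracket B s (\<lambda>p. f p *\<^sub>R t p) = (\<lambda>p. \<phi> p (bracket A u (\<lambda>p. f p *\<^sub>R v p) p))"
      using br[OF u(1) sections_mult[OF vector_bundle_A v(1) f]] by (simp add: u)
    also have "\<dots> = (\<lambda>p. \<phi> p (f p *\<^sub>R bracket A u v p + anchor A p (u p) f *\<^sub>R v p))"
      by (simp only: bracket_leibniz[OF u(1) v(1) f])
    also have "\<dots> = (\<lambda>p. f p *\<^sub>R \<phi> p (bracket A u v p) + anchor A p (u p) f *\<^sub>R \<phi> p (v p))"
      by (simp add: graph_map_add graph_map_scale fib[OF v(1)] fib[OF sec[OF u(1) v(1)]]
          subspace_scale[OF subspace_fib])
    finally show "bracket B s (\<lambda>p. f p *\<^sub>R t p) =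
      (\<lambda>p. f p *\<^sub>R bracket B s t p + anchor B p (s p) f *\<^sub>R t p)"
      unfolding st by (simp add: u v)
  qed
  \<comment> \<open>The anchor is the first projection, and the first component of the
    Courant--Dorfman bracket is the Lie bracket by definition.\<close>
  show "anchor_section B (bracket B s t) = lie_bracket M (anchor_section B s) (anchor_section B t)"
    by (simp add: anchor_section_def courant_bracket_def)
  fix w' assume "w' \<in> sections M B"
  then obtain w where w: "w \<in> sections M A" "w' = (\<lambda>p. \<phi> p (w p))" by (rule graph_sectionE)
  have "t + w' = (\<lambda>p. \<phi> p ((v + w) p))"
    by (simp add: v w fun_eq_iff graph_map_add fib)
  then have "bracket B s (t + w') = (\<lambda>p. \<phi> p (bracket A u (v + w) p))"
    using br[OF u(1) sections_add[OF vector_bundle_A v(1) w(1)]] by (simp add: u)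
  then show "bracket B s (t + w') = bracket B s t + bracket B s w'"
    using br[OF u(1) w(1)] br[OF u(1) v(1)]
    by (simp add: u v w fun_eq_iff bracket_add[OF u(1) v(1) w(1)] graph_map_add
        fib[OF sec[OF u(1) v(1)]] fib[OF sec[OF u(1) w(1)]])
  \<comment> \<open>Nested brackets are pulled back under \<phi> as a whole; the three terms are
    then added there by linearity and cancel by the Jacobi identity of \<open>A\<close>.\<close>
  have triple: "bracket B (\<lambda>p. \<phi> p (x p)) (bracket B (\<lambda>p. \<phi> p (y p)) (\<lambda>p. \<phi> p (z p))) =
      (\<lambda>p. \<phi> p (bracket A x (bracket A y z) p))"
    if "x \<in> sections M A" "y \<in> sections M A" "z \<in> sections M A" for x y z
    using br[OF that(2,3)] br[OF that(1) sec[OF that(2,3)]] by simp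
  let ?J = "\<lambda>x y z. bracket A x (bracket A y z)"
  show "bracket B s (bracket B t w') + bracket B t (bracket B w' s) + bracket B w' (bracket B s t) = 0"
  proof
    fix p
    have J: "?J x y z p \<in> fib A p" if "x \<in> sections M A" "y \<in> sections M A" "z \<in> sections M A" for x y z
      using fib[OF sec[OF that(1) sec[OF that(2,3)]]] .
    have "\<phi> p (?J u v w p) + \<phi> p (?J v w u p) + \<phi> p (?J w u v p) =
        \<phi> p (?J u v w p + ?J v w u p + ?J w u v p)"
      using J u(1) v(1) w(1) subspace_add[OF subspace_fib] by (simp add: graph_map_add)
    also have "\<dots> = \<phi> p 0"
      using fun_cong[OF bracket_jacobi[OF u(1) v(1) w(1)], of p] by simp
    also have "\<dots> = 0" by (rule linear_over_0[OF linear_graph_map subspace_fib])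
    finally show "(bracket B s (bracket B t w') + bracket B t (bracket B w' s) +
        bracket B w' (bracket B s t)) p = 0 p"
      unfolding u(2) v(2) w(2) triple[OF u(1) v(1) w(1)] triple[OF v(1) w(1) u(1)] triple[OF w(1) u(1) v(1)]
      by simp
  qed
qed

lemma lie_algebroid_iso_graph: "lie_algebroid_iso M A B \<phi>"
  unfolding lie_algebroid_iso_def
  using lie_algebroid lie_algebroid_B vb_iso_graph courant_bracket_graph by simp

section \<open>Isotropy, involutivity and the orthogonal complement\<close>

lemma isotropic_graph: "isotropic M k L"
  unfolding isotropic_def
proof
  fix p
  have "pairing (\<phi> p a) (\<phi> p b) = 0" if ab: "a \<in> fib A p" "b \<in> fib A p" for a b
  proof -
    obtain u v where uv: "u \<in> sections M A" "u p = a" "v \<in> sections M A" "v p = b"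
      using section_through[OF vector_bundle_A ab(1)] section_through[OF vector_bundle_A ab(2)] by metis
    show ?thesis using IM_skew[OF uv(1,3), of p] uv(2,4) by (simp add: pairing_def)
  qed
  then show "L p \<subseteq> perp M k L p"
    using graph_subset[of p] by (auto simp: perp_def graph_def)
qed

text \<open>Sections of the image come from sections of \<open>A\<close>, and their bracket comes
  from the bracket in \<open>A\<close>.\<close>

lemma involutive_graph: "involutive M k r L"
  unfolding involutive_def sections_subbundle_algebroid[symmetric]
proof (intro ballI)
  fix s t assume "s \<in> sections M B" "t \<in> sections M B"
  then show "courant_bracket M k s t \<in> sections M B"
    by (elim graph_sectionE) (simp add: courant_bracket_graph graph_section bracket_section)
qed

text \<open>A vector \<open>(X, 0)\<close> pairs with \<open>\<phi> p a\<close> to the contraction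
  of \<open>\<mu> p a\<close> by \<open>X\<close>, so this is the second nondegeneracy condition on
  \<mu>.\<close>

lemma perp_graph_Int_tangent: "perp M k L p \<inter> (tangent_space M p \<times> {0}) = {0}"
proof -
  have "pairing (X, 0) (\<phi> p a) = contract X (\<mu> p a)" for X a
    by (simp add: pairing_def contract_def fun_eq_iff)
  then have "perp M k L p \<inter> (tangent_space M p \<times> {0}) =
      {X \<in> tangent_space M p. \<forall>a\<in>fib A p. contract X (\<mu> p a) = 0} \<times> {0}"
    using subspace_0[OF subspace_ext_power, of k p]
    by (auto simp: perp_def higher_TM_simps graph_def)
  then show ?thesis unfolding nondegenerate by (simp add: zero_prod_def)
qed

end

theorem proposition5p1:
  fixes M :: "('m::{t2_space, second_countable_topology}) manifold"
    and A :: "('m, 'a::real_vector, 'i) lie_algebroid"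
    and \<mu> :: "'m \<Rightarrow> 'a \<Rightarrow> 'm form"
    and k :: nat
  assumes "k \<ge> 1"
    and "smooth_manifold M"
    and "lie_algebroid M A"
    and "k_poisson M k A \<mu>"
  shows "\<exists>(r::nat) (L :: 'm \<Rightarrow> 'm gvec set).
    is_subbundle M (higher_TM M k) r L \<and>
    isotropic M k L \<and>
    involutive M k r L \<and>
    (\<forall>p. perp M k L p \<inter> (tangent_space M p \<times> {0}) = {0}) \<and>
    IM_equivalent M A \<mu> (subbundle_algebroid M k r L) (\<lambda>p. snd)"
proof -
  interpret k_poisson_mfd M k A \<mu>
    by unfold_locales (fact assms)+
  have "IM_equivalent M A \<mu> B (\<lambda>p. snd)"
    unfolding IM_equivalent_def using lie_algebroid_iso_graph by (intro exI[of _ \<phi>]) simp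
  then show ?thesis
    using is_subbundle_graph isotropic_graph involutive_graph perp_graph_Int_tangent by blast
qed

end
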